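(* Let either the sign be $+$ and $n\ge4$ even, or the sign be $-$ and $n\ge3$ odd; put $\eta=\pm1$ accordingly, and write $A=A_4^{\pm}(n,q)$, $B=B_4^{\pm}(n,q)$, $N=N_4^{\pm}(n,q)=|DC_4^{\pm}(n,q)|$. Then $N=AB$ and for every integer $h\ge1$, $$\eta^h\,SK^{2h}=-\sum_{l=0}^{h-1}\eta^l\binom hl \bigl(B+\eta(q^2-q)\bigr)^{h-l}SK^{2l}+qA^{-h}\sum_{j=0}^{\min\{N,h\}}(-1)^jC_j\sum_{t=j}^h t!\,S(h,t)\,3^{h-t}2^{t-h-j-1}\binom{N-j}{N-t},$$ where $\{C_j\}_{j=0}^N$ is the weight distribution of the ternary code $C(DC_4^{\pm}(n,q))$.
   Context: Let $q=3^s$, $\mathrm{tr}:\mathbb F_q\to\mathbb F_3$ the absolute trace, $\lambda(x)=e^{2\pi i\,\mathrm{tr}(x)/3}$. $K(\psi;a)=\sum_{\alpha\in\mathbb F_q^*}\psi(\alpha+a\alpha^{-1})$. For $h\ge0$, $SK^h=\sum_{a\in\mathbb F_q^*,\,a\text{ square}}K(\lambda;a)^h$. $S(h,t)=\frac1{t!}\sum_{j=0}^t(-1)^{t-j}\binom tj j^h$. Fix a nonsquare $\epsilon\in\mathbb F_q^*$, $\delta_\epsilon=\mathrm{diag}(1,-\epsilon)$, $J=\begin{bmatrix}0&1_{n-1}&0\\1_{n-1}&0&0\\0&0&\delta_\epsilon\end{bmatrix}$, $O^-(2n,q)=\{w\in GL(2n,q):{}^twJw=J\}$, $SO^-(2n,q)$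 its determinant-one subgroup. $Q=Q(2n,q)$ is the set of products $\begin{bmatrix}A&0&0\\0&{}^tA^{-1}&0\\0&0&i\end{bmatrix}\begin{bmatrix}1_{n-1}&B&-{}^th\delta_\epsilon\\0&1_{n-1}&0\\0&h&1_2\end{bmatrix}$ with $A\in GL(n-1,q)$, $i\in SO^-(2,q)$, ${}^tB+B+{}^th\delta_\epsilon h=0$. $\rho=\mathrm{diag}(1_{n-1},1_{n-1},1,-1)$. For $0\le r\le n-1$, $\sigma_r=\begin{bmatrix}0&0&1_r&0&0\\0&1_{n-1-r}&0&0&0\\1_r&0&0&0&0\\0&0&0&1_{n-1-r}&0\\0&0&0&0&1_2\end{bmatrix}$. $DC_4^{\pm}(n,q)=\rho Q\sigma_{n-3}Q=\{\rho x\sigma_{n-3}y:x,y\in Q\}$ (sign $+$ for $n$ even, $-$ for $n$ odd). Constants (empty products $=1$, $\left[{m\atop 2}\right]_q=\frac{(q^m-1)(q^{m-1}-1)}{(q^2-1)(q-1)}$): $A_4^+(n,q)=(q+1)q^{(5n^2-6n-4)/4}\left[{n-1\atop2}\right]_q\prod_{j=1}^{(n-2)/2}(q^{2j-1}-1)$, $B_4^+(n,q)=q^{(n-2)^2/4}(q^{n-1}-1)\prod_{j=1}^{(n-2)/2}(q^{2j}-1)$; $A_4^-(n,q)=(q+1)q^{(5n^2-4n-9)/4}\left[{n-1\atop2}\right]_q\prod_{j=1}^{(n-3)/2}(q^{2j-1}-1)$, $B_4^-(n,q)=q^{(n-3)^2/4}(q^{n-2}-1)(q^{n-1}-1)\prod_{j=1}^{(n-3)/2}(q^{2j}-1)$.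 Code: fix an ordering $g_1,\dots,g_N$ of $D=DC_4^{\pm}(n,q)$; $C(D)=\{u\in\mathbb F_3^N:\sum_j u_j\mathrm{Tr}(g_j)=0\text{ in }\mathbb F_q\}$; $C_j$ = number of codewords of Hamming weight $j$. *)

theory Defs
  imports "HOL-Analysis.Analysis" "HOL-Combinatorics.Stirling"
    "Jordan_Normal_Form.Determinant"
begin

definition ext_deg :: "'a::{finite,field} itself \<Rightarrow> nat" where
  "ext_deg _ = (THE s. CARD('a) = 3 ^ s)"

text \<open>Absolute trace tr : F_q \<rightarrow> F_3 (values lie in the prime field).\<close>
definition abs_tr :: "'a::{finite,field} \<Rightarrow> 'a" where
  "abs_tr x = (\<Sum>i<ext_deg TYPE('a). x ^ (3 ^ i))"

definition tr_val :: "'a::{finite,field} \<Rightarrow> nat" where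
  "tr_val x = (THE k. k < 3 \<and> of_nat k = abs_tr x)"

definition lam :: "'a::{finite,field} \<Rightarrow> complex" where
  "lam x = exp (2 * pi * \<i> * of_nat (tr_val x) / 3)"

definition Kl :: "'a::{finite,field} \<Rightarrow> complex" where
  "Kl a = (\<Sum>\<alpha>\<in>UNIV - {0}. lam (\<alpha> + a * inverse \<alpha>))"

definition SK :: "'a::{finite,field} itself \<Rightarrow> nat \<Rightarrow> complex" where
  "SK _ h = (\<Sum>a\<in>{a::'a. a \<noteq> 0 \<and> (\<exists>b. a = b * b)}. Kl a ^ h)"

definition mat_tr :: "'a::comm_ring_1 mat \<Rightarrow> 'a" where
  "mat_tr M = (\<Sum>i<dim_row M. M $$ (i, i))"

definition GL :: "nat \<Rightarrow> 'a::field mat set" where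
  "GL m = {w \<in> carrier_mat m m. det w \<noteq> 0}"

text \<open>Block index helpers for the block decomposition (m, m, 2) of size 2m+2.\<close>
definition bidx :: "nat \<Rightarrow> nat \<Rightarrow> nat" where
  "bidx m i = (if i < m then 0 else if i < 2 * m then 1 else 2)"
definition bofs :: "nat \<Rightarrow> nat \<Rightarrow> nat" where
  "bofs m i = (if i < m then i else if i < 2 * m then i - m else i - 2 * m)"

definition blk3 :: "nat \<Rightarrow> 'a mat list list \<Rightarrow> 'a mat" where
  "blk3 m Ms = mat (2 * m + 2) (2 * m + 2)
     (\<lambda>(i, j). (Ms ! bidx m i ! bidx m j) $$ (bofs m i, bofs m j))"

definition delta_eps :: "'a::field \<Rightarrow> 'a mat" where
  "delta_eps \<epsilon> = mat 2 2 (\<lambda>(i, j). if i = j then (if i = 0 then 1 else - \<epsilon>) else 0)"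

definition Jmat :: "nat \<Rightarrow> 'a::field \<Rightarrow> 'a mat" where
  "Jmat n \<epsilon> = blk3 (n - 1)
     [[0\<^sub>m (n-1) (n-1), 1\<^sub>m (n-1), 0\<^sub>m (n-1) 2],
      [1\<^sub>m (n-1), 0\<^sub>m (n-1) (n-1), 0\<^sub>m (n-1) 2],
      [0\<^sub>m 2 (n-1), 0\<^sub>m 2 (n-1), delta_eps \<epsilon>]]"

text \<open>O^-(2n,q) and SO^-(2,q) (the latter is O^- for n = 1, where J = delta_eps).\<close>
definition Ominus :: "nat \<Rightarrow> 'a::field \<Rightarrow> 'a mat set" where
  "Ominus n \<epsilon> = {w \<in> GL (2 * n). transpose_mat w * Jmat n \<epsilon> * w = Jmat n \<epsilon>}"

definition SOminus2 :: "'a::field \<Rightarrow> 'a mat set" where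
  "SOminus2 \<epsilon> = {w \<in> GL 2. transpose_mat w * delta_eps \<epsilon> * w = delta_eps \<epsilon> \<and> det w = 1}"

text \<open>The maximal parabolic subgroup Q(2n,q). A' is the inverse of A, so
  transpose A' = (transpose A)^{-1}.\<close>
definition Qgrp :: "nat \<Rightarrow> 'a::field \<Rightarrow> 'a mat set" where
  "Qgrp n \<epsilon> = {blk3 (n - 1)
        [[A, 0\<^sub>m (n-1) (n-1), 0\<^sub>m (n-1) 2],
         [0\<^sub>m (n-1) (n-1), transpose_mat A', 0\<^sub>m (n-1) 2],
         [0\<^sub>m 2 (n-1), 0\<^sub>m 2 (n-1), i]]
      * blk3 (n - 1)
        [[1\<^sub>m (n-1), B, - (transpose_mat h * delta_eps \<epsilon>)],
         [0\<^sub>m (n-1) (n-1), 1\<^sub>m (n-1), 0\<^sub>m (n-1) 2],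
         [0\<^sub>m 2 (n-1), h, 1\<^sub>m 2]]
     | A A' i B h. A \<in> GL (n - 1) \<and> A' \<in> carrier_mat (n-1) (n-1) \<and> A * A' = 1\<^sub>m (n-1)
        \<and> i \<in> SOminus2 \<epsilon> \<and> B \<in> carrier_mat (n-1) (n-1) \<and> h \<in> carrier_mat 2 (n-1)
        \<and> transpose_mat B + B + transpose_mat h * delta_eps \<epsilon> * h = 0\<^sub>m (n-1) (n-1)}"

definition rho_mat :: "nat \<Rightarrow> 'a::field mat" where
  "rho_mat n = mat (2 * n) (2 * n) (\<lambda>(i, j). if i = j then (if i = 2 * n - 1 then -1 else 1) else 0)"

definition sw :: "nat \<Rightarrow> nat \<Rightarrow> nat \<Rightarrow> nat" where
  "sw n r i = (if i < r then i + (n - 1) else if n - 1 \<le> i \<and> i < n - 1 + r then i - (n - 1) else i)"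

definition sigma_mat :: "nat \<Rightarrow> nat \<Rightarrow> 'a::field mat" where
  "sigma_mat n r = mat (2 * n) (2 * n) (\<lambda>(i, j). if j = sw n r i then 1 else 0)"

definition DC4 :: "nat \<Rightarrow> 'a::field \<Rightarrow> 'a mat set" where
  "DC4 n \<epsilon> = {rho_mat n * x * sigma_mat n (n - 3) * y | x y. x \<in> Qgrp n \<epsilon> \<and> y \<in> Qgrp n \<epsilon>}"

text \<open>Codewords indexed by the elements of D (equivalent to fixing an ordering g_1..g_N);
  entries in F_3 are represented by 0,1,2.\<close>
definition code_C :: "'a::{finite,field} mat set \<Rightarrow> ('a mat \<Rightarrow> nat) set" where
  "code_C D = {u. u \<in> D \<rightarrow>\<^sub>E {0..<3} \<and> (\<Sum>g\<in>D. of_nat (u g) * mat_tr g) = (0::'a)}"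

definition wt :: "'a mat set \<Rightarrow> ('a mat \<Rightarrow> nat) \<Rightarrow> nat" where
  "wt D u = card {g \<in> D. u g \<noteq> 0}"

definition weight_dist :: "'a::{finite,field} mat set \<Rightarrow> nat \<Rightarrow> nat" where
  "weight_dist D j = card {u \<in> code_C D. wt D u = j}"

definition gauss2 :: "nat \<Rightarrow> nat \<Rightarrow> real" where
  "gauss2 q m = ((real q ^ m - 1) * (real q ^ (m - 1) - 1)) / ((real q ^ 2 - 1) * (real q - 1))"

definition A4plus :: "nat \<Rightarrow> nat \<Rightarrow> real" where
  "A4plus n q = (real q + 1) * real q ^ nat ((5 * int n ^ 2 - 6 * int n - 4) div 4) * gauss2 q (n - 1)
     * (\<Prod>j\<in>{1..(n - 2) div 2}. real q ^ (2 * j - 1) - 1)"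

definition B4plus :: "nat \<Rightarrow> nat \<Rightarrow> real" where
  "B4plus n q = real q ^ ((n - 2) ^ 2 div 4) * (real q ^ (n - 1) - 1)
     * (\<Prod>j\<in>{1..(n - 2) div 2}. real q ^ (2 * j) - 1)"

definition A4minus :: "nat \<Rightarrow> nat \<Rightarrow> real" where
  "A4minus n q = (real q + 1) * real q ^ nat ((5 * int n ^ 2 - 4 * int n - 9) div 4) * gauss2 q (n - 1)
     * (\<Prod>j\<in>{1..(n - 3) div 2}. real q ^ (2 * j - 1) - 1)"

definition B4minus :: "nat \<Rightarrow> nat \<Rightarrow> real" where
  "B4minus n q = real q ^ ((n - 3) ^ 2 div 4) * (real q ^ (n - 2) - 1) * (real q ^ (n - 1) - 1)
     * (\<Prod>j\<in>{1..(n - 3) div 2}. real q ^ (2 * j) - 1)"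

end

theory Submission
  imports Defs "HOL-Number_Theory.Cong"
begin

text \<open>
  Write \<open>D\<close> for the double coset and \<open>w(a)\<close> for the number of \<open>g\<close> in \<open>D\<close> with
  \<open>\<lambda>(a Tr g) \<noteq> 1\<close>, the weight of a codeword of the dual code. Expanding the indicator of
  \<open>\<lambda>(x) \<noteq> 1\<close> into characters turns \<open>\<Sum>\<^sub>a w(a)\<^sup>h\<close> into a sum over the code itself (the power moment
  identity of Pless), so that it remains to show \<open>w(a) = 2A/3 (B + \<eta>(q\<^sup>2 - q) + \<eta> K(a\<^sup>2)\<^sup>2)\<close> for
  \<open>a \<noteq> 0\<close>, with the constants \<open>A\<close>, \<open>B\<close> of the theorem.

  Put \<open>\<sigma> = \<sigma>\<^sub>r\<close> with \<open>r = n - 3\<close>. The map \<open>(x, y) \<mapsto> x\<sigma>y\<close> on \<open>Q \<times> Q\<close> has fibres of size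
  \<open>|Q \<inter> \<sigma>Q\<sigma>|\<close>, and \<open>\<rho>\<close> normalises \<open>Q\<close>, so the character sum over \<open>D\<close> is
  \<open>|Q| / |Q \<inter> \<sigma>Q\<sigma>|\<close> times the sum of \<open>\<lambda>(a Tr(\<rho>x\<sigma>))\<close> over \<open>x\<close> in \<open>Q\<close>. In characteristic
  three the condition on the unipotent factor of \<open>x\<close> says that its upper middle block minus \<open>h\<^sup>T\<delta>h\<close> is
  skew-symmetric. Summing over this skew-symmetric part forces the Levi factor in \<open>GL(n - 1, q)\<close> to have
  a vanishing upper right \<open>r \<times> 2\<close> block and a symmetric upper left block. The sum over \<open>h\<close> then
  gives \<open>(-q)\<^sup>r\<close>, because the binary form \<open>u\<^sup>2 - \<epsilon>v\<^sup>2\<close> is anisotropic, and the lower right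
  \<open>2 \<times> 2\<close> block contributes a Kloosterman sum for \<open>GL(2, q)\<close>.
\<close>

subsection \<open>Finite fields of characteristic three\<close>

text \<open>The choice of \<rho> removes the factor in SO^-(2,q) from the sum: the corresponding
  block of \<rho>x\<sigma> is a reflection, of trace zero, so this factor only contributes its order
  q + 1. The value of the sum over h does not depend on which invertible symmetric block occurs,
  because an anisotropic plane contributes -q whatever its scaling. Hence no quadratic character
  appears, the symmetric blocks only have to be counted, and \<eta> = (-1)^(r + 1) is the sign of
  (-q)^r, reversed by passing from \<lambda>(x) = 1 to \<lambda>(x) \<noteq> 1.

  B turns out to be |GL(r + 2, q)| divided by q^(r + 1) and by the number of invertible symmetric r
  x r matrices. The term q^2 - q next to it comes from the elements of GL(2, q) with nonzero lower
  left entry. Finally, a enters the weight only through a^2, and squaring is two-to-one on nonzero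
  elements in odd characteristic; this is why the moments run over squares and why the exponent of 2
  contains a -1.\<close>

lemma three_eq_0: "CHAR('a::{finite,field}) = 3 \<Longrightarrow> (3::'a) = 0"
  using of_nat_CHAR[where 'a='a] by simp

text \<open>Without this the description in \<open>ext_deg\<close> would not denote. A largest
  additively closed subset H whose size is a power of 3 must be the whole field: an element z
  outside H yields the disjoint cosets z + H and 2z + H, and the three cosets together are again
  closed because 3z = 0.\<close>

lemma card_eq_power_three:
  assumes "CHAR('a::{finite,field}) = 3"
  shows "\<exists>s. CARD('a) = 3 ^ s"
proof -
  have three: "x + x + x = 0" for x :: 'a
  proof -
    have "x + x + x = 3 * x" by (simp add: mult_2[symmetric] distrib_right[symmetric])
    then show ?thesis using three_eq_0[OF assms] by simp
  qed
  define sub where "sub H \<longleftrightarrow> 0 \<in> H \<and> (\<forall>x\<in>H. \<forall>y\<in>H. x + y \<in> H) \<and> (\<exists>k. card H = 3 ^ k)"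
    for H :: "'a set"
  have "card {0::'a} = 3 ^ 0" by simp
  then have "sub {0}" unfolding sub_def by (metis add_0 singletonD singletonI)
  moreover have "\<forall>H. sub H \<longrightarrow> card H < Suc CARD('a)"
    by (simp add: card_mono less_Suc_eq_le)
  ultimately obtain H where H: "sub H" and max: "\<And>H'. sub H' \<Longrightarrow> card H' \<le> card H"
    using ex_has_greatest_nat[of sub "{0}" card "Suc CARD('a)"] by metis
  obtain k where k: "card H = 3 ^ k" and H0: "0 \<in> H" and Hadd: "\<And>x y. x \<in> H \<Longrightarrow> y \<in> H \<Longrightarrow> x + y \<in> H"
    using H by (auto simp: sub_def)
  have Hneg: "- x \<in> H" if "x \<in> H" for x
  proof -
    have "- x = x + x" using three[of x] by (metis add_eq_0_iff minus_minus)
    then show ?thesis using Hadd[OF that that] by metis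
  qed
  have "H = UNIV"
  proof (rule ccontr)
    assume "H \<noteq> UNIV"
    then obtain z where z: "z \<notin> H" by auto
    have z2: "z + z \<notin> H"
    proof
      assume "z + z \<in> H"
      from this this have "(z + z) + (z + z) \<in> H" by (rule Hadd)
      moreover have "(z + z) + (z + z) = z" using three[of z] by (metis add.assoc add_0)
      ultimately show False using z by metis
    qed
    define G where "G = H \<union> (+) z ` H \<union> (+) (z + z) ` H"
    have disj: "H \<inter> (+) w ` H = {}" if w: "w \<notin> H" for w
    proof -
      have False if "y \<in> H" "w + y \<in> H" for y
        using Hadd[OF that(2) Hneg[OF that(1)]] w by simp
      then show ?thesis by blast
    qed
    note d1 = disj[OF z] and d2 = disj[OF z2]
    have d3: "(+) z ` H \<inter> (+) (z + z) ` H = {}"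
    proof -
      have False if "x \<in> H" "y \<in> H" "z + x = (z + z) + y" for x y
      proof -
        have "x = z + y" using that by (simp add: add.assoc)
        then show False using d1 that by auto
      qed
      then show ?thesis by blast
    qed
    have "card G = card H + card H + card H"
      unfolding G_def using d1 d2 d3
      by (simp add: card_Un_disjoint card_image Int_Un_distrib2)
    then have c: "card G = 3 ^ Suc k" using k by simp
    have G_iff: "a \<in> G \<longleftrightarrow> (\<exists>i\<in>{0, z, z + z}. \<exists>x\<in>H. a = i + x)" for a
      unfolding G_def by (simp add: image_iff disj_assoc)
    have "a + b \<in> G" if ab: "a \<in> G" "b \<in> G" for a b
    proof -
      obtain i x where i: "i \<in> {0, z, z + z}" "x \<in> H" "a = i + x" using ab(1) unfolding G_iff by metis
      obtain j y where j: "j \<in> {0, z, z + z}" "y \<in> H" "b = j + y" using ab(2) unfolding G_iff by metis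
      have s: "a + b = (i + j) + (x + y)" using i j by (simp add: algebra_simps)
      have "i + j \<in> {0, z, z + z}"
      proof -
        have "z + (z + z) = 0" "(z + z) + z = 0" "(z + z) + (z + z) = z"
          using three[of z] by (metis add.assoc add_0)+
        then show ?thesis using i(1) j(1) by (elim insertE emptyE) (simp_all del: mult_2 one_add_one)
      qed
      then show ?thesis unfolding s G_iff using Hadd[OF i(2) j(2)] by metis
    qed
    moreover have "0 \<in> G" using H0 by (simp add: G_def)
    ultimately have "sub G" using c unfolding sub_def by blast
    from max[OF this] show False using c k by simp
  qed
  then show ?thesis using k by auto
qed

text \<open>Multiplication by a nonzero x permutes the nonzero elements, so their product is
  unchanged by the factor x^(q - 1).\<close>

lemma finite_field_power_card: "(x::'a::{finite,field}) ^ CARD('a) = x"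
proof (cases "x = 0")
  case False
  have b: "bij_betw ((*) x) (UNIV - {0}) (UNIV - {0})"
    by (rule bij_betw_byWitness[of _ "\<lambda>y. y / x"]) (use False in auto)
  have "(\<Prod>y\<in>UNIV - {0}. y) = (\<Prod>y\<in>UNIV - {0}. x * y)"
    by (rule prod.reindex_bij_betw[OF b, symmetric])
  also have "\<dots> = x ^ (CARD('a) - 1) * (\<Prod>y\<in>UNIV - {0}. y)"
    by (simp add: prod.distrib card_Diff_singleton)
  finally have "x ^ (CARD('a) - 1) = 1" by simp
  then have "x ^ Suc (CARD('a) - 1) = x" by (simp only: power_Suc mult_1_right)
  moreover have "Suc (CARD('a) - 1) = CARD('a)" by simp
  ultimately show ?thesis by simp
qed (simp add: finite_UNIV_card_ge_0)

context
  assumes char3: "CHAR('a::{finite,field}) = 3"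
begin

lemma card_eq_power_ext_deg: "CARD('a) = 3 ^ ext_deg TYPE('a)"
  unfolding ext_deg_def
  by (rule theI') (use card_eq_power_three[OF char3] in \<open>auto simp: power_inject_exp\<close>)

lemma freshman_three: "(x + y :: 'a) ^ (3 ^ i) = x ^ (3 ^ i) + y ^ (3 ^ i)"
proof (induction i)
  case (Suc i)
  have c: "(a + b) ^ 3 = a ^ 3 + b ^ 3" for a b :: 'a
  proof -
    have "(a + b) ^ 3 = a ^ 3 + b ^ 3 + 3 * (a * a * b + a * b * b)"
      by (simp add: power3_eq_cube algebra_simps)
    then show ?thesis using three_eq_0[OF char3] by simp
  qed
  have "(x + y) ^ (3 ^ Suc i) = ((x + y) ^ (3 ^ i)) ^ 3"
    by (simp add: power_mult[symmetric] mult.commute)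
  also have "\<dots> = (x ^ 3 ^ i) ^ 3 + (y ^ 3 ^ i) ^ 3" by (simp only: Suc c)
  finally show ?case by (simp add: power_mult[symmetric] mult.commute)
qed simp

lemma abs_tr_add: "abs_tr (x + y) = abs_tr x + abs_tr (y::'a)"
  by (simp add: abs_tr_def freshman_three sum.distrib)

text \<open>Cubing shifts the summands of the trace by one place, and the last one returns to the
  first because x^(3^s) = x. So the trace is fixed by the Frobenius map and lies in the prime
  field.\<close>

lemma abs_tr_cube: "abs_tr x ^ 3 = abs_tr (x::'a)"
proof -
  define s where "s = ext_deg TYPE('a)"
  have cube_sum: "(\<Sum>i\<in>I. f i) ^ 3 = (\<Sum>i\<in>I. f i ^ 3)" if "finite I" for I :: "nat set" and f :: "nat \<Rightarrow> 'a"
    using that by induction (use freshman_three[of _ _ 1] in auto)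
  have "abs_tr x ^ 3 = (\<Sum>i<s. x ^ (3 ^ Suc i))"
    unfolding abs_tr_def s_def[symmetric] by (simp add: cube_sum power_mult[symmetric] mult.commute)
  also have "\<dots> = (\<Sum>i<s. x ^ 3 ^ i) + x ^ 3 ^ s - x ^ 3 ^ 0"
    using sum.lessThan_Suc_shift[of "\<lambda>i. x ^ 3 ^ i" s] sum.lessThan_Suc[of "\<lambda>i. x ^ 3 ^ i" s]
    by (simp add: algebra_simps)
  also have "\<dots> = abs_tr x"
    unfolding abs_tr_def s_def[symmetric]
    using finite_field_power_card[of x] card_eq_power_ext_deg by (simp add: s_def)
  finally show ?thesis .
qed

text \<open>A fixed point of cubing is a root of T^3 - T, which factors as T(T - 1)(T - 2) in
  characteristic three. Existence comes from this factorisation, uniqueness from the characteristic;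
  together they make the description in \<open>tr_val\<close> denote.\<close>

lemma of_nat_tr_val: "tr_val (x::'a) < 3" "of_nat (tr_val x) = abs_tr x"
proof -
  let ?t = "abs_tr x"
  have "?t * (?t - 1) * (?t - 2) = ?t ^ 3 - ?t - 3 * (?t * ?t - ?t)"
    by (simp add: power3_eq_cube algebra_simps)
  also have "\<dots> = 0" using abs_tr_cube three_eq_0[OF char3] by simp
  finally have "?t = of_nat 0 \<or> ?t = of_nat 1 \<or> ?t = of_nat 2" by auto
  then have "\<exists>k<3. of_nat k = ?t"
    by (elim disjE; intro exI[of _ 0] exI[of _ 1] exI[of _ 2]; simp)
  moreover have "k = l" if "k < 3" "l < 3" "of_nat k = (of_nat l :: 'a)" for k l
    using that of_nat_eq_iff_cong_CHAR[of k l, where 'a='a] char3 by (simp add: cong_def)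
  ultimately have "\<exists>!k. k < 3 \<and> of_nat k = ?t" by metis
  from theI'[OF this] show "tr_val x < 3" "of_nat (tr_val x) = ?t" by (auto simp: tr_val_def)
qed

lemma lam_eq_power: "lam x = exp (2 * of_real pi * \<i> / 3) ^ tr_val x"
  by (simp add: lam_def exp_of_nat_mult[symmetric] algebra_simps)

text \<open>\<open>tr_val\<close> is additive only modulo 3, which suffices because it is the
  exponent of a cube root of unity.\<close>

lemma lam_add: "lam (x + y) = lam x * lam (y::'a)"
proof -
  let ?w = "exp (2 * of_real pi * \<i> / 3) :: complex"
  have w3: "?w ^ 3 = 1" using exp_two_pi_i by (simp add: exp_of_nat_mult[symmetric] algebra_simps)
  have wmod: "?w ^ k = ?w ^ (k mod 3)" for k
  proof -
    have "?w ^ k = (?w ^ 3) ^ (k div 3) * ?w ^ (k mod 3)"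
      by (simp only: power_mult[symmetric] power_add[symmetric] mult_div_mod_eq)
    then show ?thesis by (simp only: w3 power_one mult_1)
  qed
  have "of_nat (tr_val (x + y)) = (of_nat (tr_val x + tr_val y) :: 'a)"
    by (simp add: of_nat_tr_val abs_tr_add)
  then have "tr_val (x + y) mod 3 = (tr_val x + tr_val y) mod 3"
    unfolding of_nat_eq_iff_cong_CHAR char3 cong_def .
  then have "?w ^ tr_val (x + y) = ?w ^ (tr_val x + tr_val y)"
    using wmod[of "tr_val (x + y)"] wmod[of "tr_val x + tr_val y"] by (simp only:)
  then show ?thesis unfolding lam_eq_power power_add[symmetric] .
qed

text \<open>If \<open>lam\<close> were constantly 1, every trace would be 0. But the trace is a
  nonzero polynomial of degree at most q/3, so it cannot vanish on all q elements.\<close>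

lemma lam_nontrivial: "\<exists>x::'a. lam x \<noteq> 1"
proof (rule ccontr)
  assume "\<not> ?thesis"
  then have l1: "lam x = 1" for x :: 'a by simp
  have tr0: "abs_tr x = 0" for x :: 'a
  proof -
    have "lam x = cis (2 * pi * real (tr_val x) / 3)"
      by (simp add: lam_def cis_conv_exp algebra_simps)
    then have "cos (2 * pi * real (tr_val x) / 3) = 1" using l1 by (simp add: complex_eq_iff)
    moreover have "cos (2 * pi / 3) = - (1 / 2 :: real)"
      using cos_60 cos_minus_pi[of "pi / 3"] cos_pi_minus[of "pi / 3"] by (simp add: field_simps)
    moreover have "cos (4 * pi / 3) = - (1 / 2 :: real)"
      using cos_60 cos_periodic_pi[of "pi / 3"] by (simp add: field_simps)
    ultimately have "tr_val x \<noteq> 1" "tr_val x \<noteq> 2" by (auto)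
    then have "tr_val x = 0" using of_nat_tr_val(1)[of x] by linarith
    then show ?thesis using of_nat_tr_val(2)[of x] by simp
  qed
  define s where "s = ext_deg TYPE('a)"
  have card: "CARD('a) = 3 ^ s" using card_eq_power_ext_deg by (simp add: s_def)
  have "CARD('a) \<noteq> 1" by (metis card_1_singletonE UNIV_I singletonD zero_neq_one)
  then obtain k where k: "s = Suc k" using card by (cases s) auto
  define p where "p = (\<Sum>i<s. monom (1::'a) (3 ^ i))"
  have "coeff p (3 ^ k) = 1"
    by (simp add: p_def coeff_sum k if_distrib[of "\<lambda>x. x = _"] cong: if_cong)
  then have p0: "p \<noteq> 0" by auto
  have "degree p \<le> 3 ^ k"
    unfolding p_def by (rule degree_sum_le) (auto intro!: order_trans[OF degree_monom_le] simp: k)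
  moreover have "poly p x = 0" for x
    using tr0[of x] by (simp add: p_def poly_sum poly_monom abs_tr_def s_def)
  then have "{x. poly p x = 0} = UNIV" by auto
  then have "CARD('a) \<le> degree p" using card_poly_roots_bound[OF p0] by simp
  moreover have "(0::nat) < 3 ^ k" by simp
  ultimately show False using card k by simp
qed

end

subsection \<open>Additive characters\<close>

text \<open>The assumption \<open>zero\<close> excludes the constant function 0, which satisfies the
  other two.\<close>

locale additive_character =
  fixes \<psi> :: "'a::{finite,field} \<Rightarrow> complex"
  assumes add: "\<psi> (x + y) = \<psi> x * \<psi> y"
    and zero [simp]: "\<psi> 0 = 1"
    and nontrivial: "\<exists>x. \<psi> x \<noteq> 1"
begin

lemma sum_eq_prod: "\<psi> (\<Sum>i\<in>I. f i) = (\<Prod>i\<in>I. \<psi> (f i))"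
  by (induction I rule: infinite_finite_induct) (auto simp: add)

lemma scale: "\<psi> (of_nat k * x) = \<psi> x ^ k"
  by (induction k) (auto simp: add algebra_simps)

text \<open>Orthogonality: translating x by y / c leaves the sum unchanged and multiplies it by
  \<open>\<psi> y\<close>, where y is chosen with \<open>\<psi> y\<close> different from 1.\<close>

lemma sum_mult: "(\<Sum>x\<in>UNIV. \<psi> (c * x)) = (if c = 0 then of_nat CARD('a) else 0)"
proof (cases "c = 0")
  case False
  obtain y where y: "\<psi> y \<noteq> 1" using nontrivial by auto
  have "(\<Sum>x\<in>UNIV. \<psi> (c * x)) = (\<Sum>x\<in>UNIV. \<psi> (c * (x + y / c)))"
    by (rule sum.reindex_bij_witness[of _ "\<lambda>x. x + y / c" "\<lambda>x. x - y / c"]) auto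
  also have "\<dots> = \<psi> y * (\<Sum>x\<in>UNIV. \<psi> (c * x))"
    using False by (simp add: distrib_left add sum_distrib_left mult.commute)
  finally show ?thesis using y False by simp
qed simp

end

subsection \<open>Power moments of the weights of a trace code\<close>

text \<open>\<open>fact t * (w choose t)\<close> is the falling factorial of w of length t.
  Multiplying it by w gives the falling factorial of length t + 1 plus t times itself, which is
  exactly the recursion of the Stirling numbers.\<close>

lemma power_eq_sum_Stirling:
  "(w::nat) ^ h = (\<Sum>t\<le>h. fact t * Stirling h t * (w choose t))"
proof (induction h)
  case (Suc h)
  have step: "w * (fact t * (w choose t)) = fact (Suc t) * (w choose Suc t) + t * (fact t * (w choose t))" for t
  proof (cases "t \<le> w")
    case True
    have "Suc t * (w choose Suc t) = (w - t) * (w choose t)"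
      by (metis binomial_absorb_comp binomial_absorption mult.commute)
    moreover have "fact (Suc t) * (w choose Suc t) = fact t * (Suc t * (w choose Suc t))"
      by (simp only: fact_Suc of_nat_id mult_ac)
    ultimately have "fact (Suc t) * (w choose Suc t) = (w - t) * (fact t * (w choose t))"
      by (simp only: mult_ac)
    then show ?thesis using True
      by (metis add_mult_distrib le_add_diff_inverse2)
  qed (simp add: binomial_eq_0)
  have "w ^ Suc h = (\<Sum>t\<le>h. Stirling h t * (w * (fact t * (w choose t))))"
    by (simp add: Suc sum_distrib_left algebra_simps)
  also have "\<dots> = (\<Sum>t\<le>h. fact (Suc t) * Stirling h t * (w choose Suc t))
      + (\<Sum>t\<le>h. fact t * (t * Stirling h t) * (w choose t))"
    unfolding step by (simp add: algebra_simps sum.distrib)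
  also have "(\<Sum>t\<le>h. fact t * (t * Stirling h t) * (w choose t))
      = (\<Sum>t\<le>Suc h. fact t * (t * Stirling h t) * (w choose t))"
    by simp
  also have "\<dots> = (\<Sum>t\<le>h. fact (Suc t) * (Suc t * Stirling h (Suc t)) * (w choose Suc t))"
    by (simp add: sum.atMost_Suc_shift del: sum.atMost_Suc fact_Suc)
  also have "(\<Sum>t\<le>h. fact (Suc t) * Stirling h t * (w choose Suc t)) + \<dots>
      = (\<Sum>t\<le>h. fact (Suc t) * Stirling (Suc h) (Suc t) * (w choose Suc t))"
    by (simp add: sum.distrib[symmetric] algebra_simps)
  also have "\<dots> = (\<Sum>t\<le>Suc h. fact t * Stirling (Suc h) t * (w choose t))"
    by (simp add: sum.atMost_Suc_shift del: sum.atMost_Suc fact_Suc)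
  finally show ?case .
qed simp

lemma card_supersets:
  assumes "finite D" "U \<subseteq> D" "card U \<le> t"
  shows "card {T. U \<subseteq> T \<and> T \<subseteq> D \<and> card T = t} = (card D - card U) choose (t - card U)"
proof -
  have "bij_betw (\<lambda>T. T - U) {T. U \<subseteq> T \<and> T \<subseteq> D \<and> card T = t} {V. V \<subseteq> D - U \<and> card V = t - card U}"
  proof (rule bij_betw_byWitness[of _ "\<lambda>V. V \<union> U"])
    show "(\<lambda>V. V \<union> U) ` {V. V \<subseteq> D - U \<and> card V = t - card U} \<subseteq> {T. U \<subseteq> T \<and> T \<subseteq> D \<and> card T = t}"
    proof safe
      fix V assume V: "V \<subseteq> D - U" "card V = t - card U"
      then have "card (V \<union> U) = card V + card U"
        using assms by (intro card_Un_disjoint) (auto intro: finite_subset)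
      then show "card (V \<union> U) = t" using V assms by simp
    qed (use assms in auto)
  qed (use assms in \<open>auto simp: card_Diff_subset finite_subset\<close>)
  then have "card {T. U \<subseteq> T \<and> T \<subseteq> D \<and> card T = t} = card {V. V \<subseteq> D - U \<and> card V = t - card U}"
    by (rule bij_betw_same_card)
  also have "\<dots> = card (D - U) choose (t - card U)"
    using assms by (intro n_subsets) auto
  finally show ?thesis using assms by (simp add: card_Diff_subset finite_subset)
qed

context additive_character
begin

context
  assumes char3: "CHAR('a) = 3"
begin

lemma cube: "\<psi> x ^ 3 = 1"
  using scale[of 3 x] three_eq_0[OF char3] by simp

text \<open>Fourier expansion on Z/3: the mean of \<open>\<psi> (k x)\<close> over k is the
  indicator of \<open>\<psi> x = 1\<close>, and it is subtracted from 1.\<close>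

lemma indicator_ne_1:
  "(if \<psi> x \<noteq> 1 then 1 else 0) = (\<Sum>k = 0..<3. (if k = 0 then 2/3 else - (1/3)) * \<psi> (of_nat k * x))"
proof -
  have "(\<psi> x - 1) * (\<psi> x ^ 2 + \<psi> x + 1) = 0"
    using cube[of x] by (simp add: power2_eq_square power3_eq_cube algebra_simps)
  then have "\<psi> x = 1 \<or> \<psi> x ^ 2 + \<psi> x + 1 = 0" by simp
  moreover have "{0..<3} = {0, 1, 2::nat}" by auto
  ultimately show ?thesis
    unfolding scale by (auto simp: algebra_simps)
qed

text \<open>Duality in the manner of MacWilliams. The binomial coefficient counts the t-subsets T of
  the support of the word belonging to a. The indicator that T lies in this support is a product
  over the coordinates; expanding each factor into characters gives a sum over words u, and summing
  over a keeps only those u that are codewords.\<close>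

lemma sum_binomial_weight:
  fixes f :: "'b \<Rightarrow> 'a"
  assumes "finite D"
  defines "K \<equiv> {u. u \<in> D \<rightarrow>\<^sub>E {0..<3} \<and> (\<Sum>g\<in>D. of_nat (u g) * f g) = (0::'a)}"
  shows "(\<Sum>a\<in>UNIV. of_nat (card {g \<in> D. \<psi> (a * f g) \<noteq> 1} choose t) :: complex) =
    of_nat CARD('a) * (\<Sum>u\<in>K. if card {g \<in> D. u g \<noteq> 0} \<le> t then (-1) ^ card {g \<in> D. u g \<noteq> 0} * (1/3) ^ t * 2 ^ (t - card {g \<in> D. u g \<noteq> 0}) *
        of_nat ((card D - card {g \<in> D. u g \<noteq> 0}) choose (t - card {g \<in> D. u g \<noteq> 0})) else 0)"
    (is "_ = _ * (\<Sum>u\<in>K. ?R u)")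
proof -
  define Ts where "Ts = {T. T \<subseteq> D \<and> card T = t}"
  \<comment> \<open>The Fourier coefficients of the condition imposed at coordinate g: that of
    \<open>indicator_ne_1\<close> if g is in T, and the constant 1 otherwise, which has only a
    coefficient at k = 0.\<close>
  define c where "c T g k = (if g \<in> T then (if k = 0 then 2/3 else - (1/3)) else if k = 0 then 1 else 0 :: complex)"
    for T :: "'b set" and g :: 'b and k :: nat
  have finTs: "finite Ts" unfolding Ts_def using assms by simp
  have finP: "finite (D \<rightarrow>\<^sub>E {0..<3::nat})" using assms by (simp add: finite_PiE)
  have "(of_nat (card {g \<in> D. \<psi> (a * f g) \<noteq> 1} choose t) :: complex) =
      (\<Sum>T\<in>Ts. \<Sum>u\<in>D \<rightarrow>\<^sub>E {0..<3}. (\<Prod>g\<in>D. c T g (u g)) * \<psi> ((\<Sum>g\<in>D. of_nat (u g) * f g) * a))" for a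
  proof -
    let ?W = "{g \<in> D. \<psi> (a * f g) \<noteq> 1}"
    have "of_nat (card ?W choose t) = (\<Sum>T\<in>Ts. if T \<subseteq> ?W then 1 else 0 :: complex)"
    proof -
      have "card ?W choose t = card {T. T \<subseteq> ?W \<and> card T = t}"
        using assms by (intro n_subsets[symmetric]) auto
      also have "{T. T \<subseteq> ?W \<and> card T = t} = Ts \<inter> {T. T \<subseteq> ?W}" by (auto simp: Ts_def)
      finally show ?thesis using finTs by (simp add: sum.If_cases)
    qed
    also have "\<dots> = (\<Sum>T\<in>Ts. \<Prod>g\<in>D. \<Sum>k = 0..<3. c T g k * \<psi> (of_nat k * (a * f g)))"
    proof (rule sum.cong[OF refl])
      fix T assume "T \<in> Ts"
      then have T: "T \<subseteq> D" by (auto simp: Ts_def)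
      have "(\<Prod>g\<in>D. \<Sum>k = 0..<3. c T g k * \<psi> (of_nat k * (a * f g)))
          = (\<Prod>g\<in>D. if g \<in> T then (if \<psi> (a * f g) \<noteq> 1 then 1 else 0) else 1)"
      proof (rule prod.cong[OF refl])
        fix g
        show "(\<Sum>k = 0..<3. c T g k * \<psi> (of_nat k * (a * f g))) = (if g \<in> T then (if \<psi> (a * f g) \<noteq> 1 then 1 else 0) else 1)"
        proof (cases "g \<in> T")
          case False
          have "{0..<3} = {0, 1, 2::nat}" by auto
          then show ?thesis using False by (simp add: c_def)
        qed (simp only: c_def indicator_ne_1 if_True)
      qed
      also have "\<dots> = (\<Prod>g\<in>T. if \<psi> (a * f g) \<noteq> 1 then 1 else 0)"
        using T assms by (simp add: prod.If_cases Int_absorb1)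
      also have "\<dots> = (if T \<subseteq> ?W then 1 else 0)"
        using T assms finite_subset[OF T] by (auto simp: prod_eq_1_iff intro!: prod.neutral)
      finally show "(if T \<subseteq> ?W then 1 else 0) = (\<Prod>g\<in>D. \<Sum>k = 0..<3. c T g k * \<psi> (of_nat k * (a * f g)))" ..
    qed
    also have "\<dots> = (\<Sum>T\<in>Ts. \<Sum>u\<in>D \<rightarrow>\<^sub>E {0..<3}. \<Prod>g\<in>D. c T g (u g) * \<psi> (of_nat (u g) * (a * f g)))"
      using assms by (simp add: prod_sum_PiE)
    also have "\<dots> = (\<Sum>T\<in>Ts. \<Sum>u\<in>D \<rightarrow>\<^sub>E {0..<3}. (\<Prod>g\<in>D. c T g (u g)) * \<psi> ((\<Sum>g\<in>D. of_nat (u g) * f g) * a))"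
      by (simp add: prod.distrib sum_eq_prod[symmetric] sum_distrib_left sum_distrib_right mult_ac)
    finally show ?thesis .
  qed
  then have "(\<Sum>a\<in>UNIV. of_nat (card {g \<in> D. \<psi> (a * f g) \<noteq> 1} choose t) :: complex) =
      (\<Sum>a\<in>UNIV. \<Sum>T\<in>Ts. \<Sum>u\<in>D \<rightarrow>\<^sub>E {0..<3}. (\<Prod>g\<in>D. c T g (u g)) * \<psi> ((\<Sum>g\<in>D. of_nat (u g) * f g) * a))"
    by simp
  also have "\<dots> = (\<Sum>u\<in>D \<rightarrow>\<^sub>E {0..<3}. \<Sum>T\<in>Ts. \<Sum>a\<in>UNIV. (\<Prod>g\<in>D. c T g (u g)) * \<psi> ((\<Sum>g\<in>D. of_nat (u g) * f g) * a))"
    by (subst sum.swap, subst (2) sum.swap, subst sum.swap) simp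
  also have "\<dots> = (\<Sum>u\<in>D \<rightarrow>\<^sub>E {0..<3}. if (\<Sum>g\<in>D. of_nat (u g) * f g) = 0 then
      of_nat CARD('a) * (\<Sum>T\<in>Ts. \<Prod>g\<in>D. c T g (u g)) else 0)"
    by (intro sum.cong refl, simp only: sum_distrib_left[symmetric] sum_distrib_right[symmetric] sum_mult)
       (simp add: mult.commute)
  also have "\<dots> = (\<Sum>u\<in>K. of_nat CARD('a) * (\<Sum>T\<in>Ts. \<Prod>g\<in>D. c T g (u g)))"
    using finP by (subst sum.inter_filter[symmetric]) (auto simp: K_def intro!: sum.cong)
  also have "\<dots> = of_nat CARD('a) * (\<Sum>u\<in>K. ?R u)"
    unfolding sum_distrib_left[symmetric]
  proof (intro arg_cong2[of _ _ _ _ "(*)"] refl sum.cong)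
    fix u assume "u \<in> K"
    define U where "U = {g \<in> D. u g \<noteq> 0}"
    have U: "U \<subseteq> D" "finite U" using assms by (auto simp: U_def)
    \<comment> \<open>A word contributes only if its support U lies in T; then each coordinate in U
      gives -1/3 and each coordinate in T - U gives 2/3.\<close>
    have pr: "(\<Prod>g\<in>D. c T g (u g)) = (if U \<subseteq> T then (-1) ^ card U * (1/3) ^ t * 2 ^ (t - card U) else 0)"
      if T: "T \<in> Ts" for T
    proof (cases "U \<subseteq> T")
      case True
      have T': "T \<subseteq> D" "card T = t" "finite T" using T assms by (auto simp: Ts_def intro: finite_subset)
      have "(\<Prod>g\<in>D. c T g (u g)) = (\<Prod>g\<in>T. if u g = 0 then 2/3 else - (1/3))"
        using T' assms True by (intro prod.mono_neutral_cong_right) (auto simp: c_def U_def)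
      also have "\<dots> = (2/3) ^ card (T - U) * (- (1/3)) ^ card U"
      proof -
        have "T \<inter> {g. u g = 0} = T - U" "T \<inter> - {g. u g = 0} = U" using True T' by (auto simp: U_def)
        then show ?thesis using T' by (simp add: prod.If_cases)
      qed
      also have "card (T - U) = t - card U" using True T' U by (simp add: card_Diff_subset)
      also have "(2/3) ^ (t - card U) * (- (1/3)) ^ card U = (-1) ^ card U * (1/3) ^ t * (2::complex) ^ (t - card U)"
      proof -
        have "card U \<le> t" using True T' card_mono by metis
        then have "(1/3::complex) ^ t = (1/3) ^ (t - card U) * (1/3) ^ card U"
          by (simp only: power_add[symmetric] le_add_diff_inverse2)
        moreover have "(- (1/3)::complex) ^ card U = (-1) ^ card U * (1/3) ^ card U"
          by (simp only: power_mult_distrib[symmetric]) simp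
        moreover have "(2/3::complex) ^ (t - card U) = 2 ^ (t - card U) * (1/3) ^ (t - card U)"
          by (simp only: power_mult_distrib[symmetric]) simp
        ultimately show ?thesis by (simp only: mult_ac)
      qed
      finally show ?thesis using True by simp
    next
      case False
      then obtain g where "g \<in> U" "g \<notin> T" by auto
      then have "c T g (u g) = 0" "g \<in> D" by (auto simp: U_def c_def)
      then show ?thesis using False assms by auto
    qed
    have "(\<Sum>T\<in>Ts. \<Prod>g\<in>D. c T g (u g)) = of_nat (card {T. U \<subseteq> T \<and> T \<subseteq> D \<and> card T = t}) * ((-1) ^ card U * (1/3) ^ t * 2 ^ (t - card U))"
    proof -
      have "Ts \<inter> {T. U \<subseteq> T} = {T. U \<subseteq> T \<and> T \<subseteq> D \<and> card T = t}" by (auto simp: Ts_def)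
      then show ?thesis using finTs by (simp add: pr sum.If_cases)
    qed
    also have "\<dots> = (if card U \<le> t then (-1) ^ card U * (1/3) ^ t * 2 ^ (t - card U) * of_nat ((card D - card U) choose (t - card U)) else 0)"
    proof (cases "card U \<le> t")
      case False
      then have "{T. U \<subseteq> T \<and> T \<subseteq> D \<and> card T = t} = {}"
        using assms by (auto dest: card_mono[rotated] finite_subset)
      then have "card {T. U \<subseteq> T \<and> T \<subseteq> D \<and> card T = t} = 0" by (metis card.empty)
      then show ?thesis using False by simp
    qed (use U assms in \<open>simp add: card_supersets\<close>)
    finally show "(\<Sum>T\<in>Ts. \<Prod>g\<in>D. c T g (u g)) = ?R u" unfolding U_def .
  qed
  finally show ?thesis .
qed

end

end

lemma sum_card_fibres:
  fixes F :: "nat \<Rightarrow> complex"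
  assumes "finite K" "\<And>u. u \<in> K \<Longrightarrow> w u \<le> M"
  shows "(\<Sum>u\<in>K. F (w u)) = (\<Sum>j = 0..M. of_nat (card {u \<in> K. w u = j}) * F j)"
proof -
  have "(\<Sum>u\<in>K. F (w u)) = (\<Sum>j\<in>{0..M}. \<Sum>u\<in>{u \<in> K. w u = j}. F (w u))"
    using assms by (intro sum.group[symmetric]) auto
  then show ?thesis by simp
qed

lemma (in additive_character) sum_power_weight:
  fixes D :: "'a mat set"
  assumes char3: "CHAR('a) = 3" and D: "finite D"
  shows "(\<Sum>a\<in>UNIV. of_nat (card {g \<in> D. \<psi> (a * mat_tr g) \<noteq> 1}) ^ h :: complex) =
    of_nat CARD('a) * (\<Sum>j = 0..min (card D) h. (-1) ^ j * of_nat (weight_dist D j) *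
      (\<Sum>t = j..h. of_nat (fact t * Stirling h t) * (1/3) ^ t * 2 ^ (t - j) *
        of_nat (if t \<le> card D then (card D - j) choose (card D - t) else 0)))"
proof -
  let ?N = "card D"
  have finK: "finite (code_C D)"
    unfolding code_C_def by (rule finite_subset[of _ "D \<rightarrow>\<^sub>E {0..<3}"]) (auto simp: D finite_PiE)
  define G where "G t j = (if j \<le> t then (-1) ^ j * (1/3) ^ t * 2 ^ (t - j) * of_nat ((?N - j) choose (t - j)) else 0 :: complex)" for t j
  \<comment> \<open>For t > N the left side is 0, whereas the truncated subtraction N - t would make
    the symmetric binomial equal to 1. This is the reason for the conditional, here and in the final
    formula.\<close>
  have bin: "(?N - j) choose (t - j) = (if t \<le> ?N then (?N - j) choose (?N - t) else 0)" if "j \<le> t" "j \<le> ?N" for t j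
  proof (cases "t \<le> ?N")
    case True
    then show ?thesis using binomial_symmetric[of "t - j" "?N - j"] that by simp
  qed (use that in \<open>simp add: binomial_eq_0\<close>)
  have "(\<Sum>a\<in>UNIV. of_nat (card {g \<in> D. \<psi> (a * mat_tr g) \<noteq> 1}) ^ h :: complex) =
      (\<Sum>a\<in>UNIV. \<Sum>t\<le>h. of_nat (fact t * Stirling h t) * (of_nat (card {g \<in> D. \<psi> (a * mat_tr g) \<noteq> 1} choose t) :: complex))"
    unfolding of_nat_power[symmetric] of_nat_mult[symmetric] of_nat_sum[symmetric] power_eq_sum_Stirling ..
  also have "\<dots> = (\<Sum>t\<le>h. of_nat (fact t * Stirling h t) * (\<Sum>a\<in>UNIV. of_nat (card {g \<in> D. \<psi> (a * mat_tr g) \<noteq> 1} choose t)))"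
    by (subst sum.swap) (simp only: sum_distrib_left)
  also have "\<dots> = (\<Sum>t\<le>h. of_nat (fact t * Stirling h t) * (of_nat CARD('a) * (\<Sum>u\<in>code_C D. G t (wt D u))))"
    unfolding sum_binomial_weight[OF char3 D] code_C_def[symmetric] wt_def[symmetric] G_def ..
  also have "\<dots> = (\<Sum>t\<le>h. of_nat (fact t * Stirling h t) * (of_nat CARD('a) * (\<Sum>j = 0..?N. of_nat (weight_dist D j) * G t j)))"
    unfolding weight_dist_def
    by (subst sum_card_fibres[OF finK, of "wt D" "?N"]) (auto simp: wt_def D intro!: card_mono)
  also have "\<dots> = of_nat CARD('a) * (\<Sum>t\<le>h. \<Sum>j = 0..?N. of_nat (fact t * Stirling h t) * (of_nat (weight_dist D j) * G t j))"
    by (simp only: sum_distrib_left mult_ac)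
  also have "(\<Sum>t\<le>h. \<Sum>j = 0..?N. of_nat (fact t * Stirling h t) * (of_nat (weight_dist D j) * G t j)) =
     (\<Sum>j = 0..?N. \<Sum>t\<le>h. of_nat (fact t * Stirling h t) * (of_nat (weight_dist D j) * G t j))"
    by (rule sum.swap)
  \<comment> \<open>Weights above h drop out because \<open>G t j\<close> vanishes for j > t and t
    is at most h.\<close>
  also have "\<dots> = (\<Sum>j = 0..min ?N h. \<Sum>t\<le>h. of_nat (fact t * Stirling h t) * (of_nat (weight_dist D j) * G t j))"
    by (intro sum.mono_neutral_right) (auto simp: G_def)
  also have "\<dots> = (\<Sum>j = 0..min ?N h. \<Sum>t = j..h. of_nat (fact t * Stirling h t) * (of_nat (weight_dist D j) * G t j))"
    by (intro sum.cong refl sum.mono_neutral_right) (auto simp: G_def)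
  also have "\<dots> = (\<Sum>j = 0..min ?N h. (-1) ^ j * of_nat (weight_dist D j) *
      (\<Sum>t = j..h. of_nat (fact t * Stirling h t) * (1/3) ^ t * 2 ^ (t - j) *
        of_nat (if t \<le> ?N then (?N - j) choose (?N - t) else 0)))"
    unfolding sum_distrib_left
  proof (intro sum.cong refl)
    fix j t assume "j \<in> {0..min ?N h}" "t \<in> {j..h}"
    then have jt: "j \<le> t" "j \<le> ?N" by auto
    show "of_nat (fact t * Stirling h t) * (of_nat (weight_dist D j) * G t j) =
      (-1) ^ j * of_nat (weight_dist D j) * (of_nat (fact t * Stirling h t) * (1/3) ^ t * 2 ^ (t - j) *
        of_nat (if t \<le> ?N then (?N - j) choose (?N - t) else 0))"
      unfolding bin[OF jt, symmetric] G_def using jt by (simp only: if_True mult_ac)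
  qed
  finally show ?thesis .
qed

subsection \<open>Counting matrices\<close>

lemma bij_betw_mat_PiE:
  "bij_betw (mat r c) (({..<r} \<times> {..<c}) \<rightarrow>\<^sub>E UNIV) (carrier_mat r c)"
proof (rule bij_betw_byWitness[of _ "\<lambda>M. restrict (($$) M) ({..<r} \<times> {..<c})"])
  show "\<forall>f\<in>({..<r} \<times> {..<c}) \<rightarrow>\<^sub>E UNIV. restrict (($$) (mat r c f)) ({..<r} \<times> {..<c}) = f"
    by (auto intro!: ext simp: restrict_def PiE_def extensional_def)
  show "(\<lambda>M. restrict (($$) M) ({..<r} \<times> {..<c})) ` carrier_mat r c \<subseteq> ({..<r} \<times> {..<c}) \<rightarrow>\<^sub>E (UNIV :: 'a set)"
    by (rule image_subsetI) (simp add: PiE_def)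
qed auto

lemma finite_carrier_mat [simp]: "finite (carrier_mat r c :: 'a::finite mat set)"
  using bij_betw_finite[OF bij_betw_mat_PiE[of r c, where 'a='a]] by (simp add: finite_PiE)

lemma card_carrier_mat: "card (carrier_mat r c :: 'a::finite mat set) = CARD('a) ^ (r * c)"
  using bij_betw_same_card[OF bij_betw_mat_PiE[of r c, where 'a='a]]
  by (simp add: card_PiE prod_constant card_cartesian_product)

lemma four_block_inject:
  assumes "A \<in> carrier_mat r1 c1" "B \<in> carrier_mat r1 c2" "C \<in> carrier_mat r2 c1" "D \<in> carrier_mat r2 c2"
    and "A' \<in> carrier_mat r1 c1" "B' \<in> carrier_mat r1 c2" "C' \<in> carrier_mat r2 c1" "D' \<in> carrier_mat r2 c2"
  shows "four_block_mat A B C D = four_block_mat A' B' C' D' \<longleftrightarrow> A = A' \<and> B = B' \<and> C = C' \<and> D = D'"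
proof
  assume eq: "four_block_mat A B C D = four_block_mat A' B' C' D'"
  have e: "four_block_mat A B C D $$ (i, j) = four_block_mat A' B' C' D' $$ (i, j)" for i j
    using eq by simp
  have "A = A'"
  proof (rule eq_matI)
    fix i j assume "i < dim_row A'" "j < dim_col A'"
    then show "A $$ (i, j) = A' $$ (i, j)" using e[of i j] assms by auto
  qed (use assms in auto)
  moreover have "B = B'"
  proof (rule eq_matI)
    fix i j assume "i < dim_row B'" "j < dim_col B'"
    then show "B $$ (i, j) = B' $$ (i, j)" using e[of i "j + c1"] assms by auto
  qed (use assms in auto)
  moreover have "C = C'"
  proof (rule eq_matI)
    fix i j assume "i < dim_row C'" "j < dim_col C'"
    then show "C $$ (i, j) = C' $$ (i, j)" using e[of "i + r1" j] assms by auto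
  qed (use assms in auto)
  moreover have "D = D'"
  proof (rule eq_matI)
    fix i j assume "i < dim_row D'" "j < dim_col D'"
    then show "D $$ (i, j) = D' $$ (i, j)" using e[of "i + r1" "j + c1"] assms by auto
  qed (use assms in auto)
  ultimately show "A = A' \<and> B = B' \<and> C = C' \<and> D = D'" by simp
qed simp

lemma four_block_cases:
  assumes "M \<in> carrier_mat (r1 + r2) (c1 + c2)"
  obtains A B C D where "A \<in> carrier_mat r1 c1" "B \<in> carrier_mat r1 c2"
    "C \<in> carrier_mat r2 c1" "D \<in> carrier_mat r2 c2" "M = four_block_mat A B C D"
proof -
  obtain A B C D where "split_block M r1 c1 = (A, B, C, D)" by (metis prod_cases4)
  from split_block[OF this, of r2 c2] show ?thesis using assms that by auto
qed

lemma GL_carrier: "A \<in> GL m \<Longrightarrow> A \<in> carrier_mat m m"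
  by (simp add: GL_def)

lemma finite_GL [simp]: "finite (GL m :: 'a::{finite,field} mat set)"
  by (rule finite_subset[of _ "carrier_mat m m"]) (auto simp: GL_def)

lemma one_GL [simp]: "1\<^sub>m m \<in> GL m"
  by (simp add: GL_def)

lemma GL_mult: "A \<in> GL m \<Longrightarrow> B \<in> GL m \<Longrightarrow> A * B \<in> GL m"
  by (auto simp: GL_def det_mult)

lemma GL_transpose: "A \<in> GL m \<Longrightarrow> transpose_mat A \<in> GL m"
  by (auto simp: GL_def det_transpose)

text \<open>A term for the inverse, rather than an existential witness, because inverses occur
  inside traces and parametrisations. By \<open>minv_unique\<close> it agrees with the
  \<open>A'\<close> of \<open>Qgrp\<close>.\<close>

definition minv :: "'a::field mat \<Rightarrow> 'a mat" where
  "minv A = (1 / det A) \<cdot>\<^sub>m adj_mat A"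

lemma minv:
  assumes "A \<in> GL m"
  shows "minv A \<in> carrier_mat m m" "A * minv A = 1\<^sub>m m" "minv A * A = 1\<^sub>m m"
proof -
  have A: "A \<in> carrier_mat m m" "det A \<noteq> 0" using assms by (auto simp: GL_def)
  note adj = adj_mat[OF A(1)]
  show "minv A \<in> carrier_mat m m" using adj by (simp add: minv_def)
  show "A * minv A = 1\<^sub>m m"
    using A adj(2) mult_smult_distrib[OF A(1) adj(1), of "1 / det A"] by (auto simp: minv_def)
  show "minv A * A = 1\<^sub>m m"
    using A adj(3) mult_smult_assoc_mat[OF adj(1) A(1), of "1 / det A"] by (auto simp: minv_def)
qed

lemma GL_I:
  assumes "A \<in> carrier_mat m m" "B \<in> carrier_mat m m" "A * B = 1\<^sub>m m"
  shows "A \<in> GL m" "B \<in> GL m"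
proof -
  have "det A * det B = 1" using det_mult[OF assms(1,2)] assms(3) by simp
  then show "A \<in> GL m" "B \<in> GL m" using assms by (auto simp: GL_def)
qed

lemma minv_GL: "A \<in> GL m \<Longrightarrow> minv A \<in> GL m"
  using GL_I(2) minv GL_carrier by metis

lemma minv_unique:
  assumes "A \<in> carrier_mat m m" "B \<in> carrier_mat m m" "A * B = 1\<^sub>m m"
  shows "B = minv A"
proof -
  have A: "A \<in> GL m" by (rule GL_I[OF assms])
  have "B = (minv A * A) * B" using minv[OF A] assms by simp
  also have "\<dots> = minv A * (A * B)" using minv[OF A] assms by (intro assoc_mult_mat) auto
  finally show ?thesis using minv[OF A] assms by simp
qed

lemma minv_mult_cancel:
  assumes "A \<in> GL m" "B \<in> carrier_mat m k"
  shows "minv A * (A * B) = B" "A * (minv A * B) = B"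
  using assms minv[OF assms(1)] GL_carrier[OF assms(1)]
  by (simp_all add: assoc_mult_mat[symmetric, of _ m m _ m _ k])

lemma mult_minv_cancel:
  assumes "A \<in> GL m" "B \<in> carrier_mat k m"
  shows "(B * A) * minv A = B" "(B * minv A) * A = B"
  using assms minv[OF assms(1)] GL_carrier[OF assms(1)]
  by (simp_all add: assoc_mult_mat[of _ k m _ m _ m])

lemma bij_betw_mult_right_GL:
  assumes "P \<in> GL m"
  shows "bij_betw (\<lambda>X. X * P) (carrier_mat k m) (carrier_mat k m)"
  by (rule bij_betw_byWitness[of _ "\<lambda>X. X * minv P"])
    (use assms minv[OF assms] GL_carrier[OF assms] in \<open>auto simp: mult_minv_cancel\<close>)

text \<open>The first standard basis vector, encoded as a matrix with one column so that it can
  serve as a block.\<close>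

definition ecol :: "nat \<Rightarrow> 'a::{zero,one} mat" where
  "ecol m = mat m 1 (\<lambda>(i, j). if i = 0 then 1 else 0)"

lemma ecol_carrier [simp]: "ecol m \<in> carrier_mat m 1"
  by (simp add: ecol_def)

lemma index_mult_ecol:
  fixes P :: "'a::semiring_1 mat"
  assumes "P \<in> carrier_mat k m" "0 < m" "i < k"
  shows "(P * ecol m) $$ (i, 0) = P $$ (i, 0)"
proof -
  have "(P * ecol m) $$ (i, 0) = (\<Sum>l = 0..<m. P $$ (i, l) * (if l = 0 then 1 else 0))"
    using assms by (simp add: scalar_prod_def ecol_def)
  also have "\<dots> = (\<Sum>l = 0..<m. if l = 0 then P $$ (i, l) else 0)"
    by (intro sum.cong) auto
  finally show ?thesis using assms by simp
qed

lemma mult_ecol_eq_iff: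
  fixes P :: "'a::semiring_1 mat"
  assumes P: "P \<in> carrier_mat k m" "0 < m" and v: "v \<in> carrier_mat k 1"
  shows "P * ecol m = v \<longleftrightarrow> (\<forall>i<k. P $$ (i, 0) = v $$ (i, 0))"
proof
  assume "\<forall>i<k. P $$ (i, 0) = v $$ (i, 0)"
  then have "(P * ecol m) $$ (i, j) = v $$ (i, j)" if "i < k" "j < 1" for i j
    using that index_mult_ecol[OF P] by (metis less_one)
  moreover have "P * ecol m \<in> carrier_mat k 1" using P by (metis mult_carrier_mat ecol_carrier)
  ultimately show "P * ecol m = v" using v by (intro eq_matI) auto
qed (use index_mult_ecol[OF P] in auto)

text \<open>If the first entry of v is nonzero, the identity matrix with its first column replaced
  by v is invertible. Otherwise a row with nonzero entry is first added to row 0.\<close>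

lemma GL_transitive:
  fixes v :: "'a::field mat"
  assumes v: "v \<in> carrier_mat m 1" "v \<noteq> 0\<^sub>m m 1"
  shows "\<exists>P\<in>GL m. P * ecol m = v"
proof -
  obtain i where i: "i < m" "v $$ (i, 0) \<noteq> 0"
  proof (rule ccontr)
    assume "\<not> thesis"
    then have "v = 0\<^sub>m m 1" using v that by (intro eq_matI) auto
    then show False using v by simp
  qed
  have main: "\<exists>P\<in>GL m. P * ecol m = w" if w: "w \<in> carrier_mat m 1" "w $$ (0, 0) \<noteq> 0" for w :: "'a mat"
  proof -
    define P where "P = mat m m (\<lambda>(a, b). if b = 0 then w $$ (a, 0) else if a = b then 1 else 0)"
    have P: "P \<in> carrier_mat m m" by (simp add: P_def)
    have "upper_triangular (transpose_mat P)" by (auto simp: P_def)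
    then have "det (transpose_mat P) = prod_list (diag_mat (transpose_mat P))"
      by (rule det_upper_triangular) (use P in auto)
    also have "\<dots> = (\<Prod>k\<in>{0..<m}. P $$ (k, k))"
      using P by (simp add: diag_mat_def prod.distinct_set_conv_list[symmetric])
    also have "\<dots> \<noteq> 0" using w by (auto simp: P_def)
    finally have "P \<in> GL m" using P by (simp add: GL_def det_transpose)
    moreover have "P * ecol m = w"
      using i w by (subst mult_ecol_eq_iff[OF P]) (auto simp: P_def)
    ultimately show ?thesis by auto
  qed
  show ?thesis
  proof (cases "v $$ (0, 0) = 0")
    case True
    then have i0: "i \<noteq> 0" using i by metis
    define Q where "Q = addrow_mat m (1::'a) 0 i"
    have Q: "Q \<in> GL m" using i i0 by (simp add: Q_def GL_def det_addrow_mat)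
    have "addrow 1 0 i v = Q * v" unfolding Q_def using v i by (intro addrow_mat) auto
    then have "(Q * v) $$ (0, 0) = v $$ (i, 0) + v $$ (0, 0)"
      using v i by (metis (no_types, lifting) index_mat_addrow(1) carrier_matD less_one gr_zeroI mult_1 not_less_zero gr0I)
    moreover have "Q * v \<in> carrier_mat m 1" using Q v by (auto simp: GL_def)
    ultimately obtain P where P: "P \<in> GL m" "P * ecol m = Q * v" using main[of "Q * v"] True i by auto
    have "(minv Q * P) * ecol m = minv Q * (P * ecol m)"
      using minv_GL[OF Q] P by (intro assoc_mult_mat[OF _ _ ecol_carrier]) (auto simp: GL_def)
    also have "\<dots> = v" using P(2) minv_mult_cancel(1)[OF Q v(1)] by simp
    finally show ?thesis using GL_mult[OF minv_GL[OF Q] P(1)] by auto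
  qed (use main v in auto)
qed

text \<open>Orbit counting on the nonzero columns: all sets \<open>X v\<close> are translates of the
  stabiliser of the first basis vector, which consists of the matrices with first column (1, 0, ...,
  0), an arbitrary remaining first row and an invertible lower right block.\<close>

lemma card_GL_Suc:
  "card (GL (Suc m) :: 'a::{finite,field} mat set) = (CARD('a) ^ Suc m - 1) * CARD('a) ^ m * card (GL m :: 'a mat set)"
proof -
  let ?n = "Suc m"
  define X where "X v = {A \<in> GL ?n. A * ecol ?n = v}" for v :: "'a mat"
  have X1: "card (X (ecol ?n)) = CARD('a) ^ m * card (GL m :: 'a mat set)"
  proof -
    have "bij_betw (\<lambda>(b, A). four_block_mat (1\<^sub>m 1) b (0\<^sub>m m 1) A) (carrier_mat 1 m \<times> GL m) (X (ecol ?n))"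
      unfolding bij_betw_def
    proof
      show "inj_on (\<lambda>(b, A). four_block_mat (1\<^sub>m 1) b (0\<^sub>m m 1) A) (carrier_mat 1 m \<times> GL m :: ('a mat \<times> 'a mat) set)"
        by (auto simp: inj_on_def GL_def four_block_inject[of _ 1 1 _ m _ m])
      show "(\<lambda>(b, A). four_block_mat (1\<^sub>m 1) b (0\<^sub>m m 1) A) ` (carrier_mat 1 m \<times> GL m) = X (ecol ?n)"
      proof (intro equalityI subsetI)
        fix M :: "'a mat" assume "M \<in> (\<lambda>(b, A). four_block_mat (1\<^sub>m 1) b (0\<^sub>m m 1) A) ` (carrier_mat 1 m \<times> GL m)"
        then obtain b A where bA: "b \<in> carrier_mat 1 m" "A \<in> GL m" and M: "M = four_block_mat (1\<^sub>m 1) b (0\<^sub>m m 1) A" by auto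
        have A: "A \<in> carrier_mat m m" using bA by (simp add: GL_def)
        have Mc: "M \<in> carrier_mat ?n ?n" unfolding M using A four_block_carrier_mat[of "1\<^sub>m 1" 1 1 A m m] by simp
        have "det M = det A" unfolding M
          by (subst det_four_block_mat_lower_left_zero[OF _ bA(1) refl A]) auto
        moreover have "M * ecol ?n = ecol ?n"
          using bA A by (subst mult_ecol_eq_iff[OF Mc]) (auto simp: M ecol_def)
        ultimately show "M \<in> X (ecol ?n)" using bA Mc by (simp add: X_def GL_def)
      next
        fix M assume M: "M \<in> X (ecol ?n)"
        then have Mc: "M \<in> carrier_mat ?n ?n" "M \<in> carrier_mat (1 + m) (1 + m)" by (auto simp: X_def GL_def)
        from four_block_cases[OF Mc(2)] obtain a b c A where bl: "a \<in> carrier_mat 1 1" "b \<in> carrier_mat 1 m"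
          "c \<in> carrier_mat m 1" "A \<in> carrier_mat m m" "M = four_block_mat a b c A" by metis
        have col: "M $$ (i, 0) = (if i = 0 then 1 else 0)" if "i < ?n" for i
          using M that index_mult_ecol[OF Mc(1), of i] by (auto simp: X_def ecol_def)
        have a: "a = 1\<^sub>m 1" using col[of 0] bl by (intro eq_matI) auto
        have c: "c = 0\<^sub>m m 1"
        proof (rule eq_matI)
          fix i j assume "i < dim_row (0\<^sub>m m 1)" "j < dim_col (0\<^sub>m m 1)"
          then show "c $$ (i, j) = 0\<^sub>m m 1 $$ (i, j)" using col[of "Suc i"] bl by auto
        qed (use bl in auto)
        have "det M = det A" unfolding bl(5) a c
          by (subst det_four_block_mat_lower_left_zero[OF _ bl(2) refl bl(4)]) auto
        then have "A \<in> GL m" using M bl by (auto simp: X_def GL_def)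
        then show "M \<in> (\<lambda>(b, A). four_block_mat (1\<^sub>m 1) b (0\<^sub>m m 1) A) ` (carrier_mat 1 m \<times> GL m)"
          using bl a c by auto
      qed
    qed
    from bij_betw_same_card[OF this] show ?thesis by (simp add: card_cartesian_product card_carrier_mat)
  qed
  have Xv: "card (X v) = card (X (ecol ?n))" if v: "v \<in> carrier_mat ?n 1" "v \<noteq> 0\<^sub>m ?n 1" for v
  proof -
    obtain P where P: "P \<in> GL ?n" "P * ecol ?n = v" using GL_transitive[OF v] by auto
    have "bij_betw ((*) P) (X (ecol ?n)) (X v)"
    proof (rule bij_betw_byWitness[of _ "(*) (minv P)"])
      show "(*) P ` X (ecol ?n) \<subseteq> X v"
        using P by (auto simp: X_def GL_mult assoc_mult_mat[OF GL_carrier GL_carrier ecol_carrier])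
      show "(*) (minv P) ` X v \<subseteq> X (ecol ?n)"
      proof (rule image_subsetI)
        fix A assume A: "A \<in> X v"
        then have "minv P * A * ecol ?n = minv P * (P * ecol ?n)"
          using P assoc_mult_mat[OF GL_carrier GL_carrier ecol_carrier, OF minv_GL[OF P(1)], of A] by (auto simp: X_def)
        then show "minv P * A \<in> X (ecol ?n)"
          using A minv_GL[OF P(1)] minv_mult_cancel(1)[OF P(1) ecol_carrier] by (auto simp: X_def GL_mult)
      qed
    qed (use minv_mult_cancel[OF P(1) GL_carrier] in \<open>auto simp: X_def\<close>)
    then show ?thesis by (rule bij_betw_same_card[symmetric])
  qed
  let ?V = "carrier_mat ?n 1 - {0\<^sub>m ?n 1 :: 'a mat}"
  have GLU: "GL ?n = (\<Union>v\<in>?V. X v)"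
  proof -
    have "A * ecol ?n \<in> ?V" if A: "A \<in> GL ?n" for A :: "'a mat"
    proof -
      have "A * ecol ?n \<noteq> 0\<^sub>m ?n 1"
      proof
        assume "A * ecol ?n = 0\<^sub>m ?n 1"
        then have "ecol ?n = (0\<^sub>m ?n 1 :: 'a mat)"
          using minv_mult_cancel(1)[OF A ecol_carrier] minv(1)[OF A] by simp
        then have "ecol ?n $$ (0, 0) = (0\<^sub>m ?n 1 :: 'a mat) $$ (0, 0)" by simp
        then show False by (simp add: ecol_def)
      qed
      then show ?thesis using mult_carrier_mat[OF GL_carrier[OF A] ecol_carrier] by simp
    qed
    then show ?thesis by (auto simp: X_def)
  qed
  have "card (GL ?n :: 'a mat set) = (\<Sum>v\<in>?V. card (X v))"
    unfolding GLU by (rule card_UN_disjoint) (auto simp: X_def)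
  also have "\<dots> = (\<Sum>v\<in>?V. CARD('a) ^ m * card (GL m :: 'a mat set))"
    by (intro sum.cong refl) (simp add: Xv X1)
  also have "\<dots> = (CARD('a) ^ ?n - 1) * CARD('a) ^ m * card (GL m :: 'a mat set)"
    by (simp add: card_carrier_mat)
  finally show ?thesis .
qed

subsection \<open>Invertible symmetric matrices\<close>

definition symGL :: "nat \<Rightarrow> 'a::field mat set" where
  "symGL m = {M \<in> GL m. transpose_mat M = M}"

definition shear :: "'a::field mat \<Rightarrow> 'a mat" where
  "shear b = four_block_mat (1\<^sub>m 1) (0\<^sub>m 1 (dim_col b)) (transpose_mat b) (1\<^sub>m (dim_col b))"

lemma shear_GL: "b \<in> carrier_mat 1 m \<Longrightarrow> shear b \<in> GL (Suc m)"
  using four_block_carrier_mat[of "1\<^sub>m 1" 1 1 "1\<^sub>m m" m m "0\<^sub>m 1 m" "transpose_mat b"]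
  by (auto simp: shear_def GL_def det_four_block_mat_upper_right_zero[of _ 1 _ m])

text \<open>Completing the square: M is parametrised by its pivot d, its first row b and the Schur
  complement S, so that a unipotent congruence splits off the pivot.\<close>

lemma four_block_schur:
  fixes b :: "'a::field mat"
  assumes d: "d \<noteq> 0" and b: "b \<in> carrier_mat 1 m" and S: "S \<in> carrier_mat m m"
  defines "D \<equiv> four_block_mat (d \<cdot>\<^sub>m 1\<^sub>m 1) (0\<^sub>m 1 m) (0\<^sub>m m 1) S"
    and "M \<equiv> four_block_mat (d \<cdot>\<^sub>m 1\<^sub>m 1) b (transpose_mat b) (S + (1 / d) \<cdot>\<^sub>m (transpose_mat b * b))"
  shows "M =
      shear ((1 / d) \<cdot>\<^sub>m b) * D * transpose_mat (shear ((1 / d) \<cdot>\<^sub>m b))" (is "_ = ?R")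
    and "det M = d * det S"
proof -
  let ?c = "(1 / d) \<cdot>\<^sub>m b"
  have c: "?c \<in> carrier_mat 1 m" using b by simp
  have sh: "shear ?c = four_block_mat (1\<^sub>m 1) (0\<^sub>m 1 m) (transpose_mat ?c) (1\<^sub>m m)"
    using b by (simp add: shear_def)
  have tsh: "transpose_mat (shear ?c) = four_block_mat (1\<^sub>m 1) ?c (0\<^sub>m m 1) (1\<^sub>m m)"
    unfolding sh using c by (subst transpose_four_block_mat[of _ 1 1 _ m _ m]) auto
  have "shear ?c * D = four_block_mat (d \<cdot>\<^sub>m 1\<^sub>m 1) (0\<^sub>m 1 m) (transpose_mat b) S"
    unfolding sh D_def
    using d b S
    by (subst mult_four_block_mat[of _ 1 1 _ m _ m _ _ 1 _ m])
       (auto intro!: cong_four_block_mat eq_matI simp: scalar_prod_def)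
  then have "?R = four_block_mat (d \<cdot>\<^sub>m 1\<^sub>m 1) (0\<^sub>m 1 m) (transpose_mat b) S * four_block_mat (1\<^sub>m 1) ?c (0\<^sub>m m 1) (1\<^sub>m m)"
    by (simp add: tsh)
  also have "\<dots> = M"
    unfolding M_def using d b S
    by (subst mult_four_block_mat[of _ 1 1 _ m _ m _ _ 1 _ m])
       (auto intro!: cong_four_block_mat eq_matI simp: scalar_prod_def)
  finally show M: "M = ?R" ..
  have Dc: "D \<in> carrier_mat (Suc m) (Suc m)" "det D = d * det S"
    unfolding D_def using four_block_carrier_mat[of "d \<cdot>\<^sub>m 1\<^sub>m 1" 1 1 S m m] S
    by (auto simp: det_four_block_mat_upper_right_zero[of _ 1 _ m] det_smult)
  have "det (shear ?c) = 1"
    unfolding sh by (subst det_four_block_mat_upper_right_zero[of _ 1 _ m]) (use c in auto)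
  then show "det M = d * det S"
    unfolding M using Dc shear_GL[OF c] by (simp add: det_mult[of _ "Suc m"] det_transpose GL_def)
qed

lemma symmetric_four_block_cases:
  assumes M: "M \<in> carrier_mat (Suc m) (Suc m)" "transpose_mat M = (M :: 'a::field mat)"
  obtains b A where "b \<in> carrier_mat 1 m" "A \<in> carrier_mat m m" "transpose_mat A = A"
    "M = four_block_mat (M $$ (0, 0) \<cdot>\<^sub>m 1\<^sub>m 1) b (transpose_mat b) A"
proof -
  have "M \<in> carrier_mat (1 + m) (1 + m)" using M by simp
  from four_block_cases[OF this] obtain a b c A where bl: "a \<in> carrier_mat 1 1" "b \<in> carrier_mat 1 m"
    "c \<in> carrier_mat m 1" "A \<in> carrier_mat m m" "M = four_block_mat a b c A" by metis
  have "four_block_mat (transpose_mat a) (transpose_mat c) (transpose_mat b) (transpose_mat A) = four_block_mat a b c A"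
    using M(2) unfolding bl(5) by (simp add: transpose_four_block_mat[OF bl(1-4)])
  then have "c = transpose_mat b" "transpose_mat A = A"
    using bl by (subst (asm) four_block_inject[of _ 1 1 _ m _ m]; auto)+
  moreover have "a = M $$ (0, 0) \<cdot>\<^sub>m 1\<^sub>m 1" using bl by (intro eq_matI) auto
  ultimately show ?thesis using that bl by metis
qed

lemma transpose_symmetric_four_block:
  assumes "b \<in> carrier_mat 1 m" "A \<in> carrier_mat m m" "transpose_mat A = A"
  shows "transpose_mat (four_block_mat (d \<cdot>\<^sub>m 1\<^sub>m 1) b (transpose_mat b) A) =
    four_block_mat (d \<cdot>\<^sub>m 1\<^sub>m 1) b (transpose_mat b) (A :: 'a::field mat)"
  using assms by (subst transpose_four_block_mat[of _ 1 1 _ m _ m])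
    (auto intro!: cong_four_block_mat eq_matI)

lemma transpose_smult: "transpose_mat (c \<cdot>\<^sub>m A) = c \<cdot>\<^sub>m transpose_mat A"
  by (rule eq_matI) auto

lemma transpose_gram:
  assumes "b \<in> carrier_mat 1 m"
  shows "transpose_mat (transpose_mat b * b) = transpose_mat b * (b :: 'a::field mat)"
  using assms by (subst transpose_mult[of _ m 1 _ m]) auto

lemma ecol_carrier_Suc_0 [simp]: "ecol m \<in> carrier_mat m (Suc 0)"
  by (simp add: ecol_def)

text \<open>In the coordinates of \<open>four_block_schur\<close> the determinant is d times that of
  S, so d is any nonzero element, b is arbitrary and S ranges over the smaller invertible symmetric
  matrices.\<close>

lemma card_symGL_corner_nonzero:
  "card {M \<in> symGL (Suc m). M $$ (0, 0) \<noteq> (0::'a::{finite,field})} =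
    (CARD('a) - 1) * CARD('a) ^ m * card (symGL m :: 'a mat set)"
proof -
  let ?f = "\<lambda>(d, b, S). four_block_mat (d \<cdot>\<^sub>m 1\<^sub>m 1) b (transpose_mat b) (S + (1 / d) \<cdot>\<^sub>m (transpose_mat b * b)) :: 'a mat"
  let ?X = "(UNIV - {0}) \<times> carrier_mat 1 m \<times> symGL m"
  have car: "(1 / d) \<cdot>\<^sub>m (transpose_mat b * b) \<in> carrier_mat m m" if "b \<in> carrier_mat 1 m" for b :: "'a mat" and d
    using that by auto
  have symd: "transpose_mat ((1 / d) \<cdot>\<^sub>m (transpose_mat b * b)) = (1 / d) \<cdot>\<^sub>m (transpose_mat b * b)"
    if "b \<in> carrier_mat 1 m" for b :: "'a mat" and d
    using transpose_gram[OF that] by (metis transpose_smult)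
  have "bij_betw ?f ?X {M \<in> symGL (Suc m). M $$ (0, 0) \<noteq> 0}"
    unfolding bij_betw_def
  proof
    show "inj_on ?f ?X"
    proof (rule inj_onI)
      fix p p' assume pX: "p \<in> ?X" "p' \<in> ?X" and fp: "?f p = ?f p'"
      obtain d b S d' b' S' where p: "p = (d, b, S)" "p' = (d', b', S')" by (metis prod_cases3)
      have *: "d \<noteq> 0" "b \<in> carrier_mat 1 m" "S \<in> symGL m" "d' \<noteq> 0" "b' \<in> carrier_mat 1 m" "S' \<in> symGL m"
        using pX p by auto
      have eq: "four_block_mat (d \<cdot>\<^sub>m 1\<^sub>m 1) b (transpose_mat b) (S + (1 / d) \<cdot>\<^sub>m (transpose_mat b * b)) =
          four_block_mat (d' \<cdot>\<^sub>m 1\<^sub>m 1) b' (transpose_mat b') (S' + (1 / d') \<cdot>\<^sub>m (transpose_mat b' * b'))"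
        using fp p by simp
      have S: "S \<in> carrier_mat m m" "S' \<in> carrier_mat m m" using * by (auto simp: symGL_def GL_def)
      have e: "d \<cdot>\<^sub>m 1\<^sub>m 1 = d' \<cdot>\<^sub>m (1\<^sub>m 1 :: 'a mat)" "b = b'"
        "S + (1 / d) \<cdot>\<^sub>m (transpose_mat b * b) = S' + (1 / d') \<cdot>\<^sub>m (transpose_mat b' * b')"
        using eq * S car by (subst (asm) four_block_inject[of _ 1 1 _ m _ m]; auto)+
      have "(d \<cdot>\<^sub>m 1\<^sub>m 1) $$ (0, 0) = (d' \<cdot>\<^sub>m (1\<^sub>m 1 :: 'a mat)) $$ (0, 0)" using e by simp
      then have d: "d = d'" by simp
      let ?E = "(1 / d) \<cdot>\<^sub>m (transpose_mat b * b)"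
      have "S = S + ?E - ?E" using S car[OF *(2), of d] by (intro eq_matI) auto
      also have "\<dots> = S' + ?E - ?E" using e d by metis
      also have "\<dots> = S'" using S car[OF *(2), of d] by (intro eq_matI) auto
      finally show "p = p'" using d e p by simp
    qed
    show "?f ` ?X = {M \<in> symGL (Suc m). M $$ (0, 0) \<noteq> 0}"
    proof (intro equalityI subsetI)
      fix M assume "M \<in> ?f ` ?X"
      then obtain d b S where *: "d \<noteq> 0" "b \<in> carrier_mat 1 m" "S \<in> symGL m" and M: "M = ?f (d, b, S)" by auto
      have S: "S \<in> carrier_mat m m" "transpose_mat S = S" "det S \<noteq> 0" using * by (auto simp: symGL_def GL_def)
      let ?A = "S + (1 / d) \<cdot>\<^sub>m (transpose_mat b * b)"
      have A: "?A \<in> carrier_mat m m" using S car[OF *(2)] by simp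
      have "transpose_mat ?A = ?A"
        using S car[OF *(2), of d] symd[OF *(2), of d] by (subst transpose_add[of _ m m]) auto
      then have "transpose_mat M = M" unfolding M using transpose_symmetric_four_block[OF *(2) A] by simp
      moreover have "M \<in> carrier_mat (Suc m) (Suc m)"
        unfolding M using four_block_carrier_mat[of "d \<cdot>\<^sub>m 1\<^sub>m 1" 1 1 ?A m m] A by auto
      moreover have "det M \<noteq> 0" unfolding M using four_block_schur(2)[OF *(1,2) S(1)] * S by simp
      moreover have "M $$ (0, 0) = d" unfolding M using A by simp
      ultimately show "M \<in> {M \<in> symGL (Suc m). M $$ (0, 0) \<noteq> 0}" using * by (auto simp: symGL_def GL_def)
    next
      fix M assume "M \<in> {M \<in> symGL (Suc m). M $$ (0, 0) \<noteq> (0::'a)}"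
      then have M: "M \<in> carrier_mat (Suc m) (Suc m)" "transpose_mat M = M" "det M \<noteq> 0" and d: "M $$ (0, 0) \<noteq> 0"
        by (auto simp: symGL_def GL_def)
      from symmetric_four_block_cases[OF M(1,2)] obtain b A where bA: "b \<in> carrier_mat 1 m" "A \<in> carrier_mat m m"
        "transpose_mat A = A" "M = four_block_mat (M $$ (0, 0) \<cdot>\<^sub>m 1\<^sub>m 1) b (transpose_mat b) A" by metis
      define E where "E = (1 / M $$ (0, 0)) \<cdot>\<^sub>m (transpose_mat b * b)"
      have E: "E \<in> carrier_mat m m" "transpose_mat E = E" unfolding E_def using car symd bA by auto
      have S: "A - E \<in> carrier_mat m m" "transpose_mat (A - E) = A - E"
        using E bA by (auto simp: transpose_minus[of _ m m])
      have "A - E + E = A" using E bA by (intro eq_matI) auto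
      then have Mf: "M = ?f (M $$ (0, 0), b, A - E)" using bA(4) by (simp add: E_def)
      then have "det M = M $$ (0, 0) * det (A - E)"
        using four_block_schur(2)[OF d bA(1) S(1)] by simp
      then have "A - E \<in> symGL m" using S M by (auto simp: symGL_def GL_def)
      then show "M \<in> ?f ` ?X" using Mf d bA by blast
    qed
  qed
  from bij_betw_same_card[OF this] show ?thesis
    by (simp add: card_cartesian_product card_carrier_mat card_Diff_singleton)
qed

text \<open>The first row has its only nonzero entry in column 1, and after its deletion the first
  column of the minor is the first basis vector. Two expansions leave only A; the blocks x and c are
  therefore free when such matrices are counted.\<close>

lemma det_corner_zero:
  fixes A :: "'a::field mat"
  assumes x: "x \<in> carrier_mat 1 1" and c: "c \<in> carrier_mat 1 k" and A: "A \<in> carrier_mat k k"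
  shows "det (four_block_mat (0\<^sub>m 1 1) (transpose_mat (ecol (Suc k))) (ecol (Suc k))
    (four_block_mat x c (transpose_mat c) A)) = - det A" (is "det ?M = _")
proof -
  let ?B = "four_block_mat x c (transpose_mat c) A"
  have B: "?B \<in> carrier_mat (Suc k) (Suc k)" using four_block_carrier_mat[OF x A] by simp
  have M: "?M \<in> carrier_mat (Suc (Suc k)) (Suc (Suc k))"
    using four_block_carrier_mat[of "0\<^sub>m 1 1" 1 1 ?B "Suc k" "Suc k"] B by simp
  have row0: "?M $$ (0, j) = (if j = 1 then 1 else 0)" if "j < Suc (Suc k)" for j
    using that x A by (auto simp: ecol_def)
  have del: "mat_delete ?M 0 1 = four_block_mat (1\<^sub>m 1) c (0\<^sub>m k 1) A"
  proof (rule eq_matI)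
    fix i j assume ij: "i < dim_row (four_block_mat (1\<^sub>m 1) c (0\<^sub>m k 1) A)" "j < dim_col (four_block_mat (1\<^sub>m 1) c (0\<^sub>m k 1) A)"
    then have ij': "i < Suc k" "j < Suc k" using A by auto
    have "mat_delete ?M 0 1 $$ (i, j) = ?M $$ (Suc i, if j = 0 then 0 else Suc j)"
      using ij' M x A unfolding mat_delete_def by auto
    also have "\<dots> = four_block_mat (1\<^sub>m 1) c (0\<^sub>m k 1) A $$ (i, j)"
      using ij' x c A by (cases i; cases j) (auto simp: ecol_def)
    finally show "mat_delete ?M 0 1 $$ (i, j) = four_block_mat (1\<^sub>m 1) c (0\<^sub>m k 1) A $$ (i, j)" .
  qed (use M A in \<open>auto simp: mat_delete_def\<close>)
  have "det ?M = (\<Sum>j<Suc (Suc k). ?M $$ (0, j) * cofactor ?M 0 j)"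
    by (rule laplace_expansion_row[OF M]) simp
  also have "\<dots> = (\<Sum>j<Suc (Suc k). if j = 1 then cofactor ?M 0 j else 0)"
    by (intro sum.cong refl) (simp only: row0 lessThan_iff, simp)
  also have "\<dots> = cofactor ?M 0 1" by simp
  also have "\<dots> = - det (four_block_mat (1\<^sub>m 1) c (0\<^sub>m k 1) A)"
    unfolding cofactor_def del by simp
  also have "\<dots> = - det A"
    by (subst det_four_block_mat_lower_left_zero[OF _ c refl A]) auto
  finally show ?thesis .
qed

text \<open>With a zero corner the rest b of the first row is nonzero. Congruences act transitively
  on such b, so it may be taken to be the first basis vector, where \<open>det_corner_zero\<close>
  applies: q^m choices for x and c together, times the symmetric matrices two sizes smaller. For m =
  0 the truncated m - 1 is harmless, since the factor q^0 - 1 vanishes.\<close>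

lemma card_symGL_corner_zero:
  "card {M \<in> symGL (Suc m). M $$ (0, 0) = (0::'a::{finite,field})} =
    (CARD('a) ^ m - 1) * CARD('a) ^ m * card (symGL (m - 1) :: 'a mat set)"
proof -
  define X where "X b = {A \<in> carrier_mat m m. transpose_mat A = A \<and>
      det (four_block_mat (0\<^sub>m 1 1) b (transpose_mat b) A) \<noteq> 0}" for b :: "'a mat"
  have z: "0 \<cdot>\<^sub>m 1\<^sub>m 1 = (0\<^sub>m 1 1 :: 'a mat)" by (intro eq_matI) auto
  let ?f = "\<lambda>(b, A). four_block_mat (0\<^sub>m 1 1) b (transpose_mat b) A :: 'a mat"
  have "bij_betw ?f (Sigma (carrier_mat 1 m) X) {M \<in> symGL (Suc m). M $$ (0, 0) = 0}"
    unfolding bij_betw_def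
  proof
    show "inj_on ?f (Sigma (carrier_mat 1 m) X)"
      by (auto simp: inj_on_def X_def four_block_inject[of _ 1 1 _ m _ m])
    show "?f ` (Sigma (carrier_mat 1 m) X) = {M \<in> symGL (Suc m). M $$ (0, 0) = 0}"
    proof (intro equalityI subsetI)
      fix M assume "M \<in> ?f ` (Sigma (carrier_mat 1 m) X)"
      then obtain b A where *: "b \<in> carrier_mat 1 m" "A \<in> X b" and M: "M = ?f (b, A)" by auto
      have A: "A \<in> carrier_mat m m" "transpose_mat A = A" "det M \<noteq> 0" using * M by (auto simp: X_def)
      have "M \<in> carrier_mat (Suc m) (Suc m)"
        unfolding M using four_block_carrier_mat[of "0\<^sub>m 1 1" 1 1 A m m] A by auto
      moreover have "transpose_mat M = M" unfolding M
        using transpose_symmetric_four_block[OF *(1) A(1,2), of 0] z by simp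
      moreover have "M $$ (0, 0) = 0" unfolding M using A by simp
      ultimately show "M \<in> {M \<in> symGL (Suc m). M $$ (0, 0) = 0}" using A by (auto simp: symGL_def GL_def)
    next
      fix M assume "M \<in> {M \<in> symGL (Suc m). M $$ (0, 0) = (0::'a)}"
      then have M: "M \<in> carrier_mat (Suc m) (Suc m)" "transpose_mat M = M" "det M \<noteq> 0" "M $$ (0, 0) = 0"
        by (auto simp: symGL_def GL_def)
      from symmetric_four_block_cases[OF M(1,2)] obtain b A where bA: "b \<in> carrier_mat 1 m" "A \<in> carrier_mat m m"
        "transpose_mat A = A" "M = four_block_mat (0\<^sub>m 1 1) b (transpose_mat b) A" using M(4) z by metis
      then have "A \<in> X b" using M by (auto simp: X_def)
      then show "M \<in> ?f ` (Sigma (carrier_mat 1 m) X)" using bA by auto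
    qed
  qed
  from bij_betw_same_card[OF this]
  have "card {M \<in> symGL (Suc m). M $$ (0, 0) = (0::'a)} = card (Sigma (carrier_mat 1 m) X)" ..
  also have "\<dots> = (\<Sum>b\<in>carrier_mat 1 m. card (X b))"
    by (rule card_SigmaI) (auto simp: X_def)
  also have "\<dots> = (\<Sum>b\<in>carrier_mat 1 m - {0\<^sub>m 1 m}. card (X b))"
  proof -
    have "det (four_block_mat (0\<^sub>m 1 1) (0\<^sub>m 1 m) (transpose_mat (0\<^sub>m 1 m)) A) = 0"
      if "A \<in> carrier_mat m m" for A :: "'a mat"
      using that by (subst det_four_block_mat_upper_right_zero[of _ 1 _ m]) auto
    then have "X (0\<^sub>m 1 m) = {}" by (auto simp: X_def)
    then show ?thesis by (intro sum.mono_neutral_right) auto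
  qed
  also have "\<dots> = (\<Sum>b\<in>carrier_mat 1 m - {0\<^sub>m 1 m :: 'a mat}. CARD('a) ^ m * card (symGL (m - 1) :: 'a mat set))"
  proof (rule sum.cong[OF refl])
    fix b :: "'a mat" assume "b \<in> carrier_mat 1 m - {0\<^sub>m 1 m}"
    then have b: "b \<in> carrier_mat 1 m" "b \<noteq> 0\<^sub>m 1 m" by auto
    have m: "m \<noteq> 0" using b by (metis eq_matI carrier_matD index_zero_mat(2,3) not_less_zero)
    then obtain k where k: "m = Suc k" by (cases m) auto
    have "transpose_mat b \<noteq> 0\<^sub>m m 1" using b by (metis transpose_transpose zero_transpose_mat)
    then obtain P where P: "P \<in> GL m" "P * ecol m = transpose_mat b" using GL_transitive[of "transpose_mat b" m] b by auto
    note Pc = GL_carrier[OF P(1)] note iP = minv[OF P(1)]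
    have tP: "transpose_mat P * transpose_mat (minv P) = 1\<^sub>m m" "transpose_mat (minv P) * transpose_mat P = 1\<^sub>m m"
      using Pc iP by (metis transpose_mult transpose_one)+
    have bP: "b = transpose_mat (ecol m) * transpose_mat P"
      using P(2) Pc by (metis transpose_mult transpose_transpose ecol_carrier)
    define g where "g Y A = Y * A * transpose_mat Y" for Y A :: "'a mat"
    have gc: "g Y A \<in> carrier_mat m m" if "Y \<in> carrier_mat m m" "A \<in> carrier_mat m m" for Y A
      using that by (auto simp: g_def)
    have gsym: "transpose_mat (g Y A) = g Y (transpose_mat A)" if "Y \<in> carrier_mat m m" "A \<in> carrier_mat m m" for Y A
      using that by (simp add: g_def transpose_mult[of _ m m _ m] assoc_mult_mat[of _ m m _ m _ m])
    have gg: "g (minv P) (g P A) = A" "g P (g (minv P) A) = A" if A: "A \<in> carrier_mat m m" for A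
    proof -
      show "g (minv P) (g P A) = A" "g P (g (minv P) A) = A"
        using A Pc iP by (simp_all add: g_def assoc_mult_mat[of _ m m _ m _ m] tP minv_mult_cancel[OF P(1)])
    qed
    \<comment> \<open>Congruence by diag(1, P), which sends the first basis vector to b and
      multiplies the determinant by the square of det P.\<close>
    have detg: "det (four_block_mat (0\<^sub>m 1 1) b (transpose_mat b) (g P A)) =
        det P * det P * det (four_block_mat (0\<^sub>m 1 1) (transpose_mat (ecol m)) (ecol m) A)"
      if A: "A \<in> carrier_mat m m" for A
    proof -
      let ?D = "four_block_mat (1\<^sub>m 1) (0\<^sub>m 1 m) (0\<^sub>m m 1) P"
      let ?E = "four_block_mat (1\<^sub>m 1) (0\<^sub>m 1 m) (0\<^sub>m m 1) (transpose_mat P)"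
      let ?Z = "four_block_mat (0\<^sub>m 1 1) (transpose_mat (ecol m)) (ecol m) A"
      have "?D * ?Z = four_block_mat (0\<^sub>m 1 1) (transpose_mat (ecol m)) (P * ecol m) (P * A)"
      proof -
        have te: "transpose_mat (ecol m :: 'a mat) \<in> carrier_mat 1 m" by simp
        have "0\<^sub>m 1 m * ecol m = (0\<^sub>m 1 1 :: 'a mat)" "1\<^sub>m 1 * transpose_mat (ecol m) = (transpose_mat (ecol m) :: 'a mat)"
          "0\<^sub>m m 1 * transpose_mat (ecol m) = (0\<^sub>m m m :: 'a mat)"
          by (rule left_mult_zero_mat[OF ecol_carrier] left_mult_one_mat[OF te] left_mult_zero_mat[OF te])+
        then show ?thesis
          using Pc A by (subst mult_four_block_mat[of _ 1 1 _ m _ m _ _ 1 _ m]) auto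
      qed
      moreover have "\<dots> * ?E = four_block_mat (0\<^sub>m 1 1) (transpose_mat (ecol m) * transpose_mat P) (P * ecol m) (g P A)"
      proof -
        have te: "transpose_mat (ecol m :: 'a mat) \<in> carrier_mat 1 m" by simp
        have tP: "transpose_mat P \<in> carrier_mat m m" using Pc by simp
        note Pe = mult_carrier_mat[OF Pc ecol_carrier] and eP = mult_carrier_mat[OF te tP]
        note z = right_mult_zero_mat[OF te, of 1] right_mult_zero_mat[OF Pe, of m] right_mult_one_mat[OF Pe]
          left_add_zero_mat[OF eP] right_add_zero_mat[OF Pe]
        show ?thesis
          using Pc A Pe z by (subst mult_four_block_mat[of _ 1 1 _ m _ m _ _ 1 _ m]) (auto simp: g_def)
      qed
      ultimately have eq: "four_block_mat (0\<^sub>m 1 1) b (transpose_mat b) (g P A) = ?D * ?Z * ?E"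
        using bP P(2) by simp
      have car: "?D \<in> carrier_mat (1 + m) (1 + m)" "?Z \<in> carrier_mat (1 + m) (1 + m)" "?E \<in> carrier_mat (1 + m) (1 + m)"
        using Pc A by (intro four_block_carrier_mat; simp)+
      have "det ?D = det P" "det ?E = det P"
        using Pc by (simp_all add: det_four_block_mat_upper_right_zero[of _ 1 _ m] det_transpose)
      then show ?thesis unfolding eq using car by (simp add: det_mult[of _ "1 + m"])
    qed
    have "bij_betw (g P) (X (transpose_mat (ecol m))) (X b)"
    proof (rule bij_betw_byWitness[of _ "g (minv P)"])
      have dP: "det P \<noteq> 0" using P by (simp add: GL_def)
      show "g P ` X (transpose_mat (ecol m)) \<subseteq> X b"
      proof (rule image_subsetI)
        fix A assume A: "A \<in> X (transpose_mat (ecol m))"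
        then have Ac: "A \<in> carrier_mat m m" by (simp add: X_def)
        show "g P A \<in> X b"
          using A detg[OF Ac] dP Pc by (auto simp: X_def gc gsym)
      qed
      show "g (minv P) ` X b \<subseteq> X (transpose_mat (ecol m))"
      proof (rule image_subsetI)
        fix A assume A: "A \<in> X b"
        then have Ac: "A \<in> carrier_mat m m" by (simp add: X_def)
        show "g (minv P) A \<in> X (transpose_mat (ecol m))"
          using A detg[OF gc[OF iP(1) Ac]] by (auto simp: X_def gc gsym iP gg)
      qed
    qed (auto simp: X_def gg)
    then have "card (X b) = card (X (transpose_mat (ecol m)))" by (rule bij_betw_same_card[symmetric])
    also have "\<dots> = CARD('a) * CARD('a) ^ k * card (symGL k :: 'a mat set)"
    proof -
      let ?h = "\<lambda>(x, c, A). four_block_mat x c (transpose_mat c) A :: 'a mat"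
      have "bij_betw ?h (carrier_mat 1 1 \<times> carrier_mat 1 k \<times> symGL k) (X (transpose_mat (ecol m)))"
        unfolding bij_betw_def
      proof
        show "inj_on ?h (carrier_mat 1 1 \<times> carrier_mat 1 k \<times> symGL k)"
          by (auto simp: inj_on_def symGL_def GL_def four_block_inject[of _ 1 1 _ k _ k])
        show "?h ` (carrier_mat 1 1 \<times> carrier_mat 1 k \<times> symGL k) = X (transpose_mat (ecol m))"
        proof (intro equalityI subsetI)
          fix M assume "M \<in> ?h ` (carrier_mat 1 1 \<times> carrier_mat 1 k \<times> symGL k)"
          then obtain x c A where *: "x \<in> carrier_mat 1 1" "c \<in> carrier_mat 1 k" "A \<in> symGL k" and M: "M = ?h (x, c, A)" by auto
          have A: "A \<in> carrier_mat k k" "transpose_mat A = A" "det A \<noteq> 0" using * by (auto simp: symGL_def GL_def)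
          have x: "x = x $$ (0, 0) \<cdot>\<^sub>m 1\<^sub>m 1" using * by (intro eq_matI) auto
          have "M \<in> carrier_mat m m"
            unfolding M k using four_block_carrier_mat[OF *(1) A(1)] by simp
          moreover have "transpose_mat M = M" unfolding M
            using transpose_symmetric_four_block[OF *(2) A(1,2), of "x $$ (0, 0)"] x by simp
          ultimately show "M \<in> X (transpose_mat (ecol m))"
            using det_corner_zero[OF *(1,2) A(1)] A by (auto simp: X_def M k)
        next
          fix M assume M: "M \<in> X (transpose_mat (ecol m))"
          then have "M \<in> carrier_mat (Suc k) (Suc k)" "transpose_mat M = M" by (auto simp: X_def k)
          from symmetric_four_block_cases[OF this] obtain c A where bA: "c \<in> carrier_mat 1 k" "A \<in> carrier_mat k k"
            "transpose_mat A = A" "M = ?h (M $$ (0, 0) \<cdot>\<^sub>m 1\<^sub>m 1, c, A)" by auto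
          have x: "M $$ (0, 0) \<cdot>\<^sub>m 1\<^sub>m 1 \<in> carrier_mat 1 1" by simp
          have "det A \<noteq> 0" using M det_corner_zero[OF x bA(1,2)] bA(4) by (auto simp: X_def k)
          then have "A \<in> symGL k" using bA by (simp add: symGL_def GL_def)
          then show "M \<in> ?h ` (carrier_mat 1 1 \<times> carrier_mat 1 k \<times> symGL k)"
            using bA x by (intro image_eqI[of _ _ "(M $$ (0, 0) \<cdot>\<^sub>m 1\<^sub>m 1, c, A)"]) auto
        qed
      qed
      from bij_betw_same_card[OF this] show ?thesis by (simp add: card_cartesian_product card_carrier_mat)
    qed
    finally show "card (X b) = CARD('a) ^ m * card (symGL (m - 1) :: 'a mat set)" by (simp add: k)
  qed
  also have "\<dots> = (CARD('a) ^ m - 1) * CARD('a) ^ m * card (symGL (m - 1) :: 'a mat set)"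
    by (simp add: card_carrier_mat)
  finally show ?thesis .
qed

lemma card_symGL_Suc:
  "card (symGL (Suc m) :: 'a::{finite,field} mat set) =
    (CARD('a) - 1) * CARD('a) ^ m * card (symGL m :: 'a mat set) +
    (CARD('a) ^ m - 1) * CARD('a) ^ m * card (symGL (m - 1) :: 'a mat set)"
proof -
  have "finite (symGL (Suc m) :: 'a mat set)" by (rule finite_subset[OF _ finite_GL]) (auto simp: symGL_def)
  then have "card (symGL (Suc m) :: 'a mat set) = card ({M \<in> symGL (Suc m). M $$ (0, 0) \<noteq> (0::'a)} \<union> {M \<in> symGL (Suc m). M $$ (0, 0) = 0})"
    by (intro arg_cong[of _ _ card]) auto
  also have "\<dots> = card {M \<in> symGL (Suc m). M $$ (0, 0) \<noteq> (0::'a)} + card {M \<in> symGL (Suc m). M $$ (0, 0) = (0::'a)}"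
    using \<open>finite _\<close> by (intro card_Un_disjoint) auto
  finally show ?thesis by (simp only: card_symGL_corner_nonzero card_symGL_corner_zero)
qed

lemma symGL_0: "symGL 0 = {1\<^sub>m 0 :: 'a::field mat}"
  by (auto simp: symGL_def GL_def intro!: eq_matI)

subsection \<open>The anisotropic binary form\<close>

lemma det_2x2:
  fixes w :: "'a::field mat"
  assumes w: "w \<in> carrier_mat 2 2"
  shows "det w = w $$ (0, 0) * w $$ (1, 1) - w $$ (0, 1) * w $$ (1, 0)"
proof -
  have c: "cofactor w 0 j = (-1) ^ j * mat_delete w 0 j $$ (0, 0)" if "j < 2" for j
  proof -
    have "mat_delete w 0 j \<in> carrier_mat 1 1" using mat_delete_carrier[OF w] by simp
    then show ?thesis unfolding cofactor_def by (simp only: det_single add_0)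
  qed
  have e: "mat_delete w 0 0 $$ (0, 0) = w $$ (1, 1)" "mat_delete w 0 1 $$ (0, 0) = w $$ (1, 0)"
    using w by (simp_all add: mat_delete_def)
  have "det w = (\<Sum>j<2. w $$ (0, j) * cofactor w 0 j)" by (rule laplace_expansion_row[OF w]) simp
  also have "\<dots> = w $$ (0, 0) * cofactor w 0 0 + w $$ (0, 1) * cofactor w 0 1"
    by (simp add: numeral_2_eq_2)
  finally show ?thesis using c[of 0] c[of 1] unfolding e by simp
qed

lemma card_square_roots_le: "card {u::'a::{finite,field}. u * u = y} \<le> 2"
proof (cases "\<exists>u. u * u = y")
  case True
  then obtain u where u: "u * u = y" by auto
  have "x = u \<or> x = - u" if "x * x = y" for x
  proof -
    have "(x - u) * (x + u) = 0" using u that by (simp add: algebra_simps)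
    then show ?thesis by (auto simp: eq_neg_iff_add_eq_0)
  qed
  then have "{x. x * x = y} \<subseteq> {u, - u}" by auto
  then have "card {x. x * x = y} \<le> card {u, - u}" by (intro card_mono) auto
  also have "\<dots> \<le> 2" by (simp add: card_insert_le_m1)
  finally show ?thesis .
qed simp

text \<open>Every nonzero square has at most two roots, and 0 is one more square.\<close>

lemma card_squares_ge: "CARD('a) + 1 \<le> 2 * card (range (\<lambda>u::'a::{finite,field}. u * u))"
proof -
  let ?A = "range (\<lambda>u::'a. u * u)"
  have "UNIV - {0::'a} = (\<Union>y\<in>?A - {0}. {u. u * u = y})" by auto
  then have "CARD('a) - 1 = card (\<Union>y\<in>?A - {0}. {u::'a. u * u = y})"
    by (metis card_Diff_singleton UNIV_I)
  also have "\<dots> \<le> (\<Sum>y\<in>?A - {0}. card {u::'a. u * u = y})" by (rule card_UN_le) simp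
  also have "\<dots> \<le> (\<Sum>y\<in>?A - {0}. 2)" by (intro sum_mono card_square_roots_le)
  also have "\<dots> = (card ?A - 1) * 2"
  proof -
    have "0 \<in> ?A" by (rule range_eqI[of _ _ 0]) simp
    then show ?thesis by (simp add: card_Diff_singleton)
  qed
  finally show ?thesis
    using card_gt_0_iff[of ?A] zero_less_card_finite[where 'a='a] by auto
qed

context
  fixes \<epsilon> :: "'a::{finite,field}"
  assumes nonsq: "\<forall>b. b * b \<noteq> \<epsilon>"
begin

lemma norm_form_eq_0_iff: "u * u - \<epsilon> * (v * v) = 0 \<longleftrightarrow> u = 0 \<and> v = 0"
proof
  assume eq: "u * u - \<epsilon> * (v * v) = 0"
  have "v = 0"
  proof (rule ccontr)
    assume "v \<noteq> 0"
    then have "(u / v) * (u / v) = \<epsilon>" using eq by (simp add: field_simps)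
    then show False using nonsq by blast
  qed
  then show "u = 0 \<and> v = 0" using eq by simp
qed simp

text \<open>Pigeonhole: the sets of values \<open>u * u\<close> and
  \<open>c + \<epsilon> * (v * v)\<close> each have more than q/2 elements, so they meet.\<close>

lemma norm_form_surj: "\<exists>u v. u * u - \<epsilon> * (v * v) = c"
proof -
  let ?A = "range (\<lambda>u::'a. u * u)"
  let ?B = "(\<lambda>y. c + \<epsilon> * y) ` ?A"
  have e0: "\<epsilon> \<noteq> 0" using nonsq by (metis mult_zero_left)
  have "card ?B = card ?A" using e0 by (intro card_image) (auto simp: inj_on_def)
  then have "card ?A + card ?B > CARD('a)" using card_squares_ge[where 'a='a] by linarith
  have "?A \<inter> ?B \<noteq> {}"
  proof
    assume "?A \<inter> ?B = {}"
    then have "card (?A \<union> ?B) = card ?A + card ?B" by (intro card_Un_disjoint) auto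
    moreover have "card (?A \<union> ?B) \<le> CARD('a)" by (intro card_mono) auto
    ultimately show False using \<open>card ?A + card ?B > CARD('a)\<close> by linarith
  qed
  then obtain u v where "u * u = c + \<epsilon> * (v * v)" by auto
  then show ?thesis by (intro exI[of _ u] exI[of _ v]) simp
qed

text \<open>The form is the norm of u + v sqrt(\<epsilon>) from the quadratic extension.
  Multiplication by an element of norm c carries norm 1 to norm c, so all q - 1 nonzero values have
  equally many preimages; as 0 has exactly one, q^2 = 1 + (q - 1) |X 1|.\<close>

lemma card_norm_form:
  assumes "c \<noteq> 0"
  shows "card {(u, v). u * u - \<epsilon> * (v * v) = c} = CARD('a) + 1"
proof -
  define X where "X c = {(u, v). u * u - \<epsilon> * (v * v) = c}" for c
  have same: "card (X c) = card (X 1)" if c: "c \<noteq> 0" for c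
  proof -
    obtain a b where ab: "a * a - \<epsilon> * (b * b) = c" using norm_form_surj by metis
    let ?f = "\<lambda>(u, v). (a * u + \<epsilon> * b * v, a * v + b * u)"
    let ?g = "\<lambda>(u, v). ((a * u - \<epsilon> * b * v) / c, (a * v - b * u) / c)"
    have "bij_betw ?f (X 1) (X c)"
    proof (rule bij_betw_byWitness[of _ ?g])
      have "(a * (a * u + \<epsilon> * b * v) - \<epsilon> * b * (a * v + b * u)) = c * u"
        "(a * (a * v + b * u) - b * (a * u + \<epsilon> * b * v)) = c * v"
        "(a * (a * u - \<epsilon> * b * v) + \<epsilon> * b * (a * v - b * u)) = c * u"
        "(a * (a * v - b * u) + b * (a * u - \<epsilon> * b * v)) = c * v" for u v
        unfolding ab[symmetric] by (simp_all add: algebra_simps)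
      then show "\<forall>p\<in>X 1. ?g (?f p) = p" "\<forall>p\<in>X c. ?f (?g p) = p"
        using c by (auto simp: add_divide_distrib[symmetric])
      have "(a * u + \<epsilon> * b * v) * (a * u + \<epsilon> * b * v) - \<epsilon> * ((a * v + b * u) * (a * v + b * u)) = c * (u * u - \<epsilon> * (v * v))"
        "(a * u - \<epsilon> * b * v) * (a * u - \<epsilon> * b * v) - \<epsilon> * ((a * v - b * u) * (a * v - b * u)) = c * (u * u - \<epsilon> * (v * v))" for u v
        unfolding ab[symmetric] by (simp_all add: algebra_simps)
      note h = this
      show "?f ` X 1 \<subseteq> X c" by (auto simp: X_def h)
      have "(x / c) * (x / c) - \<epsilon> * ((y / c) * (y / c)) = (x * x - \<epsilon> * (y * y)) / (c * c)" for x y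
        by (simp add: diff_divide_distrib)
      then show "?g ` X c \<subseteq> X 1" using c by (auto simp: X_def h)
    qed
    then show ?thesis by (rule bij_betw_same_card[symmetric])
  qed
  have X0: "X 0 = {(0, 0)}" unfolding X_def norm_form_eq_0_iff by auto
  have "(UNIV :: ('a \<times> 'a) set) = (\<Union>c. X c)" by (auto simp: X_def)
  then have "CARD('a \<times> 'a) = card (\<Union>c. X c)" by simp
  also have "\<dots> = (\<Sum>c\<in>UNIV. card (X c))" by (rule card_UN_disjoint) (auto simp: X_def)
  also have "\<dots> = card (X 0) + (\<Sum>c\<in>UNIV - {0}. card (X c))" by (simp add: sum.remove[of _ 0])
  also have "\<dots> = 1 + (CARD('a) - 1) * card (X 1)"
  proof -
    have "(\<Sum>c\<in>UNIV - {0}. card (X c)) = (\<Sum>c\<in>UNIV - {0 :: 'a}. card (X 1))"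
      by (rule sum.cong[OF refl], rule same) simp
    then show ?thesis using X0 by (simp add: card_Diff_singleton)
  qed
  finally have eq: "CARD('a) * CARD('a) = 1 + (CARD('a) - 1) * card (X 1)" by simp
  have "(2::nat) \<le> CARD('a)"
  proof -
    have "card {0::'a, 1} \<le> CARD('a)" by (intro card_mono) auto
    then show ?thesis by simp
  qed
  then obtain k where k: "CARD('a) = Suc (Suc k)" by (metis add_2_eq_Suc le_Suc_ex)
  have "Suc k * card (X 1) = Suc k * (CARD('a) + 1)" using eq unfolding k by (simp add: algebra_simps)
  then have "card (X 1) = CARD('a) + 1" by (simp only: mult_cancel1) simp
  then show ?thesis using same[OF assms] by (simp add: X_def)
qed

text \<open>These are the matrices of multiplication by the elements x + y sqrt(\<epsilon>) of norm
  1. Besides the order of the group, the equality of the two diagonal entries is needed later: it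
  makes a trace vanish.\<close>

lemma SOminus2_eq:
  "SOminus2 \<epsilon> = (\<lambda>(x, y). mat 2 2 (\<lambda>(i, j). if i = j then x else if i = 0 then \<epsilon> * y else y)) `
     {(u, v). u * u - \<epsilon> * (v * v) = 1}" (is "_ = ?f ` _")
proof (intro equalityI subsetI)
  fix w assume w: "w \<in> SOminus2 \<epsilon>"
  then have wc: "w \<in> carrier_mat 2 2" and weq: "transpose_mat w * delta_eps \<epsilon> * w = delta_eps \<epsilon>"
    and wdet: "det w = 1" by (auto simp: SOminus2_def GL_def)
  define p s t v where d: "p = w $$ (0, 0)" "s = w $$ (0, 1)" "t = w $$ (1, 0)" "v = w $$ (1, 1)"
  have det: "p * v - s * t = 1" using wdet det_2x2[OF wc] d by simp
  have e: "(transpose_mat w * delta_eps \<epsilon> * w) $$ (i, j) = delta_eps \<epsilon> $$ (i, j)" for i j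
    using weq by simp
  have e1: "p * p - \<epsilon> * (t * t) = 1" using e[of 0 0] wc
    by (simp add: scalar_prod_def delta_eps_def d numeral_2_eq_2 algebra_simps)
  have e2: "p * s - \<epsilon> * (t * v) = 0" using e[of 0 1] wc
    by (simp add: scalar_prod_def delta_eps_def d numeral_2_eq_2 algebra_simps)
  \<comment> \<open>The combinations of \<open>e1\<close> and \<open>e2\<close> are chosen so that
    the determinant, which is 1, splits off as a factor.\<close>
  have "v = v * (p * p - \<epsilon> * (t * t)) - t * (p * s - \<epsilon> * (t * v))" using e1 e2 by simp
  also have "\<dots> = p * (p * v - s * t)" by (simp add: algebra_simps)
  finally have v: "v = p" using det by simp
  have "s = s * (p * p - \<epsilon> * (t * t)) - p * (p * s - \<epsilon> * (t * v)) " using e1 e2 by simp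
  also have "\<dots> = \<epsilon> * t * (p * v - s * t)" by (simp add: algebra_simps)
  finally have s: "s = \<epsilon> * t" using det by simp
  have "w = ?f (p, t)"
    by (rule eq_matI) (use wc v s in \<open>auto simp: d less_2_cases_iff\<close>)
  then show "w \<in> ?f ` {(u, v). u * u - \<epsilon> * (v * v) = 1}" using e1 by blast
next
  fix w assume "w \<in> ?f ` {(u, v). u * u - \<epsilon> * (v * v) = 1}"
  then obtain x y where xy: "x * x - \<epsilon> * (y * y) = 1" and w: "w = ?f (x, y)" by auto
  have wc: "w \<in> carrier_mat 2 2" by (simp add: w)
  have "det w = 1" using det_2x2[OF wc] xy by (simp add: w algebra_simps)
  moreover have "transpose_mat w * delta_eps \<epsilon> * w = delta_eps \<epsilon>"
  proof (rule eq_matI)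
    have xx: "x * x = 1 + \<epsilon> * (y * y)" using xy by (simp add: algebra_simps)
    fix i j assume "i < dim_row (delta_eps \<epsilon>)" "j < dim_col (delta_eps \<epsilon>)"
    then show "(transpose_mat w * delta_eps \<epsilon> * w) $$ (i, j) = delta_eps \<epsilon> $$ (i, j)"
      by (auto simp: delta_eps_def w scalar_prod_def less_2_cases_iff numeral_2_eq_2 algebra_simps xx)
  qed (auto simp: w delta_eps_def)
  ultimately show "w \<in> SOminus2 \<epsilon>" using wc by (simp add: SOminus2_def GL_def)
qed

lemma card_SOminus2: "card (SOminus2 \<epsilon>) = CARD('a) + 1"
proof -
  have "inj_on (\<lambda>(x, y). mat 2 2 (\<lambda>(i, j). if i = j then x else if i = 0 then \<epsilon> * y else y)) {(u, v). u * u - \<epsilon> * (v * v) = 1}"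
  proof (rule inj_onI)
    fix p p'
    assume eq: "(\<lambda>(x, y). mat 2 2 (\<lambda>(i, j). if i = j then x else if i = 0 then \<epsilon> * y else y)) p =
      (\<lambda>(x, y). mat 2 2 (\<lambda>(i, j). if i = j then x else if i = 0 then \<epsilon> * y else y)) p'"
    have "(case p of (x, y) \<Rightarrow> mat 2 2 (\<lambda>(i, j). if i = j then x else if i = 0 then \<epsilon> * y else y)) $$ (i, 0) =
      (case p' of (x, y) \<Rightarrow> mat 2 2 (\<lambda>(i, j). if i = j then x else if i = 0 then \<epsilon> * y else y)) $$ (i, 0)" for i
      using eq by simp
    from this[of 0] this[of 1] show "p = p'" by (cases p; cases p') simp
  qed
  then show ?thesis unfolding SOminus2_eq using card_norm_form[of 1] by (simp add: card_image)
qed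

end

section \<open>Traces, horizontal concatenation and Gram matrices\<close>

lemma mat_tr_mult_commute:
  assumes "A \<in> carrier_mat r c" "B \<in> carrier_mat c r"
  shows "mat_tr (A * B) = mat_tr (B * A)"
proof -
  have "mat_tr (A * B) = (\<Sum>i<r. \<Sum>k<c. A $$ (i, k) * B $$ (k, i))"
    using assms by (simp add: mat_tr_def scalar_prod_def atLeast0LessThan)
  also have "\<dots> = (\<Sum>k<c. \<Sum>i<r. B $$ (k, i) * A $$ (i, k))"
    by (subst sum.swap) (simp only: mult.commute)
  also have "\<dots> = mat_tr (B * A)"
    using assms by (simp add: mat_tr_def scalar_prod_def atLeast0LessThan)
  finally show ?thesis .
qed

lemma mat_tr_four_block:
  assumes "A \<in> carrier_mat n n" "D \<in> carrier_mat m m"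
  shows "mat_tr (four_block_mat A B C D) = mat_tr A + mat_tr D"
proof -
  have "mat_tr (four_block_mat A B C D) = (\<Sum>i<n + m. if i < n then A $$ (i, i) else D $$ (i - n, i - n))"
    using assms by (auto simp: mat_tr_def intro!: sum.cong)
  also have "\<dots> = (\<Sum>i = 0..<n. if i < n then A $$ (i, i) else D $$ (i - n, i - n)) +
      (\<Sum>i = 0 + n..<m + n. if i < n then A $$ (i, i) else D $$ (i - n, i - n))"
    unfolding lessThan_atLeast0
    using sum.atLeastLessThan_concat[of 0 n "m + n" "\<lambda>i. if i < n then A $$ (i, i) else D $$ (i - n, i - n)"]
    by (simp only: add.commute[of n m] add_0 zero_le le_add2)
  also have "\<dots> = (\<Sum>i<n. A $$ (i, i)) + (\<Sum>i<m. D $$ (i, i))"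
    unfolding sum.shift_bounds_nat_ivl by (simp add: lessThan_atLeast0)
  finally show ?thesis using assms by (simp add: mat_tr_def)
qed

text \<open>Concatenation as a block matrix with two empty lower blocks, so that the rules for
  multiplying and transposing block matrices apply.\<close>

definition hcat :: "'a::zero mat \<Rightarrow> 'a mat \<Rightarrow> 'a mat" where
  "hcat A B = four_block_mat A B (0\<^sub>m 0 (dim_col A)) (0\<^sub>m 0 (dim_col B))"

lemma hcat_carrier:
  assumes "A \<in> carrier_mat r c1" "B \<in> carrier_mat r c2"
  shows "hcat A B \<in> carrier_mat r (c1 + c2)"
  using assms by (auto simp: hcat_def)

lemma bij_betw_hcat:
  "bij_betw (\<lambda>(A, B). hcat A B) (carrier_mat r c1 \<times> carrier_mat r c2) (carrier_mat r (c1 + c2) :: 'a::zero mat set)"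
  unfolding bij_betw_def
proof
  show "inj_on (\<lambda>(A, B). hcat A B) (carrier_mat r c1 \<times> carrier_mat r c2)"
    by (auto simp: inj_on_def hcat_def four_block_inject[of _ r c1 _ c2 _ 0])
  show "(\<lambda>(A, B). hcat A B) ` (carrier_mat r c1 \<times> carrier_mat r c2) = (carrier_mat r (c1 + c2) :: 'a mat set)"
  proof (intro equalityI subsetI)
    fix M :: "'a mat" assume "M \<in> carrier_mat r (c1 + c2)"
    then have "M \<in> carrier_mat (r + 0) (c1 + c2)" by simp
    from four_block_cases[OF this] obtain A B C D where bl: "A \<in> carrier_mat r c1" "B \<in> carrier_mat r c2"
      "C \<in> carrier_mat 0 c1" "D \<in> carrier_mat 0 c2" "M = four_block_mat A B C D" by metis
    have "C = 0\<^sub>m 0 c1" "D = 0\<^sub>m 0 c2" using bl by (auto intro!: eq_matI)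
    then show "M \<in> (\<lambda>(A, B). hcat A B) ` (carrier_mat r c1 \<times> carrier_mat r c2)" using bl by (intro image_eqI[of _ _ "(A, B)"]) (auto simp: hcat_def)
  qed (auto simp: hcat_carrier)
qed

lemma delta_eps_carrier [simp]: "delta_eps \<epsilon> \<in> carrier_mat 2 2"
  by (simp add: delta_eps_def)

definition gram :: "'a::field \<Rightarrow> 'a mat \<Rightarrow> 'a mat" where
  "gram \<epsilon> h = transpose_mat h * delta_eps \<epsilon> * h"

lemma gram_carrier: "h \<in> carrier_mat 2 r \<Longrightarrow> gram \<epsilon> h \<in> carrier_mat r r"
  unfolding gram_def by (intro mult_carrier_mat[of _ r 2]) auto

lemma gram_mult:
  assumes "h \<in> carrier_mat 2 r" "P \<in> carrier_mat r k"
  shows "gram \<epsilon> (h * P) = transpose_mat P * gram \<epsilon> h * P"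
proof -
  have "gram \<epsilon> (h * P) = transpose_mat P * transpose_mat h * delta_eps \<epsilon> * (h * P)"
    using assms by (simp add: gram_def transpose_mult[of _ 2 r _ k])
  also have "\<dots> = transpose_mat P * transpose_mat h * delta_eps \<epsilon> * h * P"
    using assms by (intro assoc_mult_mat[symmetric, of _ k 2 _ r _ k] mult_carrier_mat[of _ k 2] mult_carrier_mat[of _ k r]) auto
  also have "transpose_mat P * transpose_mat h * delta_eps \<epsilon> = transpose_mat P * (transpose_mat h * delta_eps \<epsilon>)"
    using assms by (intro assoc_mult_mat[of _ k r _ 2 _ 2]) auto
  also have "transpose_mat P * (transpose_mat h * delta_eps \<epsilon>) * h = transpose_mat P * gram \<epsilon> h"
    unfolding gram_def using assms by (intro assoc_mult_mat[of _ k r _ 2 _ r] mult_carrier_mat[of _ r 2]) auto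
  finally show ?thesis .
qed

lemma transpose_delta_eps: "transpose_mat (delta_eps \<epsilon>) = delta_eps \<epsilon>"
  by (rule eq_matI) (auto simp: delta_eps_def)

lemma transpose_gram_eps:
  assumes "h \<in> carrier_mat 2 r"
  shows "transpose_mat (gram \<epsilon> h) = gram \<epsilon> h"
proof -
  have c: "transpose_mat h * delta_eps \<epsilon> \<in> carrier_mat r 2" using assms by (intro mult_carrier_mat[of _ r 2]) auto
  have "transpose_mat (gram \<epsilon> h) = transpose_mat h * transpose_mat (transpose_mat h * delta_eps \<epsilon>)"
    unfolding gram_def using transpose_mult[OF c assms] .
  also have "transpose_mat (transpose_mat h * delta_eps \<epsilon>) = delta_eps \<epsilon> * h"
    using assms by (subst transpose_mult[of _ r 2 _ 2]) (auto simp: transpose_delta_eps)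
  also have "transpose_mat h * (delta_eps \<epsilon> * h) = gram \<epsilon> h"
    unfolding gram_def using assms by (intro assoc_mult_mat[symmetric, of _ r 2 _ 2 _ r]) auto
  finally show ?thesis .
qed

lemma gram_hcat:
  assumes "g \<in> carrier_mat 2 c1" "h \<in> carrier_mat 2 c2"
  shows "gram \<epsilon> (hcat g h) = four_block_mat (gram \<epsilon> g) (transpose_mat g * delta_eps \<epsilon> * h)
    (transpose_mat h * delta_eps \<epsilon> * g) (gram \<epsilon> h)"
proof -
  have h: "hcat g h = four_block_mat g h (0\<^sub>m 0 c1) (0\<^sub>m 0 c2)" using assms by (simp add: hcat_def)
  have t: "transpose_mat (hcat g h) = four_block_mat (transpose_mat g) (0\<^sub>m c1 0) (transpose_mat h) (0\<^sub>m c2 0)"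
    unfolding h using assms by (subst transpose_four_block_mat[of _ 2 c1 _ c2 _ 0]) auto
  \<comment> \<open>The same device for the middle factor: empty blocks make all three factors block
    matrices of matching shape.\<close>
  have d: "delta_eps \<epsilon> = four_block_mat (delta_eps \<epsilon>) (0\<^sub>m 2 0) (0\<^sub>m 0 2) (0\<^sub>m 0 0)"
    by (rule eq_matI) (auto simp: delta_eps_def)
  have c: "transpose_mat g * delta_eps \<epsilon> \<in> carrier_mat c1 2" "transpose_mat h * delta_eps \<epsilon> \<in> carrier_mat c2 2"
    using assms by (intro mult_carrier_mat[of _ _ 2]; simp)+
  have z: "0\<^sub>m k 0 * B = 0\<^sub>m k l" if "B \<in> carrier_mat 0 l" for k l and B :: "'a mat"
    using that by (intro eq_matI) (auto simp: scalar_prod_def)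
  have e: "A = 0\<^sub>m k 0" if "A \<in> carrier_mat k 0" for k and A :: "'a mat"
    using that by (intro eq_matI) auto
  have "transpose_mat (hcat g h) * delta_eps \<epsilon> = four_block_mat (transpose_mat g) (0\<^sub>m c1 0) (transpose_mat h) (0\<^sub>m c2 0)
      * four_block_mat (delta_eps \<epsilon>) (0\<^sub>m 2 0) (0\<^sub>m 0 2) (0\<^sub>m 0 0)"
    by (simp only: t d[symmetric])
  also have "\<dots> = four_block_mat (transpose_mat g * delta_eps \<epsilon> + 0\<^sub>m c1 0 * 0\<^sub>m 0 2) (transpose_mat g * 0\<^sub>m 2 0 + 0\<^sub>m c1 0 * 0\<^sub>m 0 0)
      (transpose_mat h * delta_eps \<epsilon> + 0\<^sub>m c2 0 * 0\<^sub>m 0 2) (transpose_mat h * 0\<^sub>m 2 0 + 0\<^sub>m c2 0 * 0\<^sub>m 0 0)"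
    using assms by (intro mult_four_block_mat) auto
  also have "transpose_mat g * 0\<^sub>m 2 0 + 0\<^sub>m c1 0 * 0\<^sub>m 0 0 = 0\<^sub>m c1 0" using assms by (intro e) auto
  also have "transpose_mat h * 0\<^sub>m 2 0 + 0\<^sub>m c2 0 * 0\<^sub>m 0 0 = 0\<^sub>m c2 0" using assms by (intro e) auto
  finally have "transpose_mat (hcat g h) * delta_eps \<epsilon> =
      four_block_mat (transpose_mat g * delta_eps \<epsilon>) (0\<^sub>m c1 0) (transpose_mat h * delta_eps \<epsilon>) (0\<^sub>m c2 0)"
    by (simp add: z right_add_zero_mat[OF c(1)] right_add_zero_mat[OF c(2)])
  then have "gram \<epsilon> (hcat g h) = four_block_mat (transpose_mat g * delta_eps \<epsilon>) (0\<^sub>m c1 0) (transpose_mat h * delta_eps \<epsilon>) (0\<^sub>m c2 0)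
      * four_block_mat g h (0\<^sub>m 0 c1) (0\<^sub>m 0 c2)"
    by (simp only: gram_def h)
  also have "\<dots> = four_block_mat (transpose_mat g * delta_eps \<epsilon> * g + 0\<^sub>m c1 0 * 0\<^sub>m 0 c1) (transpose_mat g * delta_eps \<epsilon> * h + 0\<^sub>m c1 0 * 0\<^sub>m 0 c2)
      (transpose_mat h * delta_eps \<epsilon> * g + 0\<^sub>m c2 0 * 0\<^sub>m 0 c1) (transpose_mat h * delta_eps \<epsilon> * h + 0\<^sub>m c2 0 * 0\<^sub>m 0 c2)"
    using assms c by (intro mult_four_block_mat) auto
  also have "\<dots> = four_block_mat (gram \<epsilon> g) (transpose_mat g * delta_eps \<epsilon> * h)
    (transpose_mat h * delta_eps \<epsilon> * g) (gram \<epsilon> h)"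
    unfolding gram_def using assms
    by (simp add: z right_add_zero_mat[OF mult_carrier_mat[OF c(1)]] right_add_zero_mat[OF mult_carrier_mat[OF c(2)]])
  finally show ?thesis .
qed

subsection \<open>Character sums over matrices\<close>

lemma quadratic_entry:
  fixes M :: "'a::comm_ring_1 mat"
  assumes "M \<in> carrier_mat n n" "P \<in> carrier_mat n n" "k < n"
  shows "(transpose_mat P * M * P) $$ (k, k) = (\<Sum>i<n. \<Sum>j<n. P $$ (i, k) * M $$ (i, j) * P $$ (j, k))"
  using assms by (simp add: scalar_prod_def atLeast0LessThan sum_distrib_left mult.assoc)

text \<open>Polarisation: if the quadratic form vanished on all basis vectors and on their pairwise
  sums, then 2 M would be zero.\<close>

lemma symGL_anisotropic_vector:
  assumes M: "M \<in> symGL n" and n: "0 < n" and two: "(2::'a::field) \<noteq> 0"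
  shows "\<exists>v. (\<Sum>i<n. \<Sum>j<n. v i * M $$ (i, j) * v j) \<noteq> (0::'a)"
proof (rule ccontr)
  assume "\<not> ?thesis"
  then have z: "(\<Sum>i<n. \<Sum>j<n. v i * M $$ (i, j) * v j) = 0" for v by auto
  have Mc: "M \<in> carrier_mat n n" and sym: "transpose_mat M = M" and det: "det M \<noteq> 0"
    using M by (auto simp: symGL_def GL_def)
  have sy: "M $$ (j, i) = M $$ (i, j)" if "i < n" "j < n" for i j
    using sym Mc that by (metis carrier_matD index_transpose_mat(1))
  have single: "(\<Sum>i<n. \<Sum>j<n. (if i = k then 1 else 0) * M $$ (i, j) * (if j = l then 1 else 0)) = M $$ (k, l)"
    if "k < n" "l < n" for k l
  proof -
    have "(\<Sum>i<n. \<Sum>j<n. (if i = k then 1 else 0) * M $$ (i, j) * (if j = l then 1 else 0)) =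
        (\<Sum>i<n. \<Sum>j<n. if j = l then (if i = k then M $$ (i, j) else 0) else 0)"
      by (intro sum.cong refl) simp
    then show ?thesis using that by simp
  qed
  have diag: "M $$ (k, k) = 0" if "k < n" for k
    using z[of "\<lambda>i. if i = k then 1 else 0"] single[OF that that] by simp
  have "M $$ (k, l) = 0" if kl: "k < n" "l < n" for k l
  proof -
    have "0 = (\<Sum>i<n. \<Sum>j<n. ((if i = k then 1 else 0) + (if i = l then 1 else 0)) * M $$ (i, j) * ((if j = k then 1 else 0) + (if j = l then 1 else 0)))"
      by (rule z[symmetric])
    also have "\<dots> = M $$ (k, k) + M $$ (k, l) + (M $$ (l, k) + M $$ (l, l))"
      unfolding distrib_left distrib_right sum.distrib by (simp only: single kl add_ac)
    also have "\<dots> = 2 * M $$ (k, l)" using diag kl sy[OF kl] by simp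
    finally show ?thesis using two by simp
  qed
  then have "M = 0\<^sub>m n n" using Mc by (intro eq_matI) auto
  then have "det M = 0" using n det_zero[of n] by (cases n) (auto simp: det_def)
  then show False using det by simp
qed

lemma symGL_congruence:
  assumes "M \<in> symGL n" "P \<in> GL n"
  shows "transpose_mat P * M * P \<in> symGL n"
proof -
  have M: "M \<in> carrier_mat n n" "transpose_mat M = M" "M \<in> GL n" and P: "P \<in> carrier_mat n n"
    using assms by (auto simp: symGL_def GL_def)
  have "transpose_mat (transpose_mat P * M * P) = transpose_mat P * M * P"
    using M P by (simp add: transpose_mult[of _ n n _ n] assoc_mult_mat[of _ n n _ n _ n])
  then show ?thesis using M assms by (simp add: symGL_def GL_mult GL_transpose)
qed

context additive_character
begin

text \<open>The Gauss sum of a quadratic form in 2r variables, namely the tensor product of M with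
  the norm form.\<close>

definition tsum :: "'a \<Rightarrow> nat \<Rightarrow> 'a mat \<Rightarrow> complex" where
  "tsum \<epsilon> r M = (\<Sum>h\<in>carrier_mat 2 r. \<psi> (mat_tr (M * gram \<epsilon> h)))"

text \<open>Cyclicity of the trace moves P from M to h, and right multiplication by an invertible
  matrix permutes all h.\<close>

lemma tsum_congruence:
  assumes M: "M \<in> carrier_mat n n" and P: "P \<in> GL n"
  shows "tsum \<epsilon> n (transpose_mat P * M * P) = tsum \<epsilon> n M"
proof -
  have Pc: "P \<in> carrier_mat n n" using P by (rule GL_carrier)
  have tr: "mat_tr (transpose_mat P * M * P * gram \<epsilon> h) = mat_tr (M * gram \<epsilon> (h * transpose_mat P))"
    if h: "h \<in> carrier_mat 2 n" for h
  proof -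
    note g = gram_carrier[OF h, of \<epsilon>]
    have "mat_tr (transpose_mat P * M * P * gram \<epsilon> h) = mat_tr (transpose_mat P * (M * P * gram \<epsilon> h))"
      using M Pc g by (simp add: assoc_mult_mat[of _ n n _ n _ n])
    also have "\<dots> = mat_tr (M * P * gram \<epsilon> h * transpose_mat P)"
      using M Pc g by (intro mat_tr_mult_commute[of _ n n]) auto
    also have "M * P * gram \<epsilon> h * transpose_mat P = M * gram \<epsilon> (h * transpose_mat P)"
      using M Pc g h by (simp add: gram_mult[of h n _ n] assoc_mult_mat[of _ n n _ n _ n])
    finally show ?thesis .
  qed
  have "tsum \<epsilon> n (transpose_mat P * M * P) = (\<Sum>h\<in>carrier_mat 2 n. \<psi> (mat_tr (M * gram \<epsilon> (h * transpose_mat P))))"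
    unfolding tsum_def by (intro sum.cong refl) (simp only: tr)
  also have "\<dots> = tsum \<epsilon> n M"
    unfolding tsum_def
    by (rule sum.reindex_bij_betw[OF bij_betw_mult_right_GL[OF GL_transpose[OF P]]])
  finally show ?thesis .
qed

lemma tsum_four_block_diag:
  assumes "D \<in> carrier_mat c1 c1" "S \<in> carrier_mat c2 c2"
  shows "tsum \<epsilon> (c1 + c2) (four_block_mat D (0\<^sub>m c1 c2) (0\<^sub>m c2 c1) S) = tsum \<epsilon> c1 D * tsum \<epsilon> c2 S"
proof -
  let ?M = "four_block_mat D (0\<^sub>m c1 c2) (0\<^sub>m c2 c1) S"
  have tr: "mat_tr (?M * gram \<epsilon> (hcat g h)) = mat_tr (D * gram \<epsilon> g) + mat_tr (S * gram \<epsilon> h)"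
    if gh: "g \<in> carrier_mat 2 c1" "h \<in> carrier_mat 2 c2" for g h
  proof -
    let ?X = "transpose_mat g * delta_eps \<epsilon> * h" and ?Y = "transpose_mat h * delta_eps \<epsilon> * g"
    have X: "?X \<in> carrier_mat c1 c2" "?Y \<in> carrier_mat c2 c1"
      using gh by (auto intro!: mult_carrier_mat[of _ _ 2])
    note G = gram_carrier[OF gh(1), of \<epsilon>] gram_carrier[OF gh(2), of \<epsilon>]
    have "?M * gram \<epsilon> (hcat g h) = four_block_mat (D * gram \<epsilon> g + 0\<^sub>m c1 c2 * ?Y) (D * ?X + 0\<^sub>m c1 c2 * gram \<epsilon> h)
       (0\<^sub>m c2 c1 * gram \<epsilon> g + S * ?Y) (0\<^sub>m c2 c1 * ?X + S * gram \<epsilon> h)"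
      unfolding gram_hcat[OF gh] using assms X G by (intro mult_four_block_mat) auto
    also have "D * gram \<epsilon> g + 0\<^sub>m c1 c2 * ?Y = D * gram \<epsilon> g"
      using left_mult_zero_mat[OF X(2)] right_add_zero_mat[OF mult_carrier_mat[OF assms(1) G(1)]] by simp
    also have "0\<^sub>m c2 c1 * ?X + S * gram \<epsilon> h = S * gram \<epsilon> h"
      using left_mult_zero_mat[OF X(1)] left_add_zero_mat[OF mult_carrier_mat[OF assms(2) G(2)]] by simp
    finally show ?thesis
      using mat_tr_four_block[OF mult_carrier_mat[OF assms(1) G(1)] mult_carrier_mat[OF assms(2) G(2)]] by simp
  qed
  have "tsum \<epsilon> (c1 + c2) ?M = (\<Sum>(g, h)\<in>carrier_mat 2 c1 \<times> carrier_mat 2 c2. \<psi> (mat_tr (?M * gram \<epsilon> (hcat g h))))"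
    unfolding tsum_def by (subst sum.reindex_bij_betw[OF bij_betw_hcat, symmetric]) (simp only: case_prod_unfold)
  also have "\<dots> = (\<Sum>(g, h)\<in>carrier_mat 2 c1 \<times> carrier_mat 2 c2. \<psi> (mat_tr (D * gram \<epsilon> g)) * \<psi> (mat_tr (S * gram \<epsilon> h)))"
    by (intro sum.cong refl) (auto simp: tr add)
  also have "\<dots> = tsum \<epsilon> c1 D * tsum \<epsilon> c2 S"
    unfolding tsum_def by (simp only: sum.cartesian_product[symmetric] sum_product)
  finally show ?thesis .
qed

text \<open>The value 0 of the norm form is taken once and every other value q + 1 times. Since the
  characters of the nonzero values sum to -1, the result is 1 - (q + 1).\<close>

lemma tsum_1:
  assumes nonsq: "\<forall>b. b * b \<noteq> \<epsilon>" and d: "d \<noteq> 0"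
  shows "tsum \<epsilon> 1 (d \<cdot>\<^sub>m 1\<^sub>m 1) = - of_nat CARD('a)"
proof -
  let ?f = "\<lambda>(u, v). mat 2 1 (\<lambda>(i, j). if i = 0 then u else v) :: 'a mat"
  have bij: "bij_betw ?f UNIV (carrier_mat 2 1)"
    by (rule bij_betw_byWitness[of _ "\<lambda>h. (h $$ (0, 0), h $$ (1, 0))"])
      (auto intro!: eq_matI simp: less_Suc_eq numeral_2_eq_2)
  have tr: "mat_tr (d \<cdot>\<^sub>m 1\<^sub>m 1 * gram \<epsilon> (?f (u, v))) = d * (u * u - \<epsilon> * (v * v))" for u v
    by (simp add: mat_tr_def gram_def scalar_prod_def delta_eps_def numeral_2_eq_2 algebra_simps)
  define X where "X c = {(u, v). u * u - \<epsilon> * (v * v) = c}" for c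
  have X0: "card (X 0) = 1"
  proof -
    have "X 0 = {(0, 0)}" unfolding X_def norm_form_eq_0_iff[OF nonsq] by auto
    then show ?thesis by simp
  qed
  have Xc: "card (X c) = CARD('a) + 1" if "c \<noteq> 0" for c
    using card_norm_form[OF nonsq that] by (simp add: X_def)
  have "tsum \<epsilon> 1 (d \<cdot>\<^sub>m 1\<^sub>m 1) = (\<Sum>p\<in>UNIV. \<psi> (mat_tr (d \<cdot>\<^sub>m 1\<^sub>m 1 * gram \<epsilon> (?f p))))"
    unfolding tsum_def by (rule sum.reindex_bij_betw[OF bij, symmetric])
  also have "\<dots> = (\<Sum>p\<in>UNIV. \<psi> (d * (fst p * fst p - \<epsilon> * (snd p * snd p))))"
    by (rule sum.cong[OF refl]) (metis tr prod.collapse)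
  also have "\<dots> = (\<Sum>c\<in>UNIV. \<Sum>p\<in>{p\<in>UNIV. fst p * fst p - \<epsilon> * (snd p * snd p) = c}. \<psi> (d * (fst p * fst p - \<epsilon> * (snd p * snd p))))"
    by (rule sum.group[symmetric]) auto
  also have "\<dots> = (\<Sum>c\<in>UNIV. of_nat (card (X c)) * \<psi> (d * c))"
  proof (rule sum.cong[OF refl])
    fix c
    have "{p\<in>UNIV. fst p * fst p - \<epsilon> * (snd p * snd p) = c} = X c" by (auto simp: X_def)
    then show "(\<Sum>p\<in>{p\<in>UNIV. fst p * fst p - \<epsilon> * (snd p * snd p) = c}. \<psi> (d * (fst p * fst p - \<epsilon> * (snd p * snd p)))) = of_nat (card (X c)) * \<psi> (d * c)"
      by (simp add: X_def case_prod_unfold)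
  qed
  also have "\<dots> = 1 + (\<Sum>c\<in>UNIV - {0}. of_nat (CARD('a) + 1) * \<psi> (d * c))"
  proof -
    have "(\<Sum>c\<in>UNIV - {0}. of_nat (card (X c)) * \<psi> (d * c)) = (\<Sum>c\<in>UNIV - {0}. of_nat (CARD('a) + 1) * \<psi> (d * c))"
      by (rule sum.cong[OF refl], subst Xc) auto
    then show ?thesis by (simp add: sum.remove[of UNIV 0] X0)
  qed
  also have "(\<Sum>c\<in>UNIV - {0}. of_nat (CARD('a) + 1) * \<psi> (d * c)) = of_nat (CARD('a) + 1) * ((\<Sum>c\<in>UNIV. \<psi> (d * c)) - 1)"
    by (simp add: sum_diff1 sum_distrib_left[symmetric])
  finally show ?thesis using d by (simp add: sum_mult)
qed

text \<open>Diagonalisation by congruence, one pivot at a time. Each pivot contributes -q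
  irrespective of its value, so the sum depends only on the size of M and not on its
  discriminant.\<close>

theorem tsum_symGL:
  assumes nonsq: "\<forall>b. b * b \<noteq> \<epsilon>" and two: "(2::'a) \<noteq> 0" and M: "M \<in> symGL r"
  shows "tsum \<epsilon> r M = (- of_nat CARD('a)) ^ r"
  using M
proof (induction r arbitrary: M)
  case 0
  have "carrier_mat 2 0 = {0\<^sub>m 2 0 :: 'a mat}" by (auto intro!: eq_matI)
  moreover have "mat_tr (M * gram \<epsilon> (0\<^sub>m 2 0)) = 0" using 0 by (auto simp: mat_tr_def symGL_def GL_def)
  ultimately show ?case by (simp add: tsum_def)
next
  case (Suc m)
  obtain v where v: "(\<Sum>i<Suc m. \<Sum>j<Suc m. v i * M $$ (i, j) * v j) \<noteq> 0"
    using symGL_anisotropic_vector[OF Suc.prems _ two] by auto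
  define w where "w = mat (Suc m) 1 (\<lambda>(i, j). v i)"
  have w: "w \<in> carrier_mat (Suc m) 1" by (simp add: w_def)
  have "w \<noteq> 0\<^sub>m (Suc m) 1"
  proof
    assume "w = 0\<^sub>m (Suc m) 1"
    then have "v i = 0" if "i < Suc m" for i
      using that unfolding w_def by (metis index_mat(1) case_prod_conv index_zero_mat(1) less_one)
    then show False using v by (simp del: sum.lessThan_Suc)
  qed
  \<comment> \<open>The first column of P is a vector on which the form does not vanish, so the
    congruent matrix N has a nonzero corner and its Schur complement can be split off.\<close>
  then obtain P where P: "P \<in> GL (Suc m)" "P * ecol (Suc m) = w" using GL_transitive[OF w] by auto
  note Pc = GL_carrier[OF P(1)]
  have Mc: "M \<in> carrier_mat (Suc m) (Suc m)" using Suc.prems by (simp add: symGL_def GL_def)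
  have col: "P $$ (i, 0) = v i" if "i < Suc m" for i
    using P(2) mult_ecol_eq_iff[OF Pc _ w] that by (simp add: w_def)
  define N where "N = transpose_mat P * M * P"
  have N: "N \<in> symGL (Suc m)" unfolding N_def by (rule symGL_congruence[OF Suc.prems P(1)])
  have "N $$ (0, 0) = (\<Sum>i<Suc m. \<Sum>j<Suc m. v i * M $$ (i, j) * v j)"
    unfolding N_def by (subst quadratic_entry[OF Mc Pc]) (auto simp: col simp del: sum.lessThan_Suc)
  then have d: "N $$ (0, 0) \<noteq> 0" using v by simp
  have Nc: "N \<in> carrier_mat (Suc m) (Suc m)" "transpose_mat N = N" "det N \<noteq> 0" using N by (auto simp: symGL_def GL_def)
  from symmetric_four_block_cases[OF Nc(1,2)] obtain b A where bA: "b \<in> carrier_mat 1 m" "A \<in> carrier_mat m m"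
    "transpose_mat A = A" "N = four_block_mat (N $$ (0, 0) \<cdot>\<^sub>m 1\<^sub>m 1) b (transpose_mat b) A" by metis
  let ?d = "N $$ (0, 0)"
  define E where "E = (1 / ?d) \<cdot>\<^sub>m (transpose_mat b * b)"
  have E: "E \<in> carrier_mat m m" "transpose_mat E = E" unfolding E_def using bA transpose_gram[OF bA(1)]
    by (auto simp: transpose_smult)
  define S where "S = A - E"
  have S: "S \<in> carrier_mat m m" "transpose_mat S = S"
    unfolding S_def using E bA by (auto simp: transpose_minus[of _ m m])
  have "S + E = A" unfolding S_def using E bA by (intro eq_matI) auto
  then have Nf: "N = four_block_mat (?d \<cdot>\<^sub>m 1\<^sub>m 1) b (transpose_mat b) (S + (1 / ?d) \<cdot>\<^sub>m (transpose_mat b * b))"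
    using bA(4) by (simp add: E_def)
  let ?D = "four_block_mat (?d \<cdot>\<^sub>m 1\<^sub>m 1) (0\<^sub>m 1 m) (0\<^sub>m m 1) S"
  let ?L = "shear ((1 / ?d) \<cdot>\<^sub>m b)"
  have L: "?L \<in> GL (Suc m)" by (rule shear_GL) (use bA in simp)
  have Dc: "?D \<in> carrier_mat (Suc m) (Suc m)"
    using four_block_carrier_mat[of "?d \<cdot>\<^sub>m 1\<^sub>m 1" 1 1 S m m] S by simp
  have "det N = ?d * det S" using four_block_schur(2)[OF d bA(1) S(1)] Nf by simp
  then have S': "S \<in> symGL m" using S Nc by (auto simp: symGL_def GL_def)
  have "N = ?L * ?D * transpose_mat ?L" using four_block_schur(1)[OF d bA(1) S(1)] Nf by simp
  then have NL: "N = transpose_mat (transpose_mat ?L) * ?D * transpose_mat ?L" by simp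
  have "tsum \<epsilon> (Suc m) M = tsum \<epsilon> (Suc m) N" unfolding N_def by (rule tsum_congruence[OF Mc P(1), symmetric])
  also have "\<dots> = tsum \<epsilon> (Suc m) ?D"
    by (subst NL) (rule tsum_congruence[OF Dc GL_transpose[OF L]])
  also have "\<dots> = tsum \<epsilon> 1 (?d \<cdot>\<^sub>m 1\<^sub>m 1) * tsum \<epsilon> m S"
    using tsum_four_block_diag[of "?d \<cdot>\<^sub>m 1\<^sub>m 1" 1 S m \<epsilon>] S by simp
  also have "\<dots> = (- of_nat CARD('a)) ^ Suc m"
    using tsum_1[OF nonsq d] Suc.IH[OF S'] by simp
  finally show ?case .
qed

end

text \<open>The adjugate of a 2 x 2 matrix has the same trace as the matrix.\<close>

lemma minv_2x2:
  assumes A: "A \<in> GL 2"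
  shows "mat_tr (minv A) = mat_tr A / det A"
proof -
  have Ac: "A \<in> carrier_mat 2 2" and D: "det A \<noteq> 0" using A by (auto simp: GL_def)
  define B where "B = mat 2 2 (\<lambda>(i, j). if i = 0 \<and> j = 0 then A $$ (1, 1) / det A
      else if i = 0 then - A $$ (0, 1) / det A else if j = 0 then - A $$ (1, 0) / det A else A $$ (0, 0) / det A)"
  have det: "det A = A $$ (0, 0) * A $$ (1, 1) - A $$ (0, 1) * A $$ (1, 0)" by (rule det_2x2[OF Ac])
  have "A * B = 1\<^sub>m 2"
  proof (rule eq_matI)
    fix i j assume "i < dim_row (1\<^sub>m 2)" "j < dim_col (1\<^sub>m 2)"
    then have "i = 0 \<or> i = 1" "j = 0 \<or> j = 1" by auto
    then show "(A * B) $$ (i, j) = 1\<^sub>m 2 $$ (i, j)"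
      using Ac D det by (auto simp: B_def scalar_prod_def numeral_2_eq_2 diff_divide_distrib[symmetric] mult.commute)
  qed (use Ac in \<open>auto simp: B_def\<close>)
  then have "minv A = B" using minv_unique[OF Ac, of B] by (simp add: B_def)
  then show ?thesis using Ac by (simp add: mat_tr_def B_def numeral_2_eq_2 add_divide_distrib)
qed

section \<open>Skew-symmetric matrices and orthogonality over them\<close>

definition skew :: "nat \<Rightarrow> 'a::field mat set" where
  "skew m = {K \<in> carrier_mat m m. transpose_mat K = - K}"

lemma skewD:
  assumes "K \<in> skew m" "i < m" "j < m"
  shows "K $$ (i, j) = - K $$ (j, i)"
proof -
  have K: "K \<in> carrier_mat m m" "transpose_mat K = - K" using assms by (auto simp: skew_def)
  have "K $$ (i, j) = transpose_mat K $$ (j, i)" using K(1) assms by simp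
  also have "\<dots> = (- K) $$ (j, i)" by (simp only: K(2))
  finally show ?thesis using K(1) assms by simp
qed

lemma skewI:
  assumes "K \<in> carrier_mat m m" "\<And>i j. i < m \<Longrightarrow> j < m \<Longrightarrow> K $$ (i, j) = - K $$ (j, i)"
  shows "K \<in> skew m"
proof -
  have "transpose_mat K = - K"
  proof (rule eq_matI)
    fix i j assume "i < dim_row (- K)" "j < dim_col (- K)"
    then have ij: "i < m" "j < m" using assms(1) by auto
    then show "transpose_mat K $$ (i, j) = (- K) $$ (i, j)"
      using assms(1) assms(2)[OF ij(2,1)] by simp
  qed (use assms(1) in auto)
  then show ?thesis using assms(1) by (simp add: skew_def)
qed

text \<open>The free coordinates are the entries below the diagonal in the rows from r on. The
  diagonal vanishes because 2 is nonzero, and the r x r corner by requirement.\<close>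

lemma card_skew_corner_zero:
  assumes two: "(2::'a::{finite,field}) \<noteq> 0" and r: "r \<le> m"
  shows "card {K \<in> skew m. \<forall>i<r. \<forall>j<r. K $$ (i, j) = (0::'a)} = CARD('a) ^ (\<Sum>i = r..<m. i)"
proof -
  define I where "I = (SIGMA i:{r..<m}. {..<i})"
  let ?f = "\<lambda>f. mat m m (\<lambda>(i, j). if (i, j) \<in> I then f (i, j) else if (j, i) \<in> I then - f (j, i) else 0) :: 'a mat"
  let ?g = "\<lambda>K. restrict (($$) K) I"
  have zero: "x = 0" if "x = - x" for x :: 'a
  proof -
    have "2 * x = 0" using that by (metis add.right_inverse mult_2)
    then show ?thesis using two by simp
  qed
  have "bij_betw ?f (I \<rightarrow>\<^sub>E UNIV) {K \<in> skew m. \<forall>i<r. \<forall>j<r. K $$ (i, j) = (0::'a)}"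
  proof (rule bij_betw_byWitness[of _ ?g])
    show "\<forall>f\<in>I \<rightarrow>\<^sub>E UNIV. ?g (?f f) = f"
    proof
      fix f :: "nat \<times> nat \<Rightarrow> 'a" assume f: "f \<in> I \<rightarrow>\<^sub>E UNIV"
      show "?g (?f f) = f"
      proof (rule ext)
        fix p :: "nat \<times> nat"
        show "?g (?f f) p = f p"
          using f by (cases p; cases "p \<in> I") (auto simp: I_def PiE_def extensional_def)
      qed
    qed
    show "\<forall>K\<in>{K \<in> skew m. \<forall>i<r. \<forall>j<r. K $$ (i, j) = (0::'a)}. ?f (?g K) = K"
    proof
      fix K :: "'a mat" assume "K \<in> {K \<in> skew m. \<forall>i<r. \<forall>j<r. K $$ (i, j) = (0::'a)}"
      then have K: "K \<in> skew m" and z: "\<And>i j. i < r \<Longrightarrow> j < r \<Longrightarrow> K $$ (i, j) = 0" by auto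
      have Kc: "K \<in> carrier_mat m m" using K by (simp add: skew_def)
      show "?f (?g K) = K"
      proof (rule eq_matI)
        fix i j assume "i < dim_row K" "j < dim_col K"
        then have ij: "i < m" "j < m" using Kc by auto
        have "(i, j) \<in> I \<or> (j, i) \<in> I \<or> i = j \<or> i < r \<and> j < r"
          using ij by (simp add: I_def) linarith
        then consider "(i, j) \<in> I" | "(j, i) \<in> I" "(i, j) \<notin> I" | "i = j" | "i < r" "j < r"
          by blast
        then show "?f (?g K) $$ (i, j) = K $$ (i, j)"
        proof cases
          case 3
          then show ?thesis using ij zero[OF skewD[OF K ij(1) ij(1)]] by (simp add: I_def)
        next
          case 4
          then show ?thesis using ij z by (simp add: I_def)
        qed (use ij skewD[OF K ij] in auto)
      qed (use Kc in auto)
    qed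
    show "?f ` (I \<rightarrow>\<^sub>E UNIV) \<subseteq> {K \<in> skew m. \<forall>i<r. \<forall>j<r. K $$ (i, j) = (0::'a)}"
    proof (rule image_subsetI)
      fix f :: "nat \<times> nat \<Rightarrow> 'a"
      have "?f f \<in> skew m" by (rule skewI) (auto simp: I_def)
      then show "?f f \<in> {K \<in> skew m. \<forall>i<r. \<forall>j<r. K $$ (i, j) = (0::'a)}" using r by (auto simp: I_def)
    qed
    show "?g ` {K \<in> skew m. \<forall>i<r. \<forall>j<r. K $$ (i, j) = (0::'a)} \<subseteq> I \<rightarrow>\<^sub>E UNIV"
      by (rule image_subsetI) (simp add: PiE_def)
  qed
  from bij_betw_same_card[OF this]
  have "card {K \<in> skew m. \<forall>i<r. \<forall>j<r. K $$ (i, j) = (0::'a)} = CARD('a) ^ card I"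
    by (simp add: card_PiE I_def)
  also have "card I = (\<Sum>i = r..<m. i)" unfolding I_def by (subst card_SigmaI) auto
  finally show ?thesis .
qed

lemma finite_skew [simp]: "finite (skew m :: 'a::{finite,field} mat set)"
  by (rule finite_subset[of _ "carrier_mat m m"]) (auto simp: skew_def)

lemma card_skew:
  assumes "(2::'a::{finite,field}) \<noteq> 0"
  shows "card (skew m :: 'a mat set) = CARD('a) ^ (\<Sum>i<m. i)"
  using card_skew_corner_zero[OF assms, of 0 m] by (simp add: lessThan_atLeast0)

text \<open>The matrices whose coefficients annihilate the skew-symmetric part in the trace of \<open>\<rho>x\<sigma>\<close>.\<close>

definition corner_symmetric :: "nat \<Rightarrow> nat \<Rightarrow> 'a::zero mat \<Rightarrow> bool" where
  "corner_symmetric r m A \<longleftrightarrow> (\<forall>i<r. \<forall>j<r. A $$ (i, j) = A $$ (j, i)) \<and> (\<forall>i<r. \<forall>j. r \<le> j \<and> j < m \<longrightarrow> A $$ (i, j) = 0)"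

context additive_character
begin

text \<open>Orthogonality on the additive group of skew-symmetric matrices: the linear functional L
  in the exponent either vanishes identically, the trace of a symmetric times a skew-symmetric
  matrix being zero, or some translation by K1 multiplies the sum by \<open>\<psi> y\<close>
  different from 1.\<close>

lemma sum_skew:
  assumes two: "(2::'a) \<noteq> 0" and a: "a \<noteq> 0" and r: "r \<le> m" and A: "A \<in> carrier_mat m m"
  shows "(\<Sum>K\<in>skew m. \<psi> (a * (\<Sum>k<r. (A * K) $$ (k, k)))) =
    (if corner_symmetric r m A then of_nat (card (skew m :: 'a mat set)) else 0)"
proof -
  define L where "L K = (\<Sum>k<r. \<Sum>l<m. A $$ (k, l) * K $$ (l, k))" for K :: "'a mat"
  have LK: "(\<Sum>k<r. (A * K) $$ (k, k)) = L K" if "K \<in> skew m" for K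
  proof -
    have "K \<in> carrier_mat m m" using that by (simp add: skew_def)
    then show ?thesis
      unfolding L_def using A r by (intro sum.cong refl) (simp add: scalar_prod_def atLeast0LessThan)
  qed
  show ?thesis
  proof (cases "corner_symmetric r m A")
    case True
    have "L K = 0" if K: "K \<in> skew m" for K
    proof -
      have *: "L K = (\<Sum>k<r. \<Sum>l<r. A $$ (k, l) * K $$ (l, k))"
        unfolding L_def using True r
        by (intro sum.cong refl sum.mono_neutral_right) (auto simp: corner_symmetric_def)
      from * have "L K = (\<Sum>k<r. \<Sum>l<r. A $$ (k, l) * K $$ (l, k))" .
      also have "(\<Sum>k<r. \<Sum>l<r. A $$ (k, l) * K $$ (l, k)) = (\<Sum>l<r. \<Sum>k<r. - (A $$ (l, k) * K $$ (k, l)))"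
      proof (subst sum.swap, intro sum.cong refl)
        fix k l assume "l \<in> {..<r}" "k \<in> {..<r}"
        then have kl: "k < r" "l < r" "k < m" "l < m" using r by auto
        show "A $$ (k, l) * K $$ (l, k) = - (A $$ (l, k) * K $$ (k, l))"
          using True kl skewD[OF K kl(4,3)] by (simp add: corner_symmetric_def)
      qed
      also have "\<dots> = - L K" unfolding * sum_negf ..
      finally have "2 * L K = 0" by (metis add.right_inverse mult_2)
      then show ?thesis using two by simp
    qed
    then show ?thesis using True by (simp add: LK)
  next
    case False
    have "\<exists>K0\<in>skew m. L K0 \<noteq> 0"
    proof -
      \<comment> \<open>Elementary skew-symmetric matrices as test elements. At \<open>E j i\<close>
        with i < r the functional takes the value A(i,j) - A(j,i) if also j < r, and A(i,j) if j
        lies beyond the corner.\<close>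
      define E where "E p q = mat m m (\<lambda>(i, j). if i = p \<and> j = q then 1 else if i = q \<and> j = p then - 1 else (0::'a))" for p q
      have E: "E p q \<in> skew m" if "p \<noteq> q" for p q
        by (rule skewI) (use that in \<open>auto simp: E_def\<close>)
      have LE: "L (E p q) = (if q < r then A $$ (q, p) else 0) - (if p < r then A $$ (p, q) else 0)"
        if pq: "p \<noteq> q" "p < m" "q < m" for p q
      proof -
        have "L (E p q) = (\<Sum>k<r. \<Sum>l<m. (if l = p then if k = q then A $$ (k, l) else 0 else 0) - (if l = q then if k = p then A $$ (k, l) else 0 else 0))"
          unfolding L_def using pq r by (intro sum.cong refl) (auto simp: E_def)
        also have "\<dots> = (\<Sum>k<r. (if k = q then A $$ (k, p) else 0) - (if k = p then A $$ (k, q) else 0))"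
          using pq by (simp add: sum_subtractf)
        finally show ?thesis using pq by (simp add: sum_subtractf)
      qed
      from False consider i j where "i < r" "j < r" "A $$ (i, j) \<noteq> A $$ (j, i)"
        | i j where "i < r" "r \<le> j" "j < m" "A $$ (i, j) \<noteq> 0"
        unfolding corner_symmetric_def by blast
      then show ?thesis
      proof cases
        case 1
        then have "j \<noteq> i" by auto
        then show ?thesis using 1 r LE[of j i] E[of j i] by (intro bexI[of _ "E j i"]) auto
      next
        case 2
        then show ?thesis using r LE[of j i] E[of j i] by (intro bexI[of _ "E j i"]) auto
      qed
    qed
    then obtain K0 where K0: "K0 \<in> skew m" "L K0 \<noteq> 0" by auto
    obtain y where y: "\<psi> y \<noteq> 1" using nontrivial by auto
    define K1 where "K1 = (y / (a * L K0)) \<cdot>\<^sub>m K0"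
    have K0c: "K0 \<in> carrier_mat m m" using K0 by (simp add: skew_def)
    have K1c: "K1 \<in> carrier_mat m m" using K0c by (simp add: K1_def)
    have K1: "K1 \<in> skew m"
    proof (rule skewI)
      fix i j assume "i < m" "j < m"
      then show "K1 $$ (i, j) = - K1 $$ (j, i)"
        using skewD[OF K0(1), of i j] K0c by (simp add: K1_def)
    qed (rule K1c)
    have "L K1 = (\<Sum>k<r. \<Sum>l<m. (y / (a * L K0)) * (A $$ (k, l) * K0 $$ (l, k)))"
      unfolding L_def using K0c r by (intro sum.cong refl) (auto simp: K1_def L_def mult_ac)
    also have "\<dots> = (y / (a * L K0)) * L K0" by (simp add: L_def sum_distrib_left)
    finally have LK1: "a * L K1 = y" using a K0 by simp
    have Ladd: "L (K + K1) = L K + L K1" if "K \<in> skew m" for K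
    proof -
      have "L (K + K1) = (\<Sum>k<r. \<Sum>l<m. A $$ (k, l) * K $$ (l, k) + A $$ (k, l) * K1 $$ (l, k))"
        unfolding L_def using that K1c r by (intro sum.cong refl) (auto simp: skew_def distrib_left)
      then show ?thesis by (simp add: L_def sum.distrib)
    qed
    have bij: "bij_betw (\<lambda>K. K + K1) (skew m) (skew m)"
    proof (rule bij_betw_byWitness[of _ "\<lambda>K. K - K1"])
      show "\<forall>K\<in>skew m. K + K1 - K1 = K" "\<forall>K\<in>skew m. K - K1 + K1 = K"
        using K1c by (auto simp: skew_def intro!: eq_matI)
      show "(\<lambda>K. K + K1) ` skew m \<subseteq> skew m"
      proof (rule image_subsetI)
        fix K :: "'a mat" assume K: "K \<in> skew m"
        show "K + K1 \<in> skew m"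
        proof (rule skewI)
          fix i j assume ij: "i < m" "j < m"
          show "(K + K1) $$ (i, j) = - (K + K1) $$ (j, i)"
            using K1c ij skewD[OF K ij] skewD[OF K1 ij] by simp
        qed (use K K1c in \<open>auto simp: skew_def\<close>)
      qed
      show "(\<lambda>K. K - K1) ` skew m \<subseteq> skew m"
      proof (rule image_subsetI)
        fix K :: "'a mat" assume K: "K \<in> skew m"
        show "K - K1 \<in> skew m"
        proof (rule skewI)
          fix i j assume ij: "i < m" "j < m"
          show "(K - K1) $$ (i, j) = - (K - K1) $$ (j, i)"
            using K1c ij skewD[OF K ij] skewD[OF K1 ij] by simp
        qed (use K K1c in \<open>auto simp: skew_def\<close>)
      qed
    qed
    let ?S = "\<Sum>K\<in>skew m. \<psi> (a * L K)"
    have "?S = (\<Sum>K\<in>skew m. \<psi> (a * L (K + K1)))"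
      by (rule sum.reindex_bij_betw[OF bij, symmetric])
    also have "\<dots> = (\<Sum>K\<in>skew m. \<psi> y * \<psi> (a * L K))"
      by (intro sum.cong refl) (simp add: Ladd distrib_left LK1 add)
    also have "\<dots> = \<psi> y * ?S" by (simp add: sum_distrib_left)
    finally have "?S = 0" using y by simp
    then show ?thesis using False by (simp add: LK)
  qed
qed

section \<open>The Kloosterman sum for GL(2, q)\<close>

definition kloosterman :: "'a \<Rightarrow> complex" where
  "kloosterman a = (\<Sum>x\<in>UNIV - {0}. \<psi> (a * (x + inverse x)))"

text \<open>Split by the lower left entry z. For z = 0 the sum factors into two Kloosterman sums,
  times q for the free upper right entry. For z \<noteq> 0 the two diagonal entries are free once
  the determinant D is prescribed, and summing over them forces 1 + 1/D = 0, that is D = -1; this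
  leaves (q - 1) q^2.\<close>

lemma sum_GL2:
  assumes a: "a \<noteq> 0"
  shows "(\<Sum>A\<in>GL 2. \<psi> (a * (mat_tr A + mat_tr (minv A)))) =
    of_nat CARD('a) * (kloosterman a ^ 2 + of_nat CARD('a) ^ 2 - of_nat CARD('a))"
proof -
  let ?q = "of_nat CARD('a) :: complex"
  define f where "f = (\<lambda>(x, y, z, w). mat 2 2 (\<lambda>(i, j). if i = 0 then (if j = 0 then x else y) else if j = 0 then z else (w::'a)))"
  define g where "g = (\<lambda>(x, y, z, w). \<psi> (a * ((x + w) + (x + w) / (x * w - y * z))))"
  define S where "S = {(x, y, z, w). x * w - y * z \<noteq> (0::'a)}"
  have fc: "f p \<in> carrier_mat 2 2" for p by (cases p) (simp add: f_def)
  have fd: "det (f (x, y, z, w)) = x * w - y * z" for x y z w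
    using det_2x2[OF fc[of "(x, y, z, w)"]] by (simp add: f_def)
  have bij: "bij_betw f S (GL 2)"
  proof (rule bij_betw_byWitness[of _ "\<lambda>A. (A $$ (0, 0), A $$ (0, 1), A $$ (1, 0), A $$ (1, 1))"])
    show "\<forall>p\<in>S. (f p $$ (0, 0), f p $$ (0, 1), f p $$ (1, 0), f p $$ (1, 1)) = p"
      by (auto simp: f_def)
    show "\<forall>A\<in>GL 2. f (A $$ (0, 0), A $$ (0, 1), A $$ (1, 0), A $$ (1, 1)) = A"
      by (auto simp: f_def GL_def less_Suc_eq numeral_2_eq_2 intro!: eq_matI)
    show "f ` S \<subseteq> GL 2" using fc fd by (auto simp: S_def GL_def)
    show "(\<lambda>A. (A $$ (0, 0), A $$ (0, 1), A $$ (1, 0), A $$ (1, 1))) ` GL 2 \<subseteq> S"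
    proof (rule image_subsetI)
      fix A :: "'a mat" assume A: "A \<in> GL 2"
      then have "det A \<noteq> 0" by (simp add: GL_def)
      then show "(A $$ (0, 0), A $$ (0, 1), A $$ (1, 0), A $$ (1, 1)) \<in> S"
        unfolding det_2x2[OF GL_carrier[OF A]] by (simp add: S_def)
    qed
  qed
  have gf: "\<psi> (a * (mat_tr (f p) + mat_tr (minv (f p)))) = g p" if "p \<in> S" for p
  proof -
    obtain x y z w where p: "p = (x, y, z, w)" by (metis prod_cases4)
    have "f p \<in> GL 2" using bij that by (auto simp: bij_betw_def)
    then have "mat_tr (minv (f p)) = mat_tr (f p) / det (f p)" by (rule minv_2x2)
    moreover have "mat_tr (f p) = x + w" by (simp add: mat_tr_def f_def p numeral_2_eq_2)
    ultimately show ?thesis by (simp add: p fd g_def)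
  qed
  define S0 where "S0 = {p \<in> S. fst (snd (snd p)) = 0}"
  define S1 where "S1 = {p \<in> S. fst (snd (snd p)) \<noteq> 0}"
  have "(\<Sum>A\<in>GL 2. \<psi> (a * (mat_tr A + mat_tr (minv A)))) = (\<Sum>p\<in>S. \<psi> (a * (mat_tr (f p) + mat_tr (minv (f p)))))"
    by (rule sum.reindex_bij_betw[OF bij, symmetric])
  also have "\<dots> = (\<Sum>p\<in>S. g p)" by (intro sum.cong refl gf)
  also have "\<dots> = (\<Sum>p\<in>S0. g p) + (\<Sum>p\<in>S1. g p)"
  proof -
    have "S = S0 \<union> S1" "S0 \<inter> S1 = {}" by (auto simp: S0_def S1_def)
    then show ?thesis by (simp add: sum.union_disjoint)
  qed
  also have "(\<Sum>p\<in>S0. g p) = ?q * kloosterman a ^ 2"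
  proof -
    let ?U = "UNIV - {0::'a}"
    have b: "bij_betw (\<lambda>(x, w, y). (x, y, 0, w)) (?U \<times> ?U \<times> UNIV) S0"
      by (rule bij_betw_byWitness[of _ "\<lambda>(x, y, z, w). (x, w, y)"]) (auto simp: S0_def S_def)
    have "(\<Sum>p\<in>S0. g p) = (\<Sum>p\<in>?U \<times> ?U \<times> UNIV. g ((\<lambda>(x, w, y). (x, y, 0, w)) p))"
      by (rule sum.reindex_bij_betw[OF b, symmetric])
    also have "\<dots> = (\<Sum>(x, w, y)\<in>?U \<times> ?U \<times> (UNIV :: 'a set). \<psi> (a * (x + inverse x)) * \<psi> (a * (w + inverse w)))"
    proof (intro sum.cong refl)
      fix p assume "p \<in> ?U \<times> ?U \<times> (UNIV :: 'a set)"
      then obtain x w y :: 'a where p: "p = (x, w, y)" "x \<noteq> 0" "w \<noteq> 0" by auto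
      have E: "a * ((x + w) + (x + w) / (x * w)) = a * (x + inverse x) + a * (w + inverse w)"
        using p by (simp add: field_simps)
      have "g (x, y, 0, w) = \<psi> (a * ((x + w) + (x + w) / (x * w)))" by (simp add: g_def)
      also have "\<dots> = \<psi> (a * (x + inverse x)) * \<psi> (a * (w + inverse w))" unfolding E by (rule add)
      finally show "g ((\<lambda>(x, w, y). (x, y, 0, w)) p) = (case p of (x, w, y) \<Rightarrow> \<psi> (a * (x + inverse x)) * \<psi> (a * (w + inverse w)))"
        by (simp only: p prod.case)
    qed
    also have "\<dots> = ?q * kloosterman a ^ 2"
      unfolding sum.cartesian_product[symmetric] kloosterman_def power2_eq_square sum_product
      by (simp add: sum_distrib_left)
    finally show ?thesis .
  qed
  also have "(\<Sum>p\<in>S1. g p) = (?q - 1) * ?q ^ 2"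
  proof -
    let ?U = "UNIV - {0::'a}"
    \<comment> \<open>As z is invertible, the determinant D can replace the upper right entry as a
      coordinate.\<close>
    let ?h = "\<lambda>(z, D, x, w). (x, (x * w - D) / z, z, w)"
    have b: "bij_betw ?h (?U \<times> ?U \<times> UNIV \<times> UNIV) S1"
      by (rule bij_betw_byWitness[of _ "\<lambda>(x, y, z, w). (z, x * w - y * z, x, w)"]) (auto simp: S1_def S_def)
    have "(\<Sum>p\<in>S1. g p) = (\<Sum>p\<in>?U \<times> ?U \<times> UNIV \<times> UNIV. g (?h p))"
      by (rule sum.reindex_bij_betw[OF b, symmetric])
    also have "\<dots> = (\<Sum>(z, D, x, w)\<in>?U \<times> ?U \<times> UNIV \<times> (UNIV :: 'a set). \<psi> ((a * (1 + 1 / D)) * x) * \<psi> ((a * (1 + 1 / D)) * w))"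
    proof (intro sum.cong refl)
      fix p :: "'a \<times> 'a \<times> 'a \<times> 'a" assume "p \<in> ?U \<times> ?U \<times> UNIV \<times> UNIV"
      then obtain z D x w :: 'a where p: "p = (z, D, x, w)" "z \<noteq> 0" "D \<noteq> 0" by auto
      have E: "a * ((x + w) + (x + w) / D) = (a * (1 + 1 / D)) * x + (a * (1 + 1 / D)) * w"
        using p by (simp add: field_simps)
      have "g (x, (x * w - D) / z, z, w) = \<psi> (a * ((x + w) + (x + w) / D))" using p by (simp add: g_def)
      also have "\<dots> = \<psi> ((a * (1 + 1 / D)) * x) * \<psi> ((a * (1 + 1 / D)) * w)" unfolding E by (rule add)
      finally show "g (?h p) = (case p of (z, D, x, w) \<Rightarrow> \<psi> ((a * (1 + 1 / D)) * x) * \<psi> ((a * (1 + 1 / D)) * w))"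
        by (simp only: p prod.case)
    qed
    also have "\<dots> = (\<Sum>z\<in>?U. \<Sum>D\<in>?U. (\<Sum>x\<in>UNIV. \<psi> ((a * (1 + 1 / D)) * x)) * (\<Sum>w\<in>UNIV. \<psi> ((a * (1 + 1 / D)) * w)))"
      by (simp only: sum.cartesian_product[symmetric] sum_product)
    also have "\<dots> = (\<Sum>z\<in>?U. \<Sum>D\<in>?U. if D = - 1 then ?q ^ 2 else 0)"
    proof (intro sum.cong refl)
      fix D :: 'a assume D: "D \<in> ?U"
      have "a * (1 + 1 / D) = 0 \<longleftrightarrow> D = - 1"
      proof -
        have "a * (1 + 1 / D) = a * (D + 1) / D" using D by (simp add: field_simps)
        then show ?thesis using D a by (simp add: eq_neg_iff_add_eq_0)
      qed
      then show "(\<Sum>x\<in>UNIV. \<psi> ((a * (1 + 1 / D)) * x)) * (\<Sum>w\<in>UNIV. \<psi> ((a * (1 + 1 / D)) * w)) = (if D = - 1 then ?q ^ 2 else 0)"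
        unfolding sum_mult by (simp add: power2_eq_square)
    qed
    also have "\<dots> = (?q - 1) * ?q ^ 2" by (simp add: card_Diff_singleton of_nat_diff)
    finally show ?thesis .
  qed
  also have "?q * kloosterman a ^ 2 + (?q - 1) * ?q ^ 2 = ?q * (kloosterman a ^ 2 + ?q ^ 2 - ?q)"
    by (simp add: power2_eq_square algebra_simps)
  finally show ?thesis .
qed

end

subsection \<open>Block matrices\<close>

text \<open>The blocks are given by a function of their position instead of a nested list, which
  allows one formula for all nine blocks of a product.\<close>

definition blk9 :: "nat \<Rightarrow> (nat \<Rightarrow> nat \<Rightarrow> 'a mat) \<Rightarrow> 'a mat" where
  "blk9 m F = mat (2 * m + 2) (2 * m + 2) (\<lambda>(i, j). F (bidx m i) (bidx m j) $$ (bofs m i, bofs m j))"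

definition bsz :: "nat \<Rightarrow> nat \<Rightarrow> nat" where
  "bsz m p = (if p = 2 then 2 else m)"

definition bcar :: "nat \<Rightarrow> (nat \<Rightarrow> nat \<Rightarrow> 'a mat) \<Rightarrow> bool" where
  "bcar m F \<longleftrightarrow> (\<forall>p<3. \<forall>q<3. F p q \<in> carrier_mat (bsz m p) (bsz m q))"

text \<open>Inverse to the splitting of an index into \<open>bidx\<close> and
  \<open>bofs\<close>.\<close>

definition bpos :: "nat \<Rightarrow> nat \<Rightarrow> nat \<Rightarrow> nat" where
  "bpos m p i = p * m + i"

lemma bidx_less: "bidx m i < 3"
  by (simp add: bidx_def)

lemma bofs_less: "i < 2 * m + 2 \<Longrightarrow> bofs m i < bsz m (bidx m i)"
  by (auto simp: bofs_def bsz_def bidx_def)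

lemma bpos_less: "p < 3 \<Longrightarrow> i < bsz m p \<Longrightarrow> bpos m p i < 2 * m + 2"
  by (auto simp: bpos_def bsz_def less_Suc_eq numeral_3_eq_3 numeral_2_eq_2 split: if_splits)

lemma bidx_bpos: "p < 3 \<Longrightarrow> i < bsz m p \<Longrightarrow> bidx m (bpos m p i) = p"
  by (auto simp: bidx_def bpos_def bsz_def less_Suc_eq numeral_3_eq_3 numeral_2_eq_2 split: if_splits)

lemma bofs_bpos: "p < 3 \<Longrightarrow> i < bsz m p \<Longrightarrow> bofs m (bpos m p i) = i"
  by (auto simp: bofs_def bpos_def bsz_def less_Suc_eq numeral_3_eq_3 numeral_2_eq_2 split: if_splits)

lemma bpos_bofs: "i < 2 * m + 2 \<Longrightarrow> bpos m (bidx m i) (bofs m i) = i"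
  by (auto simp: bofs_def bpos_def bidx_def)

lemma blk3_eq: "blk3 m Ms = blk9 m (\<lambda>p q. Ms ! p ! q)"
  by (simp add: blk3_def blk9_def)

lemma blk9_carrier [simp]: "blk9 m F \<in> carrier_mat (2 * m + 2) (2 * m + 2)"
  by (simp add: blk9_def)

lemma blk9_index:
  assumes "p < 3" "q < 3" "i < bsz m p" "j < bsz m q"
  shows "blk9 m F $$ (bpos m p i, bpos m q j) = F p q $$ (i, j)"
  using assms bpos_less[OF assms(1,3)] bpos_less[OF assms(2,4)] by (simp add: blk9_def bidx_bpos bofs_bpos)

lemma blk9_cong:
  assumes "\<And>p q. p < 3 \<Longrightarrow> q < 3 \<Longrightarrow> F p q = G p q"
  shows "blk9 m F = blk9 m G"
  unfolding blk9_def by (intro cong_mat refl) (simp add: assms bidx_less)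

lemma blk9_inject:
  assumes "bcar m F" "bcar m G"
  shows "blk9 m F = blk9 m G \<longleftrightarrow> (\<forall>p<3. \<forall>q<3. F p q = G p q)"
proof
  assume eq: "blk9 m F = blk9 m G"
  show "\<forall>p<3. \<forall>q<3. F p q = G p q"
  proof (intro allI impI)
    fix p q :: nat assume pq: "p < 3" "q < 3"
    have c: "F p q \<in> carrier_mat (bsz m p) (bsz m q)" "G p q \<in> carrier_mat (bsz m p) (bsz m q)"
      using assms pq by (auto simp: bcar_def)
    show "F p q = G p q"
    proof (rule eq_matI)
      fix i j assume "i < dim_row (G p q)" "j < dim_col (G p q)"
      then have "i < bsz m p" "j < bsz m q" using c by auto
      then show "F p q $$ (i, j) = G p q $$ (i, j)" using blk9_index[OF pq] eq by metis
    qed (use c in auto)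
  qed
qed (auto intro: blk9_cong)

lemma sum_blocks:
  "(\<Sum>k<2 * m + 2. f (bidx m k) (bofs m k)) = (\<Sum>k<m. f 0 k) + ((\<Sum>k<m. f 1 k) + (\<Sum>k<2. f 2 k :: 'b::comm_monoid_add))"
proof -
  let ?S = "SIGMA p:{..<3}. {..<bsz m p}"
  have "(\<Sum>k<2 * m + 2. f (bidx m k) (bofs m k)) = (\<Sum>(p, i)\<in>?S. f p i)"
    by (rule sum.reindex_bij_witness[of _ "\<lambda>(p, i). bpos m p i" "\<lambda>k. (bidx m k, bofs m k)"])
      (auto simp: bpos_bofs bidx_bpos bofs_bpos bidx_less bofs_less dest: bpos_less)
  also have "\<dots> = (\<Sum>p<3. \<Sum>i<bsz m p. f p i)" by (rule sum.Sigma[symmetric]) auto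
  also have "\<dots> = (\<Sum>k<m. f 0 k) + ((\<Sum>k<m. f 1 k) + (\<Sum>k<2. f 2 k))"
    by (simp add: numeral_3_eq_3 bsz_def numeral_2_eq_2 add.assoc)
  finally show ?thesis .
qed

lemma blk9_mult:
  assumes F: "bcar m F" and G: "bcar m (G :: nat \<Rightarrow> nat \<Rightarrow> 'a::comm_ring_1 mat)"
  shows "blk9 m F * blk9 m G = blk9 m (\<lambda>p q. F p 0 * G 0 q + (F p 1 * G 1 q + F p 2 * G 2 q))"
proof (rule eq_matI)
  let ?R = "blk9 m (\<lambda>p q. F p 0 * G 0 q + (F p 1 * G 1 q + F p 2 * G 2 q))"
  fix i j assume "i < dim_row ?R" "j < dim_col ?R"
  then have ij: "i < 2 * m + 2" "j < 2 * m + 2" by (auto simp: blk9_def)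
  let ?p = "bidx m i" and ?q = "bidx m j" and ?a = "bofs m i" and ?b = "bofs m j"
  have o: "?a < bsz m ?p" "?b < bsz m ?q" using bofs_less ij by auto
  have Fc: "F ?p t \<in> carrier_mat (bsz m ?p) (bsz m t)" "G t ?q \<in> carrier_mat (bsz m t) (bsz m ?q)" if "t < 3" for t
    using F G that bidx_less by (auto simp: bcar_def)
  have ent: "(F ?p t * G t ?q) $$ (?a, ?b) = (\<Sum>k<bsz m t. F ?p t $$ (?a, k) * G t ?q $$ (k, ?b))"
    if "t < 3" for t
    using Fc[OF that] o by (simp add: scalar_prod_def atLeast0LessThan)
  have prod_car: "F ?p t * G t ?q \<in> carrier_mat (bsz m ?p) (bsz m ?q)" if "t < 3" for t
    using Fc[OF that] by simp
  have "(blk9 m F * blk9 m G) $$ (i, j) = (\<Sum>k<2 * m + 2. F ?p (bidx m k) $$ (?a, bofs m k) * G (bidx m k) ?q $$ (bofs m k, ?b))"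
    using ij by (simp add: blk9_def scalar_prod_def atLeast0LessThan)
  also have "\<dots> = (\<Sum>k<m. F ?p 0 $$ (?a, k) * G 0 ?q $$ (k, ?b)) + ((\<Sum>k<m. F ?p 1 $$ (?a, k) * G 1 ?q $$ (k, ?b))
      + (\<Sum>k<2. F ?p 2 $$ (?a, k) * G 2 ?q $$ (k, ?b)))"
    by (rule sum_blocks)
  also have "\<dots> = (F ?p 0 * G 0 ?q) $$ (?a, ?b) + ((F ?p 1 * G 1 ?q) $$ (?a, ?b) + (F ?p 2 * G 2 ?q) $$ (?a, ?b))"
    by (simp only: ent) (simp add: bsz_def)
  also have "\<dots> = (F ?p 0 * G 0 ?q + (F ?p 1 * G 1 ?q + F ?p 2 * G 2 ?q)) $$ (?a, ?b)"
  proof -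
    have "(X + (Y + Z)) $$ (a, b) = X $$ (a, b) + (Y $$ (a, b) + Z $$ (a, b))"
      if "X \<in> carrier_mat r c" "Y \<in> carrier_mat r c" "Z \<in> carrier_mat r c" "a < r" "b < c" for X Y Z :: "'a mat" and a b r c
      using that by simp
    from this[OF prod_car[of 0] prod_car[of 1] prod_car[of 2] o] show ?thesis by simp
  qed
  also have "\<dots> = ?R $$ (i, j)" using ij by (simp add: blk9_def)
  finally show "(blk9 m F * blk9 m G) $$ (i, j) = ?R $$ (i, j)" .
qed (auto simp: blk9_def)

lemma blk9_transpose:
  assumes F: "bcar m F"
  shows "transpose_mat (blk9 m F) = blk9 m (\<lambda>p q. transpose_mat (F q p))"
proof (rule eq_matI)
  fix i j assume "i < dim_row (blk9 m (\<lambda>p q. transpose_mat (F q p)))" "j < dim_col (blk9 m (\<lambda>p q. transpose_mat (F q p)))"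
  then have ij: "i < 2 * m + 2" "j < 2 * m + 2" by (auto simp: blk9_def)
  have "F (bidx m j) (bidx m i) \<in> carrier_mat (bsz m (bidx m j)) (bsz m (bidx m i))"
    using F bidx_less by (auto simp: bcar_def)
  then show "transpose_mat (blk9 m F) $$ (i, j) = blk9 m (\<lambda>p q. transpose_mat (F q p)) $$ (i, j)"
    using ij bofs_less[of i m] bofs_less[of j m] by (simp add: blk9_def)
qed (auto simp: blk9_def)

definition b9 :: "nat \<Rightarrow> 'a mat \<Rightarrow> 'a mat \<Rightarrow> 'a mat \<Rightarrow> 'a mat \<Rightarrow> 'a mat \<Rightarrow> 'a mat \<Rightarrow> 'a mat \<Rightarrow> 'a mat \<Rightarrow> 'a mat \<Rightarrow> 'a mat" where
  "b9 m a b c d e f g h i = blk3 m [[a, b, c], [d, e, f], [g, h, i]]"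

lemma all_less_3: "(\<forall>p<3. P p) \<longleftrightarrow> P 0 \<and> P 1 \<and> P (2::nat)"
  by (auto simp: numeral_3_eq_3 less_Suc_eq numeral_2_eq_2)

lemma bcar_list_iff:
  "bcar m (\<lambda>p q. [[a, b, c], [d, e, f], [g, h, i]] ! p ! q) \<longleftrightarrow>
    a \<in> carrier_mat m m \<and> b \<in> carrier_mat m m \<and> c \<in> carrier_mat m 2 \<and>
    d \<in> carrier_mat m m \<and> e \<in> carrier_mat m m \<and> f \<in> carrier_mat m 2 \<and>
    g \<in> carrier_mat 2 m \<and> h \<in> carrier_mat 2 m \<and> i \<in> carrier_mat 2 2"
  unfolding bcar_def all_less_3 by (auto simp: bsz_def)

lemma b9_mult:
  fixes a :: "'a::comm_ring_1 mat"
  assumes "bcar m (\<lambda>p q. [[a, b, c], [d, e, f], [g, h, i]] ! p ! q)"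
    "bcar m (\<lambda>p q. [[a', b', c'], [d', e', f'], [g', h', i']] ! p ! q)"
  shows "b9 m a b c d e f g h i * b9 m a' b' c' d' e' f' g' h' i' =
    b9 m (a * a' + (b * d' + c * g')) (a * b' + (b * e' + c * h')) (a * c' + (b * f' + c * i'))
       (d * a' + (e * d' + f * g')) (d * b' + (e * e' + f * h')) (d * c' + (e * f' + f * i'))
       (g * a' + (h * d' + i * g')) (g * b' + (h * e' + i * h')) (g * c' + (h * f' + i * i'))"
  unfolding b9_def blk3_eq blk9_mult[OF assms]
  by (rule blk9_cong) (auto simp: numeral_3_eq_3 less_Suc_eq numeral_2_eq_2)

lemma b9_transpose:
  assumes "bcar m (\<lambda>p q. [[a, b, c], [d, e, f], [g, h, i]] ! p ! q)"
  shows "transpose_mat (b9 m a b c d e f g h i) = b9 m (transpose_mat a) (transpose_mat d) (transpose_mat g)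
    (transpose_mat b) (transpose_mat e) (transpose_mat h) (transpose_mat c) (transpose_mat f) (transpose_mat i)"
  unfolding b9_def blk3_eq blk9_transpose[OF assms]
  by (rule blk9_cong) (auto simp: numeral_3_eq_3 less_Suc_eq numeral_2_eq_2)

lemma b9_inject:
  assumes "bcar m (\<lambda>p q. [[a, b, c], [d, e, f], [g, h, i]] ! p ! q)"
    "bcar m (\<lambda>p q. [[a', b', c'], [d', e', f'], [g', h', i']] ! p ! q)"
  shows "b9 m a b c d e f g h i = b9 m a' b' c' d' e' f' g' h' i' \<longleftrightarrow>
    a = a' \<and> b = b' \<and> c = c' \<and> d = d' \<and> e = e' \<and> f = f' \<and> g = g' \<and> h = h' \<and> i = i'"
  unfolding b9_def blk3_eq blk9_inject[OF assms] all_less_3 by auto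

lemma b9_carrier [simp]: "b9 m a b c d e f g h i \<in> carrier_mat (2 * m + 2) (2 * m + 2)"
  unfolding b9_def blk3_eq by (rule blk9_carrier)

lemma b9_index:
  "i < m \<Longrightarrow> j < m \<Longrightarrow> b9 m a b c d e f g h k $$ (i, j) = a $$ (i, j)"
  "i < m \<Longrightarrow> j < m \<Longrightarrow> b9 m a b c d e f g h k $$ (i, m + j) = b $$ (i, j)"
  "i < m \<Longrightarrow> j < 2 \<Longrightarrow> b9 m a b c d e f g h k $$ (i, 2 * m + j) = c $$ (i, j)"
  "i < m \<Longrightarrow> j < m \<Longrightarrow> b9 m a b c d e f g h k $$ (m + i, j) = d $$ (i, j)"
  "i < m \<Longrightarrow> j < m \<Longrightarrow> b9 m a b c d e f g h k $$ (m + i, m + j) = e $$ (i, j)"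
  "i < m \<Longrightarrow> j < 2 \<Longrightarrow> b9 m a b c d e f g h k $$ (m + i, 2 * m + j) = f $$ (i, j)"
  "i < 2 \<Longrightarrow> j < m \<Longrightarrow> b9 m a b c d e f g h k $$ (2 * m + i, j) = g $$ (i, j)"
  "i < 2 \<Longrightarrow> j < m \<Longrightarrow> b9 m a b c d e f g h k $$ (2 * m + i, m + j) = h $$ (i, j)"
  "i < 2 \<Longrightarrow> j < 2 \<Longrightarrow> b9 m a b c d e f g h k $$ (2 * m + i, 2 * m + j) = k $$ (i, j)"
  by (simp_all add: b9_def blk3_def bidx_def bofs_def)

lemma b9_cases:
  assumes w: "w \<in> carrier_mat (2 * m + 2) (2 * m + 2)"
  obtains a b c d e f g h i where "bcar m (\<lambda>p q. [[a, b, c], [d, e, f], [g, h, i]] ! p ! q)"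
    "w = b9 m a b c d e f g h i"
proof -
  define F where "F p q = mat (bsz m p) (bsz m q) (\<lambda>(i, j). w $$ (bpos m p i, bpos m q j))" for p q
  have eq: "w = blk9 m F"
    by (rule eq_matI) (use w in \<open>auto simp: blk9_def F_def bofs_less bpos_bofs\<close>)
  have "blk9 m F = b9 m (F 0 0) (F 0 1) (F 0 2) (F 1 0) (F 1 1) (F 1 2) (F 2 0) (F 2 1) (F 2 2)"
    unfolding b9_def blk3_eq
    by (rule blk9_cong) (auto simp: numeral_3_eq_3 less_Suc_eq numeral_2_eq_2)
  moreover have "bcar m (\<lambda>p q. [[F 0 0, F 0 1, F 0 2], [F 1 0, F 1 1, F 1 2], [F 2 0, F 2 1, F 2 2]] ! p ! q)"
    unfolding bcar_list_iff by (simp add: F_def bsz_def)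
  ultimately show ?thesis using that eq by metis
qed

subsection \<open>The parabolic subgroup\<close>

text \<open>Premises on dimensions rather than carrier sets let these act as conditional rewrite
  rules inside the nine-block products.\<close>

lemma zero_mult_dim: "dim_row A = k \<Longrightarrow> 0\<^sub>m r k * A = 0\<^sub>m r (dim_col (A :: 'a::semiring_0 mat))"
  and mult_zero_dim: "dim_col A = k \<Longrightarrow> A * 0\<^sub>m k c = 0\<^sub>m (dim_row A) c"
  by (rule eq_matI; simp add: scalar_prod_def)+

lemma zero_add_dim: "dim_row A = r \<Longrightarrow> dim_col A = c \<Longrightarrow> 0\<^sub>m r c + A = (A :: 'a::monoid_add mat)"
  and add_zero_dim: "dim_row A = r \<Longrightarrow> dim_col A = c \<Longrightarrow> A + 0\<^sub>m r c = (A :: 'a::monoid_add mat)"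
  by (rule eq_matI; simp)+

lemma one_mult_dim: "dim_row A = k \<Longrightarrow> 1\<^sub>m k * A = (A :: 'a::semiring_1 mat)"
  and mult_one_dim: "dim_col A = k \<Longrightarrow> A * 1\<^sub>m k = (A :: 'a::semiring_1 mat)"
  by (metis carrier_matI left_mult_one_mat, metis carrier_matI right_mult_one_mat)

lemma neg_zero_mat: "- 0\<^sub>m r c = (0\<^sub>m r c :: 'a::group_add mat)"
  by (rule eq_matI) auto

lemmas dim_simps = neg_zero_mat zero_mult_dim mult_zero_dim zero_add_dim add_zero_dim one_mult_dim mult_one_dim

lemma delta_eps_dim [simp]: "dim_row (delta_eps \<epsilon>) = 2" "dim_col (delta_eps \<epsilon>) = 2"
  by (simp_all add: delta_eps_def)

text \<open>The zero pattern of the parabolic subgroup: these matrices preserve the isotropic span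
  of the first m basis vectors and its orthogonal complement, spanned by the first m and the last
  two.\<close>

abbreviation upper9 :: "nat \<Rightarrow> 'a::zero mat \<Rightarrow> 'a mat \<Rightarrow> 'a mat \<Rightarrow> 'a mat \<Rightarrow> 'a mat \<Rightarrow> 'a mat \<Rightarrow> 'a mat" where
  "upper9 m A X Y D Z i \<equiv> b9 m A X Y (0\<^sub>m m m) D (0\<^sub>m m 2) (0\<^sub>m 2 m) Z i"

definition ucar :: "nat \<Rightarrow> 'a mat \<Rightarrow> 'a mat \<Rightarrow> 'a mat \<Rightarrow> 'a mat \<Rightarrow> 'a mat \<Rightarrow> 'a mat \<Rightarrow> bool" where
  "ucar m A X Y D Z i \<longleftrightarrow> A \<in> carrier_mat m m \<and> X \<in> carrier_mat m m \<and> Y \<in> carrier_mat m 2 \<and>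
     D \<in> carrier_mat m m \<and> Z \<in> carrier_mat 2 m \<and> i \<in> carrier_mat 2 2"

lemma ucarD:
  assumes "ucar m A X Y D Z i"
  shows "dim_row A = m" "dim_col A = m" "dim_row X = m" "dim_col X = m" "dim_row Y = m" "dim_col Y = 2"
    "dim_row D = m" "dim_col D = m" "dim_row Z = 2" "dim_col Z = m" "dim_row i = 2" "dim_col i = 2"
  using assms by (auto simp: ucar_def)

lemma Jmat_eq: "Jmat (Suc m) \<epsilon> = b9 m (0\<^sub>m m m) (1\<^sub>m m) (0\<^sub>m m 2) (1\<^sub>m m) (0\<^sub>m m m) (0\<^sub>m m 2) (0\<^sub>m 2 m) (0\<^sub>m 2 m) (delta_eps \<epsilon>)"
  by (simp add: Jmat_def b9_def)

lemma Jmat_carrier [simp]: "Jmat (Suc m) \<epsilon> \<in> carrier_mat (2 * m + 2) (2 * m + 2)"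
  unfolding Jmat_eq by (rule b9_carrier)

lemma upper9_mult:
  assumes "ucar m A X Y D Z i" "ucar m A' X' Y' D' Z' (i' :: 'a::comm_ring_1 mat)"
  shows "upper9 m A X Y D Z i * upper9 m A' X' Y' D' Z' i' =
    upper9 m (A * A') (A * X' + (X * D' + Y * Z')) (A * Y' + Y * i') (D * D') (Z * D' + i * Z') (i * i')"
proof -
  have c: "dim_row A = m" "dim_col A = m" "dim_row X = m" "dim_col X = m" "dim_row Y = m" "dim_col Y = 2"
    "dim_row D = m" "dim_col D = m" "dim_row Z = 2" "dim_col Z = m" "dim_row i = 2" "dim_col i = 2"
    "dim_row A' = m" "dim_col A' = m" "dim_row X' = m" "dim_col X' = m" "dim_row Y' = m" "dim_col Y' = 2"
    "dim_row D' = m" "dim_col D' = m" "dim_row Z' = 2" "dim_col Z' = m" "dim_row i' = 2" "dim_col i' = 2"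
    using assms by (auto simp: ucar_def)
  have "bcar m (\<lambda>p q. [[A, X, Y], [0\<^sub>m m m, D, 0\<^sub>m m 2], [0\<^sub>m 2 m, Z, i]] ! p ! q)"
    "bcar m (\<lambda>p q. [[A', X', Y'], [0\<^sub>m m m, D', 0\<^sub>m m 2], [0\<^sub>m 2 m, Z', i']] ! p ! q)"
    using assms by (simp_all add: bcar_list_iff ucar_def)
  from b9_mult[OF this] show ?thesis by (simp add: dim_simps c)
qed

lemma upper9_gram:
  assumes "ucar m A X Y D Z (i :: 'a::field mat)"
  defines "w \<equiv> upper9 m A X Y D Z i"
  shows "transpose_mat w * (Jmat (Suc m) \<epsilon> * w) =
    b9 m (0\<^sub>m m m) (transpose_mat A * D) (0\<^sub>m m 2)
     (transpose_mat D * A) (transpose_mat X * D + (transpose_mat D * X + transpose_mat Z * (delta_eps \<epsilon> * Z)))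
       (transpose_mat D * Y + transpose_mat Z * (delta_eps \<epsilon> * i))
     (0\<^sub>m 2 m) (transpose_mat Y * D + transpose_mat i * (delta_eps \<epsilon> * Z)) (transpose_mat i * (delta_eps \<epsilon> * i))"
proof -
  have c: "dim_row A = m" "dim_col A = m" "dim_row X = m" "dim_col X = m" "dim_row Y = m" "dim_col Y = 2"
    "dim_row D = m" "dim_col D = m" "dim_row Z = 2" "dim_col Z = m" "dim_row i = 2" "dim_col i = 2"
    using assms(1) by (auto simp: ucar_def)
  have bc: "bcar m (\<lambda>p q. [[A, X, Y], [0\<^sub>m m m, D, 0\<^sub>m m 2], [0\<^sub>m 2 m, Z, i]] ! p ! q)"
    using assms(1) by (simp add: bcar_list_iff ucar_def)
  have bJ: "bcar m (\<lambda>p q. [[0\<^sub>m m m, 1\<^sub>m m, 0\<^sub>m m 2], [1\<^sub>m m, 0\<^sub>m m m, 0\<^sub>m m 2], [0\<^sub>m 2 m, 0\<^sub>m 2 m, delta_eps \<epsilon>]] ! p ! q)"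
    by (simp add: bcar_list_iff)
  have t: "transpose_mat w = b9 m (transpose_mat A) (0\<^sub>m m m) (0\<^sub>m m 2) (transpose_mat X) (transpose_mat D) (transpose_mat Z)
     (transpose_mat Y) (0\<^sub>m 2 m) (transpose_mat i)"
    unfolding w_def b9_transpose[OF bc] by (simp only: zero_transpose_mat)
  have J: "Jmat (Suc m) \<epsilon> * w = b9 m (0\<^sub>m m m) D (0\<^sub>m m 2) A X Y (0\<^sub>m 2 m) (delta_eps \<epsilon> * Z) (delta_eps \<epsilon> * i)"
    unfolding w_def Jmat_eq b9_mult[OF bJ bc] by (simp add: dim_simps c)
  have bt: "bcar m (\<lambda>p q. [[transpose_mat A, 0\<^sub>m m m, 0\<^sub>m m 2], [transpose_mat X, transpose_mat D, transpose_mat Z],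
     [transpose_mat Y, 0\<^sub>m 2 m, transpose_mat i]] ! p ! q)"
    using assms(1) by (simp add: bcar_list_iff ucar_def)
  have bJw: "bcar m (\<lambda>p q. [[0\<^sub>m m m, D, 0\<^sub>m m 2], [A, X, Y], [0\<^sub>m 2 m, delta_eps \<epsilon> * Z, delta_eps \<epsilon> * i]] ! p ! q)"
  proof -
    have "delta_eps \<epsilon> * Z \<in> carrier_mat 2 m" "delta_eps \<epsilon> * i \<in> carrier_mat 2 2"
      by (rule carrier_matI; simp only: index_mult_mat delta_eps_dim c)+
    then show ?thesis using assms(1) by (simp add: bcar_list_iff ucar_def)
  qed
  show ?thesis unfolding t J b9_mult[OF bt bJw] by (simp add: dim_simps c)
qed

lemma upper9_gram_eq_iff:
  assumes "ucar m A X Y D Z (i :: 'a::field mat)"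
  defines "w \<equiv> upper9 m A X Y D Z i"
  shows "transpose_mat w * (Jmat (Suc m) \<epsilon> * w) = Jmat (Suc m) \<epsilon> \<longleftrightarrow>
    transpose_mat A * D = 1\<^sub>m m \<and> transpose_mat D * A = 1\<^sub>m m \<and>
    transpose_mat X * D + (transpose_mat D * X + transpose_mat Z * (delta_eps \<epsilon> * Z)) = 0\<^sub>m m m \<and>
    transpose_mat D * Y + transpose_mat Z * (delta_eps \<epsilon> * i) = 0\<^sub>m m 2 \<and>
    transpose_mat Y * D + transpose_mat i * (delta_eps \<epsilon> * Z) = 0\<^sub>m 2 m \<and>
    transpose_mat i * (delta_eps \<epsilon> * i) = delta_eps \<epsilon>"
proof -
  have c: "dim_row A = m" "dim_col A = m" "dim_row X = m" "dim_col X = m" "dim_row Y = m" "dim_col Y = 2"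
    "dim_row D = m" "dim_col D = m" "dim_row Z = 2" "dim_col Z = m" "dim_row i = 2" "dim_col i = 2"
    using assms(1) by (auto simp: ucar_def)
  show ?thesis
    unfolding w_def upper9_gram[OF assms(1)] unfolding Jmat_eq
    by (subst b9_inject; (unfold bcar_list_iff)?; (intro conjI carrier_matI; simp add: c)?) auto
qed

text \<open>The Levi factor times the unipotent factor of \<open>Qgrp\<close>, multiplied
  out.\<close>

definition qel :: "nat \<Rightarrow> 'a::field \<Rightarrow> 'a mat \<Rightarrow> 'a mat \<Rightarrow> 'a mat \<Rightarrow> 'a mat \<Rightarrow> 'a mat" where
  "qel m \<epsilon> A i h B = upper9 m A (A * B) (A * (- (transpose_mat h * delta_eps \<epsilon>))) (transpose_mat (minv A)) (i * h) i"

lemma SOminus2D: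
  assumes "i \<in> SOminus2 \<epsilon>"
  shows "i \<in> GL 2" "transpose_mat i * delta_eps \<epsilon> * i = delta_eps \<epsilon>" "det i = 1"
    "i \<in> carrier_mat 2 2" "transpose_mat i * (delta_eps \<epsilon> * i) = delta_eps \<epsilon>"
proof -
  show *: "i \<in> GL 2" "transpose_mat i * delta_eps \<epsilon> * i = delta_eps \<epsilon>" "det i = 1" "i \<in> carrier_mat 2 2"
    using assms by (auto simp: SOminus2_def GL_def)
  show "transpose_mat i * (delta_eps \<epsilon> * i) = delta_eps \<epsilon>"
    using *(2,4) assoc_mult_mat[of "transpose_mat i" 2 2 "delta_eps \<epsilon>" 2 i 2] by simp
qed

lemma Qgrp_eq:
  "Qgrp (Suc m) \<epsilon> = {qel m \<epsilon> A i h B | A i h B. A \<in> GL m \<and> i \<in> SOminus2 \<epsilon> \<and> h \<in> carrier_mat 2 m \<and>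
     B \<in> carrier_mat m m \<and> transpose_mat B + B + gram \<epsilon> h = 0\<^sub>m m m}" (is "?L = ?R")
proof -
  have prod: "b9 m A (0\<^sub>m m m) (0\<^sub>m m 2) (0\<^sub>m m m) (transpose_mat (minv A)) (0\<^sub>m m 2) (0\<^sub>m 2 m) (0\<^sub>m 2 m) i
      * b9 m (1\<^sub>m m) B (- (transpose_mat h * delta_eps \<epsilon>)) (0\<^sub>m m m) (1\<^sub>m m) (0\<^sub>m m 2) (0\<^sub>m 2 m) h (1\<^sub>m 2) = qel m \<epsilon> A i h B"
    if "A \<in> GL m" "i \<in> SOminus2 \<epsilon>" "B \<in> carrier_mat m m" "h \<in> carrier_mat 2 m" for A i h B
  proof -
    have "dim_row A = m" "dim_col A = m" "dim_row i = 2" "dim_col i = 2" "dim_row B = m" "dim_col B = m"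
      "dim_row h = 2" "dim_col h = m" "dim_row (minv A) = m" "dim_col (minv A) = m"
      using that GL_carrier[OF that(1)] minv(1)[OF that(1)] SOminus2D(4)[OF that(2)] by auto
    note c = this
    have "bcar m (\<lambda>p q. [[A, 0\<^sub>m m m, 0\<^sub>m m 2], [0\<^sub>m m m, transpose_mat (minv A), 0\<^sub>m m 2], [0\<^sub>m 2 m, 0\<^sub>m 2 m, i]] ! p ! q)"
      "bcar m (\<lambda>p q. [[1\<^sub>m m, B, - (transpose_mat h * delta_eps \<epsilon>)], [0\<^sub>m m m, 1\<^sub>m m, 0\<^sub>m m 2], [0\<^sub>m 2 m, h, 1\<^sub>m 2]] ! p ! q)"
      unfolding bcar_list_iff by (intro conjI carrier_matI; simp add: c)+
    from b9_mult[OF this] show ?thesis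
      unfolding qel_def by (simp add: dim_simps c)
  qed
  show ?thesis
  proof (intro equalityI subsetI)
    fix w assume "w \<in> ?L"
    then obtain A A' i B h where w: "w = b9 m A (0\<^sub>m m m) (0\<^sub>m m 2) (0\<^sub>m m m) (transpose_mat A') (0\<^sub>m m 2) (0\<^sub>m 2 m) (0\<^sub>m 2 m) i
      * b9 m (1\<^sub>m m) B (- (transpose_mat h * delta_eps \<epsilon>)) (0\<^sub>m m m) (1\<^sub>m m) (0\<^sub>m m 2) (0\<^sub>m 2 m) h (1\<^sub>m 2)"
      and *: "A \<in> GL m" "A' \<in> carrier_mat m m" "A * A' = 1\<^sub>m m" "i \<in> SOminus2 \<epsilon>" "B \<in> carrier_mat m m" "h \<in> carrier_mat 2 m"
        "transpose_mat B + B + transpose_mat h * delta_eps \<epsilon> * h = 0\<^sub>m m m"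
      unfolding Qgrp_def b9_def diff_Suc_1 by blast
    have "A' = minv A" by (rule minv_unique[OF GL_carrier[OF *(1)] *(2,3)])
    then show "w \<in> ?R" using w prod[OF *(1,4,5,6)] * unfolding gram_def by auto
  next
    fix w assume "w \<in> ?R"
    then obtain A i h B where w: "w = qel m \<epsilon> A i h B" and *: "A \<in> GL m" "i \<in> SOminus2 \<epsilon>" "h \<in> carrier_mat 2 m"
      "B \<in> carrier_mat m m" "transpose_mat B + B + gram \<epsilon> h = 0\<^sub>m m m" by auto
    show "w \<in> ?L"
      unfolding w prod[OF *(1,2,4,3), symmetric] Qgrp_def b9_def diff_Suc_1
      using * minv(1,2)[OF *(1)] unfolding gram_def by blast
  qed
qed

lemma qel_ucar:
  assumes "A \<in> GL m" "i \<in> SOminus2 \<epsilon>" "h \<in> carrier_mat 2 m" "B \<in> carrier_mat m m"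
  shows "ucar m A (A * B) (A * (- (transpose_mat h * delta_eps \<epsilon>))) (transpose_mat (minv A)) (i * h) i"
  unfolding ucar_def using assms GL_carrier[OF assms(1)] minv(1)[OF assms(1)] SOminus2D(4)[OF assms(2)]
  by (intro conjI carrier_matI; simp)

text \<open>An intrinsic description of Q: isometries with the block zero pattern and with
  determinant 1 in the last block. In this form closure under products and under conjugation by
  \<rho> is immediate, and for conjugates by \<sigma> only the zero pattern and the last block need
  inspection.\<close>

lemma Qgrp_iff:
  "w \<in> Qgrp (Suc m) \<epsilon> \<longleftrightarrow> (\<exists>A X Y D Z i. ucar m A X Y D Z i \<and> w = upper9 m A X Y D Z i \<and>
     transpose_mat w * (Jmat (Suc m) \<epsilon> * w) = Jmat (Suc m) \<epsilon> \<and> det i = 1)" (is "_ \<longleftrightarrow> ?R")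
proof
  let ?d = "delta_eps \<epsilon>"
  assume "w \<in> Qgrp (Suc m) \<epsilon>"
  then obtain A i h B where w: "w = qel m \<epsilon> A i h B" and A: "A \<in> GL m" and i: "i \<in> SOminus2 \<epsilon>"
    and h: "h \<in> carrier_mat 2 m" and B: "B \<in> carrier_mat m m" and eq: "transpose_mat B + B + gram \<epsilon> h = 0\<^sub>m m m"
    unfolding Qgrp_eq by auto
  note uc = qel_ucar[OF A i h B]
  note Ac = GL_carrier[OF A] and iA = minv[OF A] and ii = SOminus2D[OF i]
  let ?Y = "- (transpose_mat h * ?d)"
  have Yc: "?Y \<in> carrier_mat m 2" and hd: "transpose_mat h * ?d \<in> carrier_mat m 2" using h by auto
  have a1: "transpose_mat A * transpose_mat (minv A) = 1\<^sub>m m"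
    using transpose_mult[OF iA(1) Ac] iA(3) by simp
  have b1: "minv A * (A * B) = B" by (rule minv_mult_cancel(1)[OF A B])
  have b2: "transpose_mat (A * B) * transpose_mat (minv A) = transpose_mat B"
    using transpose_mult[OF iA(1), of "A * B" m] Ac B b1 by simp
  have z1: "transpose_mat (i * h) * (?d * i) = transpose_mat h * ?d"
  proof -
    have "transpose_mat (i * h) * (?d * i) = transpose_mat h * transpose_mat i * (?d * i)"
      using ii(4) h by (simp add: transpose_mult[of _ 2 2 _ m])
    also have "\<dots> = transpose_mat h * (transpose_mat i * (?d * i))"
      using ii(4) h by (intro assoc_mult_mat[of _ m 2 _ 2 _ 2]) auto
    finally show ?thesis using ii(5) by simp
  qed
  have z2: "transpose_mat (i * h) * (?d * (i * h)) = gram \<epsilon> h"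
  proof -
    have "transpose_mat (i * h) * (?d * (i * h)) = transpose_mat (i * h) * (?d * i * h)"
      using ii(4) h by (simp add: assoc_mult_mat[of _ 2 2 _ 2 _ m])
    also have "\<dots> = transpose_mat (i * h) * (?d * i) * h"
      using ii(4) h by (intro assoc_mult_mat[symmetric, of _ m 2 _ 2 _ m]) auto
    finally show ?thesis unfolding z1 gram_def .
  qed
  have y1: "minv A * (A * ?Y) = ?Y" by (rule minv_mult_cancel(1)[OF A Yc])
  have e4: "minv A * (A * ?Y) + transpose_mat (i * h) * (?d * i) = 0\<^sub>m m 2"
    unfolding y1 z1 using hd by (intro eq_matI) auto
  \<comment> \<open>The fifth block equation is the transpose of the fourth.\<close>
  have "transpose_mat (minv A * (A * ?Y) + transpose_mat (i * h) * (?d * i)) =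
      transpose_mat (A * ?Y) * transpose_mat (minv A) + transpose_mat i * (?d * (i * h))"
  proof -
    have "transpose_mat (minv A * (A * ?Y)) = transpose_mat (A * ?Y) * transpose_mat (minv A)"
      by (rule transpose_mult[OF iA(1) mult_carrier_mat[OF Ac Yc]])
    moreover have "transpose_mat (transpose_mat (i * h) * (?d * i)) = transpose_mat i * (?d * (i * h))"
    proof -
      have "transpose_mat (transpose_mat (i * h) * (?d * i)) = transpose_mat (?d * i) * (i * h)"
        using ii(4) h by (subst transpose_mult[of _ m 2 _ 2]) auto
      also have "transpose_mat (?d * i) = transpose_mat i * ?d"
        using ii(4) by (subst transpose_mult[of _ 2 2 _ 2]) (auto simp: transpose_delta_eps)
      also have "transpose_mat i * ?d * (i * h) = transpose_mat i * (?d * (i * h))"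
        using ii(4) h by (intro assoc_mult_mat[of _ 2 2 _ 2 _ m]) auto
      finally show ?thesis .
    qed
    moreover have "minv A * (A * ?Y) \<in> carrier_mat m 2" "transpose_mat (i * h) * (?d * i) \<in> carrier_mat m 2"
      unfolding y1 z1 using Yc hd by auto
    ultimately show ?thesis by (simp only: transpose_add)
  qed
  then have e5: "transpose_mat (A * ?Y) * transpose_mat (minv A) + transpose_mat i * (?d * (i * h)) = 0\<^sub>m 2 m"
    unfolding e4 by simp
  have e3: "transpose_mat B + (B + gram \<epsilon> h) = 0\<^sub>m m m"
    using eq B gram_carrier[OF h, of \<epsilon>] by (simp add: assoc_add_mat[of _ m m])
  have "transpose_mat w * (Jmat (Suc m) \<epsilon> * w) = Jmat (Suc m) \<epsilon>"
    unfolding w qel_def upper9_gram_eq_iff[OF uc] transpose_transpose a1 b1 b2 z2 e3 e4 e5 iA(3) ii(5) by simp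
  then show ?R using uc w ii(3) unfolding qel_def by blast
next
  let ?d = "delta_eps \<epsilon>"
  assume ?R
  then obtain A X Y D Z i where uc: "ucar m A X Y D Z i" and w: "w = upper9 m A X Y D Z i"
    and J: "transpose_mat w * (Jmat (Suc m) \<epsilon> * w) = Jmat (Suc m) \<epsilon>" and det: "det i = 1" by blast
  have c: "A \<in> carrier_mat m m" "X \<in> carrier_mat m m" "Y \<in> carrier_mat m 2" "D \<in> carrier_mat m m"
    "Z \<in> carrier_mat 2 m" "i \<in> carrier_mat 2 2" using uc by (auto simp: ucar_def)
  from J[unfolded w upper9_gram_eq_iff[OF uc]] have e: "transpose_mat D * A = 1\<^sub>m m"
    "transpose_mat X * D + (transpose_mat D * X + transpose_mat Z * (?d * Z)) = 0\<^sub>m m m"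
    "transpose_mat D * Y + transpose_mat Z * (?d * i) = 0\<^sub>m m 2"
    "transpose_mat i * (?d * i) = ?d" by auto
  have tD: "transpose_mat D \<in> carrier_mat m m" using c by simp
  have A: "A \<in> GL m" using GL_I(2)[OF tD c(1) e(1)] .
  have "transpose_mat D = transpose_mat D * A * minv A"
    using mult_minv_cancel(1)[OF A tD] by simp
  then have D: "transpose_mat D = minv A" using e(1) minv(1)[OF A] by simp
  then have D': "D = transpose_mat (minv A)" by (metis transpose_transpose)
  have i: "i \<in> SOminus2 \<epsilon>"
    using e(4) det c by (simp add: SOminus2_def GL_def assoc_mult_mat[of _ 2 2 _ 2 _ 2])
  note ii = SOminus2D[OF i]
  \<comment> \<open>The parameters are recovered by dividing i out of Z and A out of X; the block
    equations then force D and Y to have the required form.\<close>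
  define h where "h = minv i * Z"
  define B where "B = minv A * X"
  have h: "h \<in> carrier_mat 2 m" using minv(1)[OF ii(1)] c by (simp add: h_def)
  have B: "B \<in> carrier_mat m m" using minv(1)[OF A] c by (simp add: B_def)
  have Z: "i * h = Z" unfolding h_def by (rule minv_mult_cancel(2)[OF ii(1) c(5)])
  have X: "A * B = X" unfolding B_def by (rule minv_mult_cancel(2)[OF A c(2)])
  have z1: "transpose_mat Z * (?d * i) = transpose_mat h * ?d"
  proof -
    have "transpose_mat (i * h) * (?d * i) = transpose_mat h * transpose_mat i * (?d * i)"
      using ii(4) h by (simp add: transpose_mult[of _ 2 2 _ m])
    also have "\<dots> = transpose_mat h * (transpose_mat i * (?d * i))"
      using ii(4) h by (intro assoc_mult_mat[of _ m 2 _ 2 _ 2]) auto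
    finally show ?thesis using ii(5) Z by simp
  qed
  have z2: "transpose_mat Z * (?d * Z) = gram \<epsilon> h"
  proof -
    have "transpose_mat Z * (?d * (i * h)) = transpose_mat Z * (?d * i * h)"
      using ii(4) h by (simp add: assoc_mult_mat[of _ 2 2 _ 2 _ m])
    also have "\<dots> = transpose_mat Z * (?d * i) * h"
      using ii(4) h c by (intro assoc_mult_mat[symmetric, of _ m 2 _ 2 _ m]) auto
    finally show ?thesis unfolding z1 gram_def Z .
  qed
  have hd: "transpose_mat h * ?d \<in> carrier_mat m 2" using h by auto
  have DY: "minv A * Y = - (transpose_mat h * ?d)"
  proof (rule eq_matI)
    fix k l assume "k < dim_row (- (transpose_mat h * ?d))" "l < dim_col (- (transpose_mat h * ?d))"
    then have kl: "k < m" "l < 2" using hd by auto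
    have "(minv A * Y) $$ (k, l) + (transpose_mat h * ?d) $$ (k, l) = (minv A * Y + transpose_mat h * ?d) $$ (k, l)"
      using hd kl by (intro index_add_mat(1)[symmetric]) auto
    also have "\<dots> = 0" unfolding e(3)[unfolded D z1] using kl by simp
    finally have "(minv A * Y) $$ (k, l) = - (transpose_mat h * ?d) $$ (k, l)"
      by (simp only: eq_neg_iff_add_eq_0)
    also have "\<dots> = (- (transpose_mat h * ?d)) $$ (k, l)"
      using hd kl by (intro index_uminus_mat(1)[symmetric]) auto
    finally show "(minv A * Y) $$ (k, l) = (- (transpose_mat h * ?d)) $$ (k, l)" .
  qed (use hd minv(1)[OF A] c in auto)
  have Y: "A * (- (transpose_mat h * ?d)) = Y"
    using minv_mult_cancel(2)[OF A c(3)] unfolding DY .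
  have "transpose_mat X * D = transpose_mat B"
    unfolding B_def D' using transpose_mult[OF minv(1)[OF A] c(2)] ..
  then have "transpose_mat B + (B + gram \<epsilon> h) = 0\<^sub>m m m"
    using e(2) unfolding z2 D B_def[symmetric] by simp
  then have "transpose_mat B + B + gram \<epsilon> h = 0\<^sub>m m m"
    using B gram_carrier[OF h, of \<epsilon>] by (simp add: assoc_add_mat[of _ m m])
  moreover have "w = qel m \<epsilon> A i h B" unfolding w qel_def X Y Z D' ..
  ultimately show "w \<in> Qgrp (Suc m) \<epsilon>" unfolding Qgrp_eq using A i h B by blast
qed

section \<open>Isometries of the form, and the matrices \<rho> and \<sigma>\<close>

definition isom :: "nat \<Rightarrow> 'a::field mat \<Rightarrow> 'a mat set" where
  "isom N J = {w \<in> carrier_mat N N. transpose_mat w * (J * w) = J}"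

lemma isom_mult:
  assumes J: "J \<in> carrier_mat N N" and w: "v \<in> isom N J" "w \<in> isom N J"
  shows "v * w \<in> isom N J"
proof -
  have c: "v \<in> carrier_mat N N" "w \<in> carrier_mat N N" using w by (auto simp: isom_def)
  have "transpose_mat (v * w) * (J * (v * w)) = transpose_mat w * ((transpose_mat v * (J * v)) * w)"
    using c J by (simp add: transpose_mult[of _ N N _ N] assoc_mult_mat[of _ N N _ N _ N])
  then show ?thesis using w c by (simp add: isom_def)
qed

lemma Qgrp_carrier: "w \<in> Qgrp (Suc m) \<epsilon> \<Longrightarrow> w \<in> carrier_mat (2 * m + 2) (2 * m + 2)"
  unfolding Qgrp_iff by (metis b9_carrier)

lemma Qgrp_isom: "w \<in> Qgrp (Suc m) \<epsilon> \<Longrightarrow> w \<in> isom (2 * m + 2) (Jmat (Suc m) \<epsilon>)"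
  unfolding isom_def using Qgrp_carrier Qgrp_iff by blast

lemma Qgrp_mult:
  assumes "v \<in> Qgrp (Suc m) \<epsilon>" "w \<in> Qgrp (Suc m) (\<epsilon> :: 'a::field)"
  shows "v * w \<in> Qgrp (Suc m) \<epsilon>"
proof -
  obtain A X Y D Z i where v: "ucar m A X Y D Z i" "v = upper9 m A X Y D Z i" "det i = 1"
    using assms(1) unfolding Qgrp_iff by blast
  obtain A' X' Y' D' Z' i' where w: "ucar m A' X' Y' D' Z' i'" "w = upper9 m A' X' Y' D' Z' i'" "det i' = 1"
    using assms(2) unfolding Qgrp_iff by blast
  have vw: "v * w = upper9 m (A * A') (A * X' + (X * D' + Y * Z')) (A * Y' + Y * i') (D * D') (Z * D' + i * Z') (i * i')"
    unfolding v(2) w(2) by (rule upper9_mult[OF v(1) w(1)])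
  have uc: "ucar m (A * A') (A * X' + (X * D' + Y * Z')) (A * Y' + Y * i') (D * D') (Z * D' + i * Z') (i * i')"
    unfolding ucar_def by (intro conjI carrier_matI; simp add: ucarD[OF v(1)] ucarD[OF w(1)])
  have "v * w \<in> isom (2 * m + 2) (Jmat (Suc m) \<epsilon>)"
    by (intro isom_mult Jmat_carrier Qgrp_isom assms)
  moreover have "det (i * i') = 1" using v w by (simp add: det_mult[of _ 2] ucar_def)
  ultimately show ?thesis unfolding Qgrp_iff isom_def using uc vw by blast
qed

lemma one_Qgrp: "1\<^sub>m (2 * m + 2) \<in> Qgrp (Suc m) (\<epsilon> :: 'a::field)"
proof -
  have 1: "1\<^sub>m (2 * m + 2) = upper9 m (1\<^sub>m m) (0\<^sub>m m m) (0\<^sub>m m 2) (1\<^sub>m m) (0\<^sub>m 2 m) (1\<^sub>m 2 :: 'a mat)"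
  proof (rule eq_matI)
    fix i j assume "i < dim_row (upper9 m (1\<^sub>m m) (0\<^sub>m m m) (0\<^sub>m m 2) (1\<^sub>m m) (0\<^sub>m 2 m) (1\<^sub>m 2 :: 'a mat))"
      "j < dim_col (upper9 m (1\<^sub>m m) (0\<^sub>m m m) (0\<^sub>m m 2) (1\<^sub>m m) (0\<^sub>m 2 m) (1\<^sub>m 2 :: 'a mat))"
    then have "i < 2 * m + 2" "j < 2 * m + 2" by (auto simp: b9_def blk3_def)
    then show "1\<^sub>m (2 * m + 2) $$ (i, j) = upper9 m (1\<^sub>m m) (0\<^sub>m m m) (0\<^sub>m m 2) (1\<^sub>m m) (0\<^sub>m 2 m) (1\<^sub>m 2 :: 'a mat) $$ (i, j)"
      by (auto simp: b9_def blk3_def bidx_def bofs_def)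
  qed (auto simp: b9_def blk3_def)
  have "ucar m (1\<^sub>m m) (0\<^sub>m m m) (0\<^sub>m m 2) (1\<^sub>m m) (0\<^sub>m 2 m) (1\<^sub>m 2 :: 'a mat)" by (simp add: ucar_def)
  moreover have "transpose_mat (1\<^sub>m (2 * m + 2)) * (Jmat (Suc m) \<epsilon> * 1\<^sub>m (2 * m + 2)) = Jmat (Suc m) \<epsilon>"
    unfolding transpose_one right_mult_one_mat[OF Jmat_carrier] left_mult_one_mat[OF Jmat_carrier] ..
  moreover have "det (1\<^sub>m 2 :: 'a mat) = 1" by simp
  ultimately show ?thesis unfolding Qgrp_iff using 1 by blast
qed

text \<open>\<open>delta_eps 1\<close> is diag(1, -1), the last block of \<rho>.\<close>

lemma rho_mat_eq: "rho_mat (Suc m) = upper9 m (1\<^sub>m m) (0\<^sub>m m m) (0\<^sub>m m 2) (1\<^sub>m m) (0\<^sub>m 2 m) (delta_eps 1 :: 'a::field mat)"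
proof (rule eq_matI)
  let ?R = "upper9 m (1\<^sub>m m) (0\<^sub>m m m) (0\<^sub>m m 2) (1\<^sub>m m) (0\<^sub>m 2 m) (delta_eps 1 :: 'a::field mat)"
  fix i j assume "i < dim_row ?R" "j < dim_col ?R"
  then have "i < 2 * m + 2" "j < 2 * m + 2" by (auto simp: b9_def blk3_def)
  then show "rho_mat (Suc m) $$ (i, j) = ?R $$ (i, j)"
    by (auto simp: b9_def blk3_def bidx_def bofs_def rho_mat_def delta_eps_def)
qed (auto simp: b9_def blk3_def rho_mat_def)

lemma rho_ucar: "ucar m (1\<^sub>m m) (0\<^sub>m m m) (0\<^sub>m m 2) (1\<^sub>m m) (0\<^sub>m 2 m) (delta_eps 1 :: 'a::field mat)"
  by (simp add: ucar_def)

lemma rho_carrier [simp]: "rho_mat (Suc m) \<in> carrier_mat (2 * m + 2) (2 * m + 2)"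
  unfolding rho_mat_eq by (rule b9_carrier)

lemma delta_eps_1_square: "delta_eps 1 * delta_eps 1 = (1\<^sub>m 2 :: 'a::field mat)"
  by (rule eq_matI) (auto simp: delta_eps_def scalar_prod_def numeral_2_eq_2 less_Suc_eq)

lemma rho_square: "rho_mat (Suc m) * rho_mat (Suc m) = (1\<^sub>m (2 * m + 2) :: 'a::field mat)"
  by (rule eq_matI) (auto simp: rho_mat_def scalar_prod_def if_distrib[of "\<lambda>x. x * _"] cong: if_cong)

lemma rho_isom: "rho_mat (Suc m) \<in> isom (2 * m + 2) (Jmat (Suc m) (\<epsilon> :: 'a::field))"
proof -
  have "transpose_mat (delta_eps 1) * (delta_eps \<epsilon> * delta_eps 1) = delta_eps \<epsilon>"
    by (rule eq_matI) (auto simp: delta_eps_def scalar_prod_def numeral_2_eq_2 less_Suc_eq)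
  then have "transpose_mat (rho_mat (Suc m)) * (Jmat (Suc m) \<epsilon> * rho_mat (Suc m)) = Jmat (Suc m) \<epsilon>"
    unfolding rho_mat_eq upper9_gram_eq_iff[OF rho_ucar] by (simp add: dim_simps)
  then show ?thesis unfolding isom_def using rho_carrier by blast
qed

text \<open>\<rho> is an isometry with the block pattern of Q and fails to lie in Q only because its
  last block has determinant -1; conjugation uses this determinant twice.\<close>

lemma rho_conj_Qgrp:
  assumes "w \<in> Qgrp (Suc m) (\<epsilon> :: 'a::field)"
  shows "rho_mat (Suc m) * w * rho_mat (Suc m) \<in> Qgrp (Suc m) \<epsilon>"
proof -
  let ?r = "rho_mat (Suc m) :: 'a mat"
  obtain A X Y D Z i where w: "ucar m A X Y D Z i" "w = upper9 m A X Y D Z i" "det i = 1"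
    using assms unfolding Qgrp_iff by blast
  have ic: "i \<in> carrier_mat 2 2" using w by (simp add: ucar_def)
  define X1 Y1 D1 Z1 where "X1 = 1\<^sub>m m * X + (0\<^sub>m m m * D + 0\<^sub>m m 2 * Z)" "Y1 = 1\<^sub>m m * Y + 0\<^sub>m m 2 * i" "D1 = 1\<^sub>m m * D" "Z1 = 0\<^sub>m 2 m * D + delta_eps 1 * Z"
  have 1: "?r * w = upper9 m (1\<^sub>m m * A) X1 Y1 D1 Z1 (delta_eps 1 * i)"
    unfolding rho_mat_eq w(2) X1_Y1_D1_Z1_def by (rule upper9_mult[OF rho_ucar w(1)])
  have uc: "ucar m (1\<^sub>m m * A) X1 Y1 D1 Z1 (delta_eps 1 * i)"
    unfolding ucar_def X1_Y1_D1_Z1_def by (intro conjI carrier_matI; simp add: ucarD[OF w(1)])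
  have "\<exists>A' X' Y' D' Z'. ucar m A' X' Y' D' Z' (delta_eps 1 * i * delta_eps 1) \<and> ?r * w * ?r = upper9 m A' X' Y' D' Z' (delta_eps 1 * i * delta_eps 1)"
  proof -
    note 2 = upper9_mult[OF uc rho_ucar]
    have "ucar m (1\<^sub>m m * A * 1\<^sub>m m) (1\<^sub>m m * A * 0\<^sub>m m m + (X1 * 1\<^sub>m m + Y1 * 0\<^sub>m 2 m)) (1\<^sub>m m * A * 0\<^sub>m m 2 + Y1 * delta_eps 1)
        (D1 * 1\<^sub>m m) (Z1 * 1\<^sub>m m + delta_eps 1 * i * 0\<^sub>m 2 m) (delta_eps 1 * i * delta_eps 1)"
      unfolding ucar_def by (intro conjI carrier_matI; simp add: ucarD[OF uc] ucarD[OF w(1)])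
    then show ?thesis unfolding 1 using 2 unfolding rho_mat_eq by blast
  qed
  moreover have "det (delta_eps 1 * i * delta_eps 1) = 1"
  proof -
    have "det (delta_eps 1 :: 'a mat) * det (delta_eps 1 :: 'a mat) = 1"
      using det_mult[of "delta_eps 1 :: 'a mat" 2 "delta_eps 1"] by (simp add: delta_eps_1_square)
    moreover have "det (delta_eps 1 * i * delta_eps 1) = det (delta_eps 1 * i) * det (delta_eps 1)"
      by (rule det_mult[OF mult_carrier_mat[OF delta_eps_carrier ic] delta_eps_carrier])
    moreover have "det (delta_eps 1 * i) = det (delta_eps 1) * det i"
      by (rule det_mult[OF delta_eps_carrier ic])
    ultimately show ?thesis using w(3) by simp
  qed
  moreover have "?r * w * ?r \<in> isom (2 * m + 2) (Jmat (Suc m) \<epsilon>)"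
    by (intro isom_mult Jmat_carrier rho_isom Qgrp_isom assms)
  ultimately show ?thesis unfolding Qgrp_iff isom_def by blast
qed

lemma isom_GL:
  assumes "w \<in> isom N J" "J \<in> carrier_mat N N" "det J \<noteq> 0"
  shows "w \<in> GL N"
proof -
  have w: "w \<in> carrier_mat N N" "transpose_mat w * (J * w) = J" using assms by (auto simp: isom_def)
  then have "det J = det w * (det J * det w)"
    using assms(2) by (metis det_mult det_transpose mult_carrier_mat transpose_carrier_mat)
  then show ?thesis using w assms(3) by (auto simp: GL_def)
qed

lemma sw_props:
  assumes "r \<le> m" "i < 2 * m + 2"
  shows "sw (Suc m) r i < 2 * m + 2" "sw (Suc m) r (sw (Suc m) r i) = i"
  using assms by (auto simp: sw_def)

lemma sigma_carrier [simp]: "sigma_mat (Suc m) r \<in> carrier_mat (2 * m + 2) (2 * m + 2)"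
  by (simp add: sigma_mat_def)

lemma sigma_mult:
  assumes "r \<le> m" "w \<in> carrier_mat (2 * m + 2) (2 * m + 2)" "i < 2 * m + 2" "j < 2 * m + 2"
  shows "(sigma_mat (Suc m) r * w) $$ (i, j) = (w $$ (sw (Suc m) r i, j) :: 'a::field)"
    and "(w * sigma_mat (Suc m) r) $$ (i, j) = w $$ (i, sw (Suc m) r j)"
proof -
  let ?s = "sw (Suc m) r"
  have "(sigma_mat (Suc m) r * w) $$ (i, j) = (\<Sum>k = 0..<2 * m + 2. (if k = ?s i then 1 else 0) * w $$ (k, j))"
    using assms by (simp add: sigma_mat_def scalar_prod_def)
  also have "\<dots> = (\<Sum>k = 0..<2 * m + 2. if k = ?s i then w $$ (k, j) else 0)"
    by (intro sum.cong refl) simp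
  also have "\<dots> = w $$ (?s i, j)" using sw_props(1)[OF assms(1,3)] by simp
  finally show "(sigma_mat (Suc m) r * w) $$ (i, j) = w $$ (?s i, j)" .
  have "(w * sigma_mat (Suc m) r) $$ (i, j) = (\<Sum>k = 0..<2 * m + 2. w $$ (i, k) * (if j = ?s k then 1 else 0))"
    using assms by (simp add: sigma_mat_def scalar_prod_def)
  also have "\<dots> = (\<Sum>k = 0..<2 * m + 2. if k = ?s j then w $$ (i, k) else 0)"
    by (intro sum.cong refl) (use sw_props(2)[OF assms(1)] assms(4) in auto)
  also have "\<dots> = w $$ (i, ?s j)" using sw_props(1)[OF assms(1,4)] by simp
  finally show "(w * sigma_mat (Suc m) r) $$ (i, j) = w $$ (i, ?s j)" .
qed

lemma sigma_square:
  assumes "r \<le> m"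
  shows "sigma_mat (Suc m) r * sigma_mat (Suc m) r = (1\<^sub>m (2 * m + 2) :: 'a::field mat)"
proof (rule eq_matI)
  fix i j assume "i < dim_row (1\<^sub>m (2 * m + 2) :: 'a mat)" "j < dim_col (1\<^sub>m (2 * m + 2) :: 'a mat)"
  then have ij: "i < 2 * m + 2" "j < 2 * m + 2" by auto
  show "(sigma_mat (Suc m) r * sigma_mat (Suc m) r) $$ (i, j) = (1\<^sub>m (2 * m + 2) :: 'a mat) $$ (i, j)"
    unfolding sigma_mult(1)[OF assms sigma_carrier ij]
    using sw_props[OF assms ij(1)] ij by (simp add: sigma_mat_def eq_commute)
qed (auto simp: sigma_mat_def)

lemma sigma_transpose:
  assumes "r \<le> m"
  shows "transpose_mat (sigma_mat (Suc m) r) = (sigma_mat (Suc m) r :: 'a::field mat)"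
proof (rule eq_matI)
  fix i j assume "i < dim_row (sigma_mat (Suc m) r :: 'a mat)" "j < dim_col (sigma_mat (Suc m) r :: 'a mat)"
  then have ij: "i < 2 * m + 2" "j < 2 * m + 2" by (auto simp: sigma_mat_def)
  then show "transpose_mat (sigma_mat (Suc m) r) $$ (i, j) = (sigma_mat (Suc m) r :: 'a mat) $$ (i, j)"
    using sw_props(2)[OF assms ij(1)] sw_props(2)[OF assms ij(2)] by (auto simp: sigma_mat_def)
qed (auto simp: sigma_mat_def)

lemma Jmat_index:
  assumes "i < 2 * m + 2" "j < 2 * m + 2"
  shows "Jmat (Suc m) \<epsilon> $$ (i, j) = (if j = sw (Suc m) m i then (if i \<le> 2 * m then 1 else - \<epsilon>) else 0)"
proof -
  consider "i < m" | "m \<le> i" "i < 2 * m" | "2 * m \<le> i" by linarith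
  then show ?thesis
    using assms by cases (auto simp: Jmat_def blk3_def bidx_def bofs_def sw_def delta_eps_def)
qed

text \<open>J is monomial with respect to the full swap of the first two blocks, and \<sigma>
  permutes indices by a partial swap. The two swaps commute, and the partial one does not touch the
  last two indices, where the entries of J are not all 1.\<close>

lemma sigma_isom:
  assumes "r \<le> m"
  shows "sigma_mat (Suc m) r \<in> isom (2 * m + 2) (Jmat (Suc m) (\<epsilon> :: 'a::field))"
proof -
  let ?s = "sw (Suc m) r" and ?J = "Jmat (Suc m) \<epsilon>"
  have "transpose_mat (sigma_mat (Suc m) r) * (?J * sigma_mat (Suc m) r) = ?J"
  proof (rule eq_matI)
    fix i j assume "i < dim_row ?J" "j < dim_col ?J"
    then have ij: "i < 2 * m + 2" "j < 2 * m + 2" using Jmat_carrier[of m \<epsilon>] by auto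
    have Jc: "?J * sigma_mat (Suc m) r \<in> carrier_mat (2 * m + 2) (2 * m + 2)"
      by (rule mult_carrier_mat[OF Jmat_carrier sigma_carrier])
    have "(transpose_mat (sigma_mat (Suc m) r) * (?J * sigma_mat (Suc m) r)) $$ (i, j) = ?J $$ (?s i, ?s j)"
      unfolding sigma_transpose[OF assms] sigma_mult(1)[OF assms Jc ij]
        sigma_mult(2)[OF assms Jmat_carrier sw_props(1)[OF assms ij(1)] ij(2)] ..
    also have "\<dots> = ?J $$ (i, j)"
    proof -
      have comm: "sw (Suc m) m (?s i) = ?s (sw (Suc m) m i)" using assms by (auto simp: sw_def)
      have "sw (Suc m) m i < 2 * m + 2" by (rule sw_props(1)[OF order_refl ij(1)])
      then have "?s j = ?s (sw (Suc m) m i) \<longleftrightarrow> j = sw (Suc m) m i"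
        using sw_props(2)[OF assms] ij by metis
      moreover have "?s i \<le> 2 * m \<longleftrightarrow> i \<le> 2 * m" using assms by (auto simp: sw_def)
      ultimately show ?thesis
        by (simp only: Jmat_index[OF ij] Jmat_index[OF sw_props(1)[OF assms ij(1)] sw_props(1)[OF assms ij(2)]] comm)
    qed
    finally show "(transpose_mat (sigma_mat (Suc m) r) * (?J * sigma_mat (Suc m) r)) $$ (i, j) = ?J $$ (i, j)" .
  qed (use Jmat_carrier[of m \<epsilon>] in \<open>auto simp: sigma_mat_def\<close>)
  then show ?thesis unfolding isom_def using sigma_carrier by blast
qed

section \<open>Summation over double cosets\<close>

lemma minv_closed:
  assumes Q: "Q \<subseteq> GL N" "finite Q" and mult: "\<And>x y. x \<in> Q \<Longrightarrow> y \<in> Q \<Longrightarrow> x * y \<in> Q"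
    and one: "1\<^sub>m N \<in> Q" and x: "x \<in> Q"
  shows "minv x \<in> Q"
proof -
  have xG: "x \<in> GL N" using Q x by auto
  have "inj_on ((*) x) Q"
    by (rule inj_onI) (metis Q(1) GL_carrier minv_mult_cancel(1) subsetD xG)
  moreover have "(*) x ` Q \<subseteq> Q" using mult x by auto
  ultimately have "(*) x ` Q = Q" using Q(2) by (intro endo_inj_surj)
  \<comment> \<open>An injective self-map of a finite set is onto, so the identity is the product of
    x with some element of Q.\<close>
  then obtain y where y: "y \<in> Q" "x * y = 1\<^sub>m N" using one by (metis image_iff)
  then have "y = minv x" using minv_unique[of x N y] Q xG GL_carrier by blast
  then show ?thesis using y by simp
qed

text \<open>Given one factorisation w = x0 s y0, every other one is x = x0 z, y = (s z s)^(-1) y0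
  with z in Q and s z s in Q. The involution s is its own inverse, which keeps the condition on z
  symmetric. The identity is stated without division by the fibre size.\<close>

lemma double_coset_sum:
  fixes f :: "'a::{finite,field} mat \<Rightarrow> complex"
  assumes Q: "Q \<subseteq> GL N" and mult: "\<And>x y. x \<in> Q \<Longrightarrow> y \<in> Q \<Longrightarrow> x * y \<in> Q"
    and one: "1\<^sub>m N \<in> Q" and s: "s \<in> carrier_mat N N" "s * s = 1\<^sub>m N"
  shows "of_nat (card {z \<in> Q. s * z * s \<in> Q}) * (\<Sum>w\<in>{x * s * y | x y. x \<in> Q \<and> y \<in> Q}. f w)
    = (\<Sum>x\<in>Q. \<Sum>y\<in>Q. f (x * s * y))"
proof -
  have fin: "finite Q" using Q finite_subset finite_GL by blast
  have inv: "minv x \<in> Q" if "x \<in> Q" for x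
    by (rule minv_closed[OF Q fin _ one that]) (rule mult)
  have car: "x \<in> carrier_mat N N" if "x \<in> Q" for x using that Q GL_carrier by blast
  note as = assoc_mult_mat[of _ N N _ N _ N]
  have QG: "x \<in> GL N" if "x \<in> Q" for x using that Q by auto
  let ?I = "{z \<in> Q. s * z * s \<in> Q}" and ?g = "\<lambda>(x, y). x * s * y"
  define W where "W = {x * s * y | x y. x \<in> Q \<and> y \<in> Q}"
  have W: "W = ?g ` (Q \<times> Q)" by (auto simp: W_def)
  have fibre: "card {p \<in> Q \<times> Q. ?g p = w} = card ?I" if "w \<in> W" for w
  proof -
    obtain x0 y0 where xy: "x0 \<in> Q" "y0 \<in> Q" "w = x0 * s * y0" using \<open>w \<in> W\<close> by (auto simp: W_def)
    note c0 = car[OF xy(1)] car[OF xy(2)]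
    have fwd: "x0 * z * s * (minv (s * z * s) * y0) = w" if z: "z \<in> ?I" for z
    proof -
      define u where "u = s * z * s"
      have u: "u \<in> Q" using z by (simp add: u_def)
      have zc: "z \<in> carrier_mat N N" using z car by auto
      have "s * u = (s * s) * z * s" unfolding u_def using zc s(1) by (simp add: as)
      then have su: "z * s = s * u" using s zc by simp
      have "x0 * z * s * (minv u * y0) = x0 * (z * s) * (minv u * y0)" using c0 zc s(1) by (simp add: as)
      also have "\<dots> = x0 * s * (u * (minv u * y0))"
        unfolding su using c0 s(1) car[OF u] car[OF inv[OF u]] by (simp add: as)
      also have "\<dots> = w" using minv_mult_cancel(2)[OF QG[OF u] c0(2)] xy(3) by simp
      finally show ?thesis by (simp add: u_def)
    qed
    have bwd: "minv x0 * x \<in> ?I" "minv (s * (minv x0 * x) * s) * y0 = y"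
      if p: "x \<in> Q" "y \<in> Q" "x * s * y = w" for x y
    proof -
      define z where "z = minv x0 * x"
      have z: "z \<in> Q" unfolding z_def by (rule mult[OF inv[OF xy(1)] p(1)])
      note c = car[OF p(1)] car[OF p(2)] car[OF z] car[OF inv[OF xy(1)]]
      have "z * s * y = minv x0 * (x * s * y)" unfolding z_def using c s(1) by (simp add: as)
      also have "\<dots> = minv x0 * (x0 * (s * y0))" unfolding p(3) xy(3) using c0 s(1) by (simp add: as)
      also have "\<dots> = s * y0" using minv_mult_cancel(1)[OF QG[OF xy(1)], of "s * y0" N] s(1) c0 by simp
      finally have zsy: "z * s * y = s * y0" .
      have "s * z * s * y = s * (z * s * y)" using c s(1) by (simp add: as)
      also have "\<dots> = s * s * y0" unfolding zsy using c0 s(1) by (simp add: as)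
      finally have szs: "s * z * s * y = y0" using s c0 by simp
      have "s * z * s = s * z * s * y * minv y"
        using mult_minv_cancel(1)[OF QG[OF p(2)], of "s * z * s" N] c s(1) by simp
      then have szsQ: "s * z * s \<in> Q" unfolding szs using mult[OF xy(2) inv[OF p(2)]] by simp
      then show "minv x0 * x \<in> ?I" using z by (simp add: z_def)
      show "minv (s * (minv x0 * x) * s) * y0 = y"
        using minv_mult_cancel(1)[OF QG[OF szsQ] c(2), unfolded szs] unfolding z_def .
    qed
    have "bij_betw (\<lambda>z. (x0 * z, minv (s * z * s) * y0)) ?I {p \<in> Q \<times> Q. ?g p = w}"
    proof (rule bij_betw_byWitness[of _ "\<lambda>(x, y). minv x0 * x"])
      show "\<forall>z\<in>?I. (\<lambda>(x, y). minv x0 * x) (x0 * z, minv (s * z * s) * y0) = z"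
        using minv_mult_cancel(1)[OF QG[OF xy(1)] car] by auto
      show "\<forall>p\<in>{p \<in> Q \<times> Q. ?g p = w}. (\<lambda>z. (x0 * z, minv (s * z * s) * y0)) ((\<lambda>(x, y). minv x0 * x) p) = p"
        using minv_mult_cancel(2)[OF QG[OF xy(1)] car] bwd(2) by auto
      show "(\<lambda>z. (x0 * z, minv (s * z * s) * y0)) ` ?I \<subseteq> {p \<in> Q \<times> Q. ?g p = w}"
        using fwd mult inv xy by auto
      show "(\<lambda>(x, y). minv x0 * x) ` {p \<in> Q \<times> Q. ?g p = w} \<subseteq> ?I"
        using bwd(1) by fast
    qed
    then show ?thesis by (rule bij_betw_same_card[symmetric])
  qed
  have "(\<Sum>x\<in>Q. \<Sum>y\<in>Q. f (x * s * y)) = (\<Sum>p\<in>Q \<times> Q. f (?g p))"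
    by (simp add: sum.cartesian_product case_prod_unfold)
  also have "\<dots> = (\<Sum>w\<in>W. \<Sum>p\<in>{p \<in> Q \<times> Q. ?g p = w}. f (?g p))"
    using fin unfolding W by (intro sum.group[symmetric]) auto
  also have "\<dots> = (\<Sum>w\<in>W. of_nat (card ?I) * f w)"
  proof (rule sum.cong[OF refl])
    fix w assume w: "w \<in> W"
    have "(\<Sum>p\<in>{p \<in> Q \<times> Q. ?g p = w}. f (?g p)) = (\<Sum>p\<in>{p \<in> Q \<times> Q. ?g p = w}. f w)"
      by (rule sum.cong) auto
    then show "(\<Sum>p\<in>{p \<in> Q \<times> Q. ?g p = w}. f (?g p)) = of_nat (card ?I) * f w"
      using fibre[OF w] by simp
  qed
  finally show ?thesis by (simp add: W_def sum_distrib_left)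
qed

text \<open>Characteristic three enters through \<open>-1/2 = 1\<close>: the symmetric part of the block \<open>B\<close> is \<open>h\<^sup>T\<delta>h\<close>.\<close>

definition qpar :: "nat \<Rightarrow> 'a::field \<Rightarrow> 'a mat \<times> 'a mat \<times> 'a mat \<times> 'a mat \<Rightarrow> 'a mat" where
  "qpar m \<epsilon> = (\<lambda>(A, i, h, K). qel m \<epsilon> A i h (gram \<epsilon> h + K))"

lemma qpar_bij:
  assumes three: "(3::'a::field) = 0"
  shows "bij_betw (qpar m \<epsilon>) (GL m \<times> SOminus2 \<epsilon> \<times> carrier_mat 2 m \<times> skew m) (Qgrp (Suc m) (\<epsilon>::'a))"
  unfolding bij_betw_def
proof
  have Kc: "K \<in> carrier_mat m m" if "K \<in> skew m" for K :: "'a mat" using that by (simp add: skew_def)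
  have Bc: "gram \<epsilon> h + K \<in> carrier_mat m m" if "h \<in> carrier_mat 2 m" "K \<in> skew m" for h K :: "'a mat"
    using gram_carrier[OF that(1), of \<epsilon>] Kc[OF that(2)] by simp
  show "inj_on (qpar m \<epsilon>) (GL m \<times> SOminus2 \<epsilon> \<times> carrier_mat 2 m \<times> skew m)"
  proof (rule inj_onI)
    fix p p' assume p: "p \<in> GL m \<times> SOminus2 \<epsilon> \<times> carrier_mat 2 m \<times> skew m"
      "p' \<in> GL m \<times> SOminus2 \<epsilon> \<times> carrier_mat 2 m \<times> skew m" and eq: "qpar m \<epsilon> p = qpar m \<epsilon> p'"
    obtain A i h K A' i' h' K' where pp: "p = (A, i, h, K)" "p' = (A', i', h', K')" by (metis prod_cases4)
    have *: "A \<in> GL m" "i \<in> SOminus2 \<epsilon>" "h \<in> carrier_mat 2 m" "K \<in> skew m"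
      "A' \<in> GL m" "i' \<in> SOminus2 \<epsilon>" "h' \<in> carrier_mat 2 m" "K' \<in> skew m" using p pp by auto
    let ?B = "gram \<epsilon> h + K" and ?B' = "gram \<epsilon> h' + K'"
    note uc = qel_ucar[OF *(1-3) Bc[OF *(3,4)]] qel_ucar[OF *(5-7) Bc[OF *(7,8)]]
    have "A = A' \<and> A * ?B = A' * ?B' \<and> i * h = i' * h' \<and> i = i'"
      using eq unfolding pp qpar_def prod.case qel_def
      by (subst (asm) b9_inject) (use uc in \<open>auto simp: bcar_list_iff ucar_def\<close>)
    then have A: "A' = A" and i: "i' = i" and "A * ?B = A * ?B'" "i * h = i * h'" by auto
    then have "?B = ?B'" "h = h'"
      using minv_mult_cancel(1)[OF *(1) Bc[OF *(3,4)]] minv_mult_cancel(1)[OF *(1) Bc[OF *(7,8)]]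
        minv_mult_cancel(1)[OF SOminus2D(1)[OF *(2)] *(3)] minv_mult_cancel(1)[OF SOminus2D(1)[OF *(2)] *(7)] by metis+
    then have h: "h' = h" and BB: "gram \<epsilon> h + K = gram \<epsilon> h + K'" by auto
    have "K $$ (a, b) = K' $$ (a, b)" if "a < m" "b < m" for a b
    proof -
      have "(gram \<epsilon> h + K) $$ (a, b) = (gram \<epsilon> h + K') $$ (a, b)" using BB by simp
      then show ?thesis using that Kc[OF *(4)] Kc[OF *(8)] by simp
    qed
    then have "K' = K" using Kc[OF *(4)] Kc[OF *(8)] by (intro eq_matI) auto
    then show "p = p'" using pp A i h by simp
  qed
  have t: "x + x = - x" for x :: 'a
  proof -
    have "x + x + x = 3 * x" by (simp add: mult_2[symmetric] distrib_right[symmetric])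
    then show ?thesis using three by (simp add: eq_neg_iff_add_eq_0)
  qed
  show "qpar m \<epsilon> ` (GL m \<times> SOminus2 \<epsilon> \<times> carrier_mat 2 m \<times> skew m) = Qgrp (Suc m) \<epsilon>"
  proof (intro equalityI subsetI)
    fix w assume "w \<in> qpar m \<epsilon> ` (GL m \<times> SOminus2 \<epsilon> \<times> carrier_mat 2 m \<times> skew m)"
    then obtain A i h K where *: "A \<in> GL m" "i \<in> SOminus2 \<epsilon>" "h \<in> carrier_mat 2 m" "K \<in> skew m"
      and w: "w = qel m \<epsilon> A i h (gram \<epsilon> h + K)" by (auto simp: qpar_def)
    note G = gram_carrier[OF *(3), of \<epsilon>] and K = Kc[OF *(4)]
    have tG: "transpose_mat (gram \<epsilon> h) = gram \<epsilon> h" by (rule transpose_gram_eps[OF *(3)])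
    have "transpose_mat (gram \<epsilon> h + K) + (gram \<epsilon> h + K) + gram \<epsilon> h = 0\<^sub>m m m"
    proof (rule eq_matI)
      fix a b assume "a < dim_row (0\<^sub>m m m :: 'a mat)" "b < dim_col (0\<^sub>m m m :: 'a mat)"
      then have ab: "a < m" "b < m" by auto
      have g: "gram \<epsilon> h $$ (b, a) = gram \<epsilon> h $$ (a, b)" using tG G ab by (metis carrier_matD index_transpose_mat(1))
      have "gram \<epsilon> h $$ (a, b) + gram \<epsilon> h $$ (a, b) + gram \<epsilon> h $$ (a, b) = 0"
        using t[of "gram \<epsilon> h $$ (a, b)"] by simp
      then show "(transpose_mat (gram \<epsilon> h + K) + (gram \<epsilon> h + K) + gram \<epsilon> h) $$ (a, b) = 0\<^sub>m m m $$ (a, b)"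
        using G K ab skewD[OF *(4) ab] g by simp
    qed (use G K in auto)
    then show "w \<in> Qgrp (Suc m) \<epsilon>" unfolding Qgrp_eq using w * Bc by blast
  next
    fix w assume "w \<in> Qgrp (Suc m) \<epsilon>"
    then obtain A i h B where *: "A \<in> GL m" "i \<in> SOminus2 \<epsilon>" "h \<in> carrier_mat 2 m" "B \<in> carrier_mat m m"
      and eq: "transpose_mat B + B + gram \<epsilon> h = 0\<^sub>m m m" and w: "w = qel m \<epsilon> A i h B" unfolding Qgrp_eq by auto
    note G = gram_carrier[OF *(3), of \<epsilon>]
    have tG: "transpose_mat (gram \<epsilon> h) = gram \<epsilon> h" by (rule transpose_gram_eps[OF *(3)])
    \<comment> \<open>The defining relation reads B^T + B = -gram = 2 gram, so removing one gram
      matrix from B and one from its transpose leaves zero.\<close>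
    have K: "B - gram \<epsilon> h \<in> skew m"
    proof (rule skewI)
      fix a b assume ab: "a < m" "b < m"
      have g: "gram \<epsilon> h $$ (b, a) = gram \<epsilon> h $$ (a, b)" using tG G ab by (metis carrier_matD index_transpose_mat(1))
      have "(transpose_mat B + B + gram \<epsilon> h) $$ (a, b) = 0" unfolding eq using ab by simp
      then have "B $$ (b, a) + B $$ (a, b) + gram \<epsilon> h $$ (a, b) = 0" using *(4) G ab by (simp add: add.assoc)
      then have "B $$ (b, a) + B $$ (a, b) = - gram \<epsilon> h $$ (a, b)" by (simp only: eq_neg_iff_add_eq_0)
      then have "B $$ (a, b) + B $$ (b, a) = gram \<epsilon> h $$ (a, b) + gram \<epsilon> h $$ (a, b)"
        unfolding t by (simp only: add.commute)
      then have "B $$ (a, b) = gram \<epsilon> h $$ (a, b) + gram \<epsilon> h $$ (a, b) - B $$ (b, a)" by (simp only: eq_diff_eq)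
      then have "B $$ (a, b) - gram \<epsilon> h $$ (a, b) = gram \<epsilon> h $$ (a, b) - B $$ (b, a)" by simp
      then show "(B - gram \<epsilon> h) $$ (a, b) = - (B - gram \<epsilon> h) $$ (b, a)" using *(4) G ab g by simp
    qed (use * G in auto)
    have "gram \<epsilon> h + (B - gram \<epsilon> h) = B" using * G by (intro eq_matI) auto
    then show "w \<in> qpar m \<epsilon> ` (GL m \<times> SOminus2 \<epsilon> \<times> carrier_mat 2 m \<times> skew m)"
      using * K w by (intro image_eqI[of _ _ "(A, i, h, B - gram \<epsilon> h)"]) (auto simp: qpar_def)
  qed
qed

section \<open>Block lower triangular invertible matrices\<close>

definition lowGL :: "nat \<Rightarrow> nat \<Rightarrow> 'a::field mat set" where
  "lowGL r m = {A \<in> GL m. \<forall>i<r. \<forall>j. r \<le> j \<and> j < m \<longrightarrow> A $$ (i, j) = 0}"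

lemma low_block_GL_iff:
  assumes "A \<in> carrier_mat r r" "C \<in> carrier_mat k r" "D \<in> carrier_mat k k"
  shows "four_block_mat A (0\<^sub>m r k) C D \<in> GL (r + k) \<longleftrightarrow> A \<in> GL r \<and> D \<in> GL (k :: nat)"
proof -
  have "det (four_block_mat A (0\<^sub>m r k) C D) = det A * det D"
    by (rule det_four_block_mat_upper_right_zero[OF assms(1) refl assms(2,3)])
  then show ?thesis using assms four_block_carrier_mat[OF assms(1,3)] by (auto simp: GL_def)
qed

lemma lowGL_bij:
  "bij_betw (\<lambda>(A, C, D). four_block_mat A (0\<^sub>m r k) C D) (GL r \<times> carrier_mat k r \<times> GL k)
    (lowGL r (r + k) :: 'a::field mat set)"
  unfolding bij_betw_def
proof
  show "inj_on (\<lambda>(A, C, D). four_block_mat A (0\<^sub>m r k) C D) (GL r \<times> carrier_mat k r \<times> GL k :: ('a mat \<times> 'a mat \<times> 'a mat) set)"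
    by (auto simp: inj_on_def GL_def four_block_inject[of _ r r _ k _ k])
  show "(\<lambda>(A, C, D). four_block_mat A (0\<^sub>m r k) C D) ` (GL r \<times> carrier_mat k r \<times> GL k) = (lowGL r (r + k) :: 'a mat set)"
  proof (intro equalityI subsetI)
    fix M :: "'a mat" assume "M \<in> (\<lambda>(A, C, D). four_block_mat A (0\<^sub>m r k) C D) ` (GL r \<times> carrier_mat k r \<times> GL k)"
    then obtain A C D where *: "A \<in> GL r" "C \<in> carrier_mat k r" "D \<in> GL k" "M = four_block_mat A (0\<^sub>m r k) C D" by auto
    have c: "A \<in> carrier_mat r r" "D \<in> carrier_mat k k" using * GL_carrier by auto
    have "M \<in> GL (r + k)" using low_block_GL_iff[OF c(1) *(2) c(2)] * by simp
    moreover have "M $$ (i, j) = 0" if "i < r" "r \<le> j" "j < r + k" for i j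
      using that c * by auto
    ultimately show "M \<in> lowGL r (r + k)" by (auto simp: lowGL_def)
  next
    fix M :: "'a mat" assume M: "M \<in> lowGL r (r + k)"
    then have Mc: "M \<in> carrier_mat (r + k) (r + k)" by (auto simp: lowGL_def GL_def)
    from four_block_cases[OF this] obtain A B C D where *: "A \<in> carrier_mat r r" "B \<in> carrier_mat r k"
      "C \<in> carrier_mat k r" "D \<in> carrier_mat k k" "M = four_block_mat A B C D" by metis
    have "B = 0\<^sub>m r k"
    proof (rule eq_matI)
      fix i j assume "i < dim_row (0\<^sub>m r k :: 'a mat)" "j < dim_col (0\<^sub>m r k :: 'a mat)"
      then have ij: "i < r" "j < k" by auto
      then have "M $$ (i, j + r) = 0" using M by (simp add: lowGL_def)
      moreover have "M $$ (i, j + r) = B $$ (i, j)" using ij * by simp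
      ultimately show "B $$ (i, j) = 0\<^sub>m r k $$ (i, j)" using ij by simp
    qed (use * in auto)
    then have Mf: "M = four_block_mat A (0\<^sub>m r k) C D" using * by simp
    have "A \<in> GL r \<and> D \<in> GL k" using low_block_GL_iff[OF *(1,3,4)] M Mf by (simp add: lowGL_def)
    then show "M \<in> (\<lambda>(A, C, D). four_block_mat A (0\<^sub>m r k) C D) ` (GL r \<times> carrier_mat k r \<times> GL k)"
      using Mf * by (intro image_eqI[of _ _ "(A, C, D)"]) auto
  qed
qed

lemma minv_low_block:
  assumes A: "A \<in> GL r" and C: "C \<in> carrier_mat k r" and D: "D \<in> GL k"
  shows "minv (four_block_mat A (0\<^sub>m r k) C D) =
    four_block_mat (minv A) (0\<^sub>m r k) (- (minv D * C * minv A)) (minv (D :: 'a::field mat))"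
proof (rule minv_unique[symmetric, of _ "r + k"])
  note c = GL_carrier[OF A] GL_carrier[OF D] minv(1)[OF A] minv(1)[OF D]
  let ?E = "minv D * C * minv A"
  have E: "?E \<in> carrier_mat k r" using c C by (intro mult_carrier_mat[of _ k r] mult_carrier_mat[of _ k k]) auto
  have CA: "C * minv A \<in> carrier_mat k r" using c C by auto
  have DE: "D * ?E = C * minv A"
  proof -
    have "?E = minv D * (C * minv A)" using c C by (intro assoc_mult_mat) auto
    then show ?thesis using minv_mult_cancel(2)[OF D CA] by simp
  qed
  have "four_block_mat A (0\<^sub>m r k) C D * four_block_mat (minv A) (0\<^sub>m r k) (- ?E) (minv D) =
    four_block_mat (A * minv A + 0\<^sub>m r k * (- ?E)) (A * 0\<^sub>m r k + 0\<^sub>m r k * minv D)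
      (C * minv A + D * (- ?E)) (C * 0\<^sub>m r k + D * minv D)"
    using c C E by (intro mult_four_block_mat) auto
  also have "A * minv A + 0\<^sub>m r k * (- ?E) = 1\<^sub>m r"
    using minv(2)[OF A] left_mult_zero_mat[OF uminus_carrier_mat[OF E], of r] by (simp add: dim_simps)
  also have "A * 0\<^sub>m r k + 0\<^sub>m r k * minv D = 0\<^sub>m r k" using c by (simp add: dim_simps)
  also have "C * minv A + D * (- ?E) = 0\<^sub>m k r"
  proof -
    have "D * (- ?E) = - (D * ?E)" using c E by (intro eq_matI) auto
    moreover have "X + - X = 0\<^sub>m k r" if "X \<in> carrier_mat k r" for X :: "'a mat"
      using that by (intro eq_matI) auto
    ultimately show ?thesis unfolding DE using CA by simp
  qed
  also have "C * 0\<^sub>m r k + D * minv D = 1\<^sub>m k" using minv(2)[OF D] C by (simp add: dim_simps)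
  also have "four_block_mat (1\<^sub>m r) (0\<^sub>m r k) (0\<^sub>m k r) (1\<^sub>m k) = (1\<^sub>m (r + k) :: 'a mat)"
    by (rule four_block_one_mat)
  finally show "four_block_mat A (0\<^sub>m r k) C D * four_block_mat (minv A) (0\<^sub>m r k) (- ?E) (minv D) = 1\<^sub>m (r + k)" .
  show "four_block_mat A (0\<^sub>m r k) C D \<in> carrier_mat (r + k) (r + k)"
    "four_block_mat (minv A) (0\<^sub>m r k) (- ?E) (minv D) \<in> carrier_mat (r + k) (r + k)"
    using four_block_carrier_mat[OF c(1,2)] four_block_carrier_mat[OF c(3,4)] by auto
qed

lemma minv_lowGL:
  assumes A: "A \<in> lowGL r (r + k)"
  shows "minv (A :: 'a::field mat) \<in> lowGL r (r + k)"
proof -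
  have "A \<in> (\<lambda>(A, C, D). four_block_mat A (0\<^sub>m r k) C D) ` (GL r \<times> carrier_mat k r \<times> GL k)"
    using lowGL_bij[of r k, where 'a='a] A by (simp add: bij_betw_def)
  then obtain P C D where *: "P \<in> GL r" "C \<in> carrier_mat k r" "D \<in> GL k" "A = four_block_mat P (0\<^sub>m r k) C D" by auto
  have "- (minv D * C * minv P) \<in> carrier_mat k r"
    using * minv(1)[OF *(1)] minv(1)[OF *(3)]
    by (intro uminus_carrier_mat mult_carrier_mat[of _ k r] mult_carrier_mat[of _ k k]) auto
  then have "minv A \<in> (\<lambda>(A, C, D). four_block_mat A (0\<^sub>m r k) C D) ` (GL r \<times> carrier_mat k r \<times> GL k)"
    unfolding *(4) minv_low_block[OF *(1-3)] using minv_GL[OF *(1)] minv_GL[OF *(3)]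
    by (intro image_eqI[of _ _ "(minv P, - (minv D * C * minv P), minv D)"]) auto
  then show ?thesis using lowGL_bij[of r k, where 'a='a] by (simp add: bij_betw_def)
qed

subsection \<open>The intersection of the parabolic subgroup with its conjugate\<close>

lemma sw_values:
  "k < r \<Longrightarrow> sw (Suc m) r k = m + k"
  "k < r \<Longrightarrow> r \<le> m \<Longrightarrow> sw (Suc m) r (m + k) = k"
  "r \<le> k \<Longrightarrow> k < m \<Longrightarrow> sw (Suc m) r k = k"
  "r \<le> k \<Longrightarrow> k < m \<Longrightarrow> sw (Suc m) r (m + k) = m + k"
  "r \<le> m \<Longrightarrow> sw (Suc m) r (2 * m + p) = 2 * m + p"
  by (auto simp: sw_def)

lemma mult_mat_index:
  assumes "A \<in> carrier_mat a b" "B \<in> carrier_mat b c" "i < a" "j < c"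
  shows "(A * B) $$ (i, j) = (\<Sum>t = 0..<b. A $$ (i, t) * B $$ (t, j))"
  using assms by (simp add: scalar_prod_def)

lemma sigma_conj_index:
  assumes "r \<le> m" "z \<in> carrier_mat (2 * m + 2) (2 * m + 2)" "i < 2 * m + 2" "j < 2 * m + 2"
  shows "(sigma_mat (Suc m) r * z * sigma_mat (Suc m) r) $$ (i, j) = (z $$ (sw (Suc m) r i, sw (Suc m) r j) :: 'a::field)"
  unfolding sigma_mult(2)[OF assms(1) mult_carrier_mat[OF sigma_carrier assms(2)] assms(3,4)]
    sigma_mult(1)[OF assms(1,2,3) sw_props(1)[OF assms(1,4)]] ..

text \<open>Conjugation by \<sigma> permutes entries, and by \<open>Qgrp_iff\<close> the question is
  which entries of the given element land in the forbidden blocks. These come from the upper right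
  part of A, the corner of \<open>A * B\<close> and the first r columns of \<open>i * h\<close>.
  Invertibility of i and the triangular shape of A turn this into conditions on h and on the corner
  of B, and the latter becomes one on K because the Gram matrix vanishes where h has zero
  columns.\<close>

lemma sigma_conj_Qgrp_iff:
  assumes three: "(3::'a) = 0" and A: "A \<in> GL (r + k)" and i: "i \<in> SOminus2 \<epsilon>" and h: "h \<in> carrier_mat 2 (r + k)"
    and K: "K \<in> skew (r + k)"
  shows "sigma_mat (Suc (r + k)) r * qpar (r + k) \<epsilon> (A, i, h, K) * sigma_mat (Suc (r + k)) r \<in> Qgrp (Suc (r + k)) (\<epsilon> :: 'a::field) \<longleftrightarrow>
    A \<in> lowGL r (r + k) \<and> (\<forall>p<2. \<forall>j<r. h $$ (p, j) = 0) \<and> (\<forall>a<r. \<forall>b<r. K $$ (a, b) = 0)"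
proof -
  define m where "m = r + k"
  have r: "r \<le> m" by (simp add: m_def)
  note A = A[folded m_def] and h = h[folded m_def] and K = K[folded m_def]
  define B where "B = gram \<epsilon> h + K"
  define z where "z = qel m \<epsilon> A i h B"
  have z: "qpar m \<epsilon> (A, i, h, K) = z" by (simp add: qpar_def z_def B_def)
  let ?s = "sigma_mat (Suc m) r :: 'a mat"
  let ?w = "?s * z * ?s"
  note G = gram_carrier[OF h, of \<epsilon>]
  have Kc: "K \<in> carrier_mat m m" using K by (simp add: skew_def)
  have B: "B \<in> carrier_mat m m" using G Kc by (simp add: B_def)
  have Ac: "A \<in> carrier_mat m m" and Ai: "minv A \<in> carrier_mat m m" using GL_carrier minv A by auto
  have ic: "i \<in> carrier_mat 2 2" and iG: "i \<in> GL 2" using SOminus2D[OF i] by auto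
  have AB: "A * B \<in> carrier_mat m m" using Ac B by simp
  let ?Y = "A * (- (transpose_mat h * delta_eps \<epsilon>))"
  have zc: "z \<in> carrier_mat (2 * m + 2) (2 * m + 2)" unfolding z_def qel_def by (rule b9_carrier)
  have wi: "?w $$ (a, b) = z $$ (sw (Suc m) r a, sw (Suc m) r b)" if "a < 2 * m + 2" "b < 2 * m + 2" for a b
    by (rule sigma_conj_index[OF r zc that])
  have gram0: "gram \<epsilon> h $$ (a, b) = 0" if "\<forall>p<2. \<forall>j<r. h $$ (p, j) = 0" "a < m" "b < r" for a b
  proof -
    have "gram \<epsilon> h $$ (a, b) = (\<Sum>t = 0..<2. (transpose_mat h * delta_eps \<epsilon>) $$ (a, t) * h $$ (t, b))"
      unfolding gram_def using that r h by (intro mult_mat_index[of _ m 2 _ m] mult_carrier_mat[of _ m 2 _ 2]) auto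
    also have "\<dots> = 0" using that by (intro sum.neutral) auto
    finally show ?thesis .
  qed
  have AB_ent: "(A * B) $$ (a, b) = (\<Sum>l = 0..<m. A $$ (a, l) * B $$ (l, b))" if "a < m" "b < m" for a b
    using that Ac B by (simp add: scalar_prod_def)
  have ih_ent: "(i * h) $$ (p, b) = (\<Sum>t = 0..<2. i $$ (p, t) * h $$ (t, b))" if "p < 2" "b < m" for p b
    using that ic h by (simp add: scalar_prod_def)
  have "?w \<in> Qgrp (Suc m) \<epsilon> \<longleftrightarrow> A \<in> lowGL r m \<and> (\<forall>p<2. \<forall>j<r. h $$ (p, j) = 0) \<and> (\<forall>a<r. \<forall>b<r. K $$ (a, b) = 0)"
  proof
    assume "?w \<in> Qgrp (Suc m) \<epsilon>"
    then obtain A' X' Y' D' Z' i' where w': "?w = upper9 m A' X' Y' D' Z' i'" unfolding Qgrp_iff by blast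
    have w1: "?w $$ (m + a, b) = 0" if "a < m" "b < m" for a b
      unfolding w' b9_index(4)[OF that] using that by simp
    have w3: "?w $$ (2 * m + p, b) = 0" if "p < 2" "b < m" for p b
      unfolding w' b9_index(7)[OF that] using that by simp
    have A0: "A $$ (a, b) = 0" if "a < r" "r \<le> b" "b < m" for a b
    proof -
      have "z $$ (a, b) = 0" using w1[of a b] wi[of "m + a" b] that r by (simp add: sw_values)
      then show ?thesis unfolding z_def qel_def using that r by (simp add: b9_index)
    qed
    then have low: "A \<in> lowGL r m" using A by (auto simp: lowGL_def)
    have AB0: "(A * B) $$ (a, b) = 0" if "a < r" "b < r" for a b
    proof -
      have "z $$ (a, m + b) = 0" using w1[of a b] wi[of "m + a" b] that r by (simp add: sw_values)
      then show ?thesis unfolding z_def qel_def using that r by (simp add: b9_index(2))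
    qed
    have ih0: "(i * h) $$ (p, b) = 0" if "p < 2" "b < r" for p b
    proof -
      have "z $$ (2 * m + p, m + b) = 0" using w3[of p b] wi[of "2 * m + p" b] that r by (simp add: sw_values)
      moreover have "b < m" using that r by simp
      ultimately show ?thesis unfolding z_def qel_def b9_index(8)[OF that(1) \<open>b < m\<close>] by simp
    qed
    have h0: "h $$ (p, b) = 0" if "p < 2" "b < r" for p b
    proof -
      have ihc: "i * h \<in> carrier_mat 2 m" using ic h by simp
      have "h $$ (p, b) = (minv i * (i * h)) $$ (p, b)" using minv_mult_cancel(1)[OF iG h] by simp
      also have "\<dots> = (\<Sum>t = 0..<2. minv i $$ (p, t) * (i * h) $$ (t, b))"
        using that r by (intro mult_mat_index[OF minv(1)[OF iG] ihc]) auto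
      also have "\<dots> = 0" using that ih0 by (intro sum.neutral) auto
      finally show ?thesis .
    qed
    \<comment> \<open>The inverse of A is block lower triangular as well, so cancelling A expresses
      the first r rows of B through the first r rows of \<open>A * B\<close>.\<close>
    have iA0: "minv A $$ (a, b) = 0" if "a < r" "r \<le> b" "b < m" for a b
      using minv_lowGL[OF low[unfolded m_def]] that by (auto simp: lowGL_def m_def)
    have B0: "B $$ (a, b) = 0" if "a < r" "b < r" for a b
    proof -
      have "B $$ (a, b) = (minv A * (A * B)) $$ (a, b)" using minv_mult_cancel(1)[OF A B] by simp
      also have "\<dots> = (\<Sum>l = 0..<m. minv A $$ (a, l) * (A * B) $$ (l, b))"
        using that r by (intro mult_mat_index[OF Ai AB]) auto
      also have "\<dots> = 0"
      proof (intro sum.neutral ballI)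
        fix l assume "l \<in> {0..<m}"
        then show "minv A $$ (a, l) * (A * B) $$ (l, b) = 0" using that iA0 AB0 by (cases "l < r") auto
      qed
      finally show ?thesis .
    qed
    have "K $$ (a, b) = 0" if "a < r" "b < r" for a b
      using B0[OF that] gram0[of a b] h0 that r Kc G unfolding B_def by simp
    then show "A \<in> lowGL r m \<and> (\<forall>p<2. \<forall>j<r. h $$ (p, j) = 0) \<and> (\<forall>a<r. \<forall>b<r. K $$ (a, b) = 0)"
      using low h0 by auto
  next
    assume "A \<in> lowGL r m \<and> (\<forall>p<2. \<forall>j<r. h $$ (p, j) = 0) \<and> (\<forall>a<r. \<forall>b<r. K $$ (a, b) = 0)"
    then have low: "A \<in> lowGL r m" and h0: "\<forall>p<2. \<forall>j<r. h $$ (p, j) = 0" and K0: "\<forall>a<r. \<forall>b<r. K $$ (a, b) = 0" by auto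
    have A0: "A $$ (a, b) = 0" if "a < r" "r \<le> b" "b < m" for a b
      using low that by (auto simp: lowGL_def)
    have iA0: "minv A $$ (a, b) = 0" if "a < r" "r \<le> b" "b < m" for a b
      using minv_lowGL[OF low[unfolded m_def]] that by (auto simp: lowGL_def m_def)
    have B0: "B $$ (a, b) = 0" if "a < r" "b < r" for a b
      using gram0[OF h0, of a b] K0 that r Kc G unfolding B_def by simp
    have AB0: "(A * B) $$ (a, b) = 0" if "a < r" "b < r" for a b
    proof -
      have "(A * B) $$ (a, b) = (\<Sum>l = 0..<m. A $$ (a, l) * B $$ (l, b))" using AB_ent that r by simp
      also have "\<dots> = 0"
      proof (intro sum.neutral ballI)
        fix l assume "l \<in> {0..<m}"
        then show "A $$ (a, l) * B $$ (l, b) = 0" using that A0 B0 by (cases "l < r") auto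
      qed
      finally show ?thesis .
    qed
    have ih0: "(i * h) $$ (p, b) = 0" if "p < 2" "b < r" for p b
    proof -
      have "b < m" using that r by simp
      show ?thesis unfolding ih_ent[OF that(1) \<open>b < m\<close>] using that h0 by (intro sum.neutral) auto
    qed
    have hd: "transpose_mat h * delta_eps \<epsilon> \<in> carrier_mat m 2" using h by auto
    have Y0: "?Y $$ (a, p) = 0" if "a < r" "p < 2" for a p
    proof -
      have "?Y $$ (a, p) = (\<Sum>l = 0..<m. A $$ (a, l) * (- (transpose_mat h * delta_eps \<epsilon>)) $$ (l, p))"
        using that r by (intro mult_mat_index[OF Ac uminus_carrier_mat[OF hd]]) auto
      also have "\<dots> = 0"
      proof (intro sum.neutral ballI)
        fix l assume l: "l \<in> {0..<m}"
        show "A $$ (a, l) * (- (transpose_mat h * delta_eps \<epsilon>)) $$ (l, p) = 0"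
        proof (cases "l < r")
          case True
          have "(transpose_mat h * delta_eps \<epsilon>) $$ (l, p) = (\<Sum>t = 0..<2. h $$ (t, l) * delta_eps \<epsilon> $$ (t, p))"
            using l that h by (subst mult_mat_index[of _ m 2 _ 2]) auto
          also have "\<dots> = 0" using h0 True by (intro sum.neutral) auto
          finally have "(transpose_mat h * delta_eps \<epsilon>) $$ (l, p) = 0" .
          moreover have "(- (transpose_mat h * delta_eps \<epsilon>)) $$ (l, p) = - (transpose_mat h * delta_eps \<epsilon>) $$ (l, p)"
            using l that hd by (intro index_uminus_mat(1)) auto
          ultimately show ?thesis by simp
        next
          case False
          then show ?thesis using A0[of a l] that l by simp
        qed
      qed
      finally show ?thesis .
    qed
    have wc: "?w \<in> carrier_mat (2 * m + 2) (2 * m + 2)"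
      by (intro mult_carrier_mat[OF mult_carrier_mat[OF sigma_carrier zc] sigma_carrier])
    from b9_cases[OF wc] obtain a' b' c' d' e' f' g' h' i' where bc: "bcar m (\<lambda>p q. [[a', b', c'], [d', e', f'], [g', h', i']] ! p ! q)"
      and w': "?w = b9 m a' b' c' d' e' f' g' h' i'" by metis
    note bc' = bc[unfolded bcar_list_iff]
    \<comment> \<open>The four cases take their entries from \<open>A * B\<close>, from A, from the
      transposed inverse of A and from a zero block of the original element.\<close>
    have d': "d' = 0\<^sub>m m m"
    proof (rule eq_matI)
      fix a b assume "a < dim_row (0\<^sub>m m m :: 'a mat)" "b < dim_col (0\<^sub>m m m :: 'a mat)"
      then have ab: "a < m" "b < m" by auto
      have "d' $$ (a, b) = ?w $$ (m + a, b)" unfolding w' b9_index(4)[OF ab] ..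
      also have "\<dots> = z $$ (sw (Suc m) r (m + a), sw (Suc m) r b)" using wi ab by simp
      also have "\<dots> = 0"
      proof (cases "a < r"; cases "b < r")
        assume "a < r" "b < r"
        then show ?thesis unfolding z_def qel_def using ab r AB0 by (simp add: sw_values b9_index(2))
      next
        assume "a < r" "\<not> b < r"
        then show ?thesis unfolding z_def qel_def using ab r A0 by (simp add: sw_values b9_index(1))
      next
        assume "\<not> a < r" "b < r"
        then show ?thesis unfolding z_def qel_def using ab r iA0 Ai by (simp add: sw_values b9_index(5))
      next
        assume "\<not> a < r" "\<not> b < r"
        then show ?thesis unfolding z_def qel_def using ab r by (simp add: sw_values b9_index(4))
      qed
      finally show "d' $$ (a, b) = 0\<^sub>m m m $$ (a, b)" using ab by simp
    qed (use bc' in auto)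
    have f': "f' = 0\<^sub>m m 2"
    proof (rule eq_matI)
      fix a p assume "a < dim_row (0\<^sub>m m 2 :: 'a mat)" "p < dim_col (0\<^sub>m m 2 :: 'a mat)"
      then have ab: "a < m" "p < 2" by auto
      have "f' $$ (a, p) = ?w $$ (m + a, 2 * m + p)" unfolding w' b9_index(6)[OF ab] ..
      also have "\<dots> = z $$ (sw (Suc m) r (m + a), 2 * m + p)" using wi ab r by (simp add: sw_values)
      also have "\<dots> = 0"
      proof (cases "a < r")
        case True
        then show ?thesis unfolding z_def qel_def using ab r Y0 by (simp add: sw_values b9_index(3))
      next
        case False
        then show ?thesis unfolding z_def qel_def using ab r by (simp add: sw_values b9_index(6))
      qed
      finally show "f' $$ (a, p) = 0\<^sub>m m 2 $$ (a, p)" using ab by simp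
    qed (use bc' in auto)
    have g': "g' = 0\<^sub>m 2 m"
    proof (rule eq_matI)
      fix p b assume "p < dim_row (0\<^sub>m 2 m :: 'a mat)" "b < dim_col (0\<^sub>m 2 m :: 'a mat)"
      then have ab: "p < 2" "b < m" by auto
      have "g' $$ (p, b) = ?w $$ (2 * m + p, b)" unfolding w' b9_index(7)[OF ab] ..
      also have "\<dots> = z $$ (2 * m + p, sw (Suc m) r b)" using wi ab r by (simp add: sw_values)
      also have "\<dots> = 0"
      proof (cases "b < r")
        case True
        then show ?thesis unfolding z_def qel_def sw_values(1)[OF True] b9_index(8)[OF ab] using ab ih0 by simp
      next
        case False
        then have sb: "sw (Suc m) r b = b" using ab by (simp add: sw_values)
        show ?thesis unfolding sb z_def qel_def b9_index(7)[OF ab] using ab by simp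
      qed
      finally show "g' $$ (p, b) = 0\<^sub>m 2 m $$ (p, b)" using ab by simp
    qed (use bc' in auto)
    have "i' = i"
    proof (rule eq_matI)
      fix p p' assume "p < dim_row i" "p' < dim_col i"
      then have ab: "p < 2" "p' < 2" using ic by auto
      have "i' $$ (p, p') = ?w $$ (2 * m + p, 2 * m + p')" unfolding w' b9_index(9)[OF ab] ..
      also have "\<dots> = z $$ (2 * m + p, 2 * m + p')" using wi ab r by (simp add: sw_values)
      also have "\<dots> = i $$ (p, p')" unfolding z_def qel_def b9_index(9)[OF ab] ..
      finally show "i' $$ (p, p') = i $$ (p, p')" .
    qed (use bc' ic in auto)
    then have det: "det i' = 1" using SOminus2D(3)[OF i] by simp
    have uc: "ucar m a' b' c' e' h' i'" using bc' by (simp add: ucar_def)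
    have wu: "?w = upper9 m a' b' c' e' h' i'" using w' d' f' g' by simp
    \<comment> \<open>The isometry condition costs no block computation, as the conjugate is a
      product of isometries.\<close>
    have "z \<in> Qgrp (Suc m) \<epsilon>"
      unfolding z[symmetric] using bij_betw_imp_surj_on[OF qpar_bij[OF three, of m \<epsilon>]] A i h K by blast
    then have "?w \<in> isom (2 * m + 2) (Jmat (Suc m) \<epsilon>)"
      by (intro isom_mult Jmat_carrier sigma_isom[OF r] Qgrp_isom)
    then show "?w \<in> Qgrp (Suc m) \<epsilon>" unfolding Qgrp_iff isom_def using uc wu det by blast
  qed
  then show ?thesis unfolding z m_def[symmetric] .
qed

lemma card_lowGL:
  "card (lowGL r (r + k) :: 'a::{finite,field} mat set) = card (GL r :: 'a mat set) * (CARD('a) ^ (k * r) * card (GL k :: 'a mat set))"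
  using bij_betw_same_card[OF lowGL_bij[of r k, where 'a='a]]
  by (simp add: card_cartesian_product card_carrier_mat)

lemma card_left_cols_zero:
  "card {h \<in> carrier_mat 2 (r + k). \<forall>p<2. \<forall>j<r. h $$ (p, j) = (0::'a::{finite,field})} = CARD('a) ^ (2 * k)"
proof -
  have "bij_betw (hcat (0\<^sub>m 2 r)) (carrier_mat 2 k) {h \<in> carrier_mat 2 (r + k). \<forall>p<2. \<forall>j<r. h $$ (p, j) = (0::'a)}"
    unfolding bij_betw_def
  proof
    have inj: "inj_on (\<lambda>(A, B). hcat A B) (carrier_mat 2 r \<times> carrier_mat 2 k :: ('a mat \<times> 'a mat) set)"
      using bij_betw_hcat[of 2 r k, where 'a='a] by (simp add: bij_betw_def)
    show "inj_on (hcat (0\<^sub>m 2 r)) (carrier_mat 2 k :: 'a mat set)"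
    proof (rule inj_onI)
      fix h h' :: "'a mat" assume "h \<in> carrier_mat 2 k" "h' \<in> carrier_mat 2 k" "hcat (0\<^sub>m 2 r) h = hcat (0\<^sub>m 2 r) h'"
      then show "h = h'" using inj_onD[OF inj, of "(0\<^sub>m 2 r, h)" "(0\<^sub>m 2 r, h')"] by auto
    qed
    show "hcat (0\<^sub>m 2 r) ` carrier_mat 2 k = {h \<in> carrier_mat 2 (r + k). \<forall>p<2. \<forall>j<r. h $$ (p, j) = (0::'a)}"
    proof (intro equalityI subsetI)
      fix h :: "'a mat" assume "h \<in> {h \<in> carrier_mat 2 (r + k). \<forall>p<2. \<forall>j<r. h $$ (p, j) = 0}"
      then have h: "h \<in> carrier_mat 2 (r + k)" "\<forall>p<2. \<forall>j<r. h $$ (p, j) = 0" by auto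
      then have "h \<in> (\<lambda>(A, B). hcat A B) ` (carrier_mat 2 r \<times> carrier_mat 2 k)"
        using bij_betw_imp_surj_on[OF bij_betw_hcat[of 2 r k, where 'a='a]] by blast
      then obtain g h' where gh: "g \<in> carrier_mat 2 r" "h' \<in> carrier_mat 2 k" "h = hcat g h'" by auto
      have "g = 0\<^sub>m 2 r"
      proof (rule eq_matI)
        fix p j assume "p < dim_row (0\<^sub>m 2 r :: 'a mat)" "j < dim_col (0\<^sub>m 2 r :: 'a mat)"
        then have pj: "p < 2" "j < r" by auto
        then have "h $$ (p, j) = g $$ (p, j)" using gh by (simp add: hcat_def)
        then show "g $$ (p, j) = 0\<^sub>m 2 r $$ (p, j)" using h pj by simp
      qed (use gh in auto)
      then show "h \<in> hcat (0\<^sub>m 2 r) ` carrier_mat 2 k" using gh by auto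
    next
      fix h :: "'a mat" assume "h \<in> hcat (0\<^sub>m 2 r) ` carrier_mat 2 k"
      then obtain h' where h': "h' \<in> carrier_mat 2 k" "h = hcat (0\<^sub>m 2 r) h'" by auto
      have "h \<in> carrier_mat 2 (r + k)" unfolding h'(2) by (rule hcat_carrier) (use h' in auto)
      moreover have "h $$ (p, j) = 0" if "p < 2" "j < r" for p j
        using that h' by (simp add: hcat_def)
      ultimately show "h \<in> {h \<in> carrier_mat 2 (r + k). \<forall>p<2. \<forall>j<r. h $$ (p, j) = 0}" by auto
    qed
  qed
  from bij_betw_same_card[OF this] show ?thesis by (simp add: card_carrier_mat)
qed

lemma two_ne_0: "(3::'a::field) = 0 \<Longrightarrow> (2::'a) \<noteq> 0"
proof
  assume "(3::'a) = 0" "(2::'a) = 0"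
  moreover have "(1::'a) = 3 - 2" by simp
  ultimately show False by simp
qed

lemma sum_three:
  fixes g :: "nat \<Rightarrow> 'b::comm_monoid_add"
  shows "(\<Sum>k<2 * m + 2. g k) = (\<Sum>k<m. g k) + ((\<Sum>k<m. g (m + k)) + (\<Sum>k<2. g (2 * m + k)))"
proof -
  have "(\<Sum>k<2 * m + 2. g k) = (\<Sum>k<2 * m + 2. g (bpos m (bidx m k) (bofs m k)))"
    by (intro sum.cong refl) (simp only: bpos_bofs lessThan_iff)
  also have "\<dots> = (\<Sum>k<m. g (bpos m 0 k)) + ((\<Sum>k<m. g (bpos m 1 k)) + (\<Sum>k<2. g (bpos m 2 k)))"
    by (rule sum_blocks)
  finally show ?thesis by (simp add: bpos_def)
qed

context
  fixes \<epsilon> :: "'a::{finite,field}"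
  assumes three: "(3::'a) = 0" and nonsq: "\<forall>b. b * b \<noteq> \<epsilon>"
begin

lemma card_Qgrp:
  "card (Qgrp (Suc m) \<epsilon>) = card (GL m :: 'a mat set) * ((CARD('a) + 1) * (CARD('a) ^ (2 * m) * CARD('a) ^ (\<Sum>i<m. i)))"
  using bij_betw_same_card[OF qpar_bij[OF three, of m \<epsilon>]]
  by (simp add: card_cartesian_product card_carrier_mat card_SOminus2[OF nonsq] card_skew[OF two_ne_0[OF three]])

lemma card_Qgrp_inter:
  "card {z \<in> Qgrp (Suc (r + k)) \<epsilon>. sigma_mat (Suc (r + k)) r * z * sigma_mat (Suc (r + k)) r \<in> Qgrp (Suc (r + k)) \<epsilon>} =
    card (lowGL r (r + k) :: 'a mat set) * ((CARD('a) + 1) * (CARD('a) ^ (2 * k) * CARD('a) ^ (\<Sum>i = r..<r + k. i)))"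
  (is "card ?I = _")
proof -
  let ?m = "r + k"
  let ?H = "{h \<in> carrier_mat 2 ?m. \<forall>p<2. \<forall>j<r. h $$ (p, j) = (0::'a)}"
  let ?K = "{K \<in> skew ?m. \<forall>a<r. \<forall>b<r. K $$ (a, b) = (0::'a)}"
  let ?P = "(GL ?m :: 'a mat set) \<times> SOminus2 \<epsilon> \<times> (carrier_mat 2 ?m :: 'a mat set) \<times> (skew ?m :: 'a mat set)"
  let ?L = "(lowGL r ?m :: 'a mat set) \<times> SOminus2 \<epsilon> \<times> ?H \<times> ?K"
  note bij = qpar_bij[OF three, of ?m \<epsilon>]
  have sub: "?L \<subseteq> ?P" by (auto simp: lowGL_def)
  have I: "?I = qpar ?m \<epsilon> ` ?L"
  proof (intro equalityI subsetI)
    fix z assume z: "z \<in> ?I"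
    then have "z \<in> qpar ?m \<epsilon> ` ?P" unfolding bij_betw_imp_surj_on[OF bij] by blast
    then obtain A i h K where p: "A \<in> GL ?m" "i \<in> SOminus2 \<epsilon>" "h \<in> carrier_mat 2 ?m" "K \<in> skew ?m" "z = qpar ?m \<epsilon> (A, i, h, K)"
      by auto
    then show "z \<in> qpar ?m \<epsilon> ` ?L"
      using z sigma_conj_Qgrp_iff[OF three p(1-4)] by (intro image_eqI[of _ _ "(A, i, h, K)"]) auto
  next
    fix z assume "z \<in> qpar ?m \<epsilon> ` ?L"
    then obtain A i h K where p: "A \<in> lowGL r ?m" "i \<in> SOminus2 \<epsilon>" "h \<in> ?H" "K \<in> ?K" "z = qpar ?m \<epsilon> (A, i, h, K)" by auto
    have p': "A \<in> GL ?m" "h \<in> carrier_mat 2 ?m" "K \<in> skew ?m" using p by (auto simp: lowGL_def)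
    have "z \<in> Qgrp (Suc ?m) \<epsilon>" using bij_betw_imp_surj_on[OF bij] p p' by blast
    then show "z \<in> ?I" using sigma_conj_Qgrp_iff[OF three p'(1) p(2) p'(2,3)] p by auto
  qed
  have "card ?I = card ?L"
    unfolding I by (rule card_image[OF inj_on_subset[OF bij_betw_imp_inj_on[OF bij] sub]])
  then show ?thesis
    by (simp add: card_cartesian_product card_left_cols_zero card_SOminus2[OF nonsq]
        card_skew_corner_zero[OF two_ne_0[OF three]])
qed

text \<open>Right multiplication by \<sigma> exchanges columns, so the first r diagonal entries are
  read off the upper middle block, the entries opposite to them from a zero block, and the remaining
  ones from A and its inverse. Thus h and the unipotent parameter enter only through
  \<open>A * B\<close>, and i not at all.\<close>

lemma mat_tr_rho_sigma:
  assumes A: "A \<in> GL m" and i: "i \<in> SOminus2 \<epsilon>" and h: "h \<in> carrier_mat 2 m"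
    and B: "B \<in> carrier_mat m m" and r: "r \<le> m"
  shows "mat_tr (rho_mat (Suc m) * qel m \<epsilon> A i h B * sigma_mat (Suc m) r) =
    (\<Sum>k<r. (A * B) $$ (k, k)) + (\<Sum>k = r..<m. A $$ (k, k) + minv A $$ (k, k))"
proof -
  let ?Y = "A * (- (transpose_mat h * delta_eps \<epsilon>))" and ?D = "transpose_mat (minv A)"
  let ?w = "rho_mat (Suc m) * qel m \<epsilon> A i h B"
  note uc = qel_ucar[OF A i h B]
  have ic: "i \<in> carrier_mat 2 2" using SOminus2D[OF i] by simp
  have w: "?w = upper9 m A (A * B) ?Y ?D (delta_eps 1 * (i * h)) (delta_eps 1 * i)"
    unfolding rho_mat_eq qel_def upper9_mult[OF rho_ucar uc] using ucarD[OF uc] by (simp add: dim_simps)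
  have wc: "?w \<in> carrier_mat (2 * m + 2) (2 * m + 2)" unfolding w by (rule b9_carrier)
  have Ai: "minv A \<in> carrier_mat m m" by (rule minv(1)[OF A])
  have "mat_tr (?w * sigma_mat (Suc m) r) = (\<Sum>k<2 * m + 2. ?w $$ (k, sw (Suc m) r k))"
  proof -
    have "dim_row (?w * sigma_mat (Suc m) r) = 2 * m + 2"
      using mult_carrier_mat[OF wc sigma_carrier] by (rule carrier_matD(1))
    then show ?thesis unfolding mat_tr_def using sigma_mult(2)[OF r wc] by (intro sum.cong) auto
  qed
  also have "\<dots> = (\<Sum>k<m. ?w $$ (k, sw (Suc m) r k)) + ((\<Sum>k<m. ?w $$ (m + k, sw (Suc m) r (m + k)))
      + (\<Sum>k<2. ?w $$ (2 * m + k, sw (Suc m) r (2 * m + k))))"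
    by (rule sum_three)
  also have "(\<Sum>k<m. ?w $$ (k, sw (Suc m) r k)) = (\<Sum>k<r. (A * B) $$ (k, k)) + (\<Sum>k = r..<m. A $$ (k, k))"
  proof -
    have "(\<Sum>k<m. ?w $$ (k, sw (Suc m) r k)) = (\<Sum>k = 0..<r. ?w $$ (k, sw (Suc m) r k)) + (\<Sum>k = r..<m. ?w $$ (k, sw (Suc m) r k))"
      using r by (simp add: sum.atLeastLessThan_concat lessThan_atLeast0)
    also have "(\<Sum>k = 0..<r. ?w $$ (k, sw (Suc m) r k)) = (\<Sum>k<r. (A * B) $$ (k, k))"
      unfolding lessThan_atLeast0 w by (intro sum.cong refl) (use r in \<open>simp add: sw_values b9_index(2)\<close>)
    also have "(\<Sum>k = r..<m. ?w $$ (k, sw (Suc m) r k)) = (\<Sum>k = r..<m. A $$ (k, k))"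
      unfolding w by (intro sum.cong refl) (simp add: sw_values b9_index(1))
    finally show ?thesis .
  qed
  also have "(\<Sum>k<m. ?w $$ (m + k, sw (Suc m) r (m + k))) = (\<Sum>k = r..<m. minv A $$ (k, k))"
  proof -
    have "(\<Sum>k<m. ?w $$ (m + k, sw (Suc m) r (m + k))) = (\<Sum>k = 0..<r. ?w $$ (m + k, sw (Suc m) r (m + k))) + (\<Sum>k = r..<m. ?w $$ (m + k, sw (Suc m) r (m + k)))"
      using r by (simp add: sum.atLeastLessThan_concat lessThan_atLeast0)
    also have "(\<Sum>k = 0..<r. ?w $$ (m + k, sw (Suc m) r (m + k))) = 0"
      unfolding w by (intro sum.neutral ballI) (use r in \<open>simp add: sw_values b9_index(4)\<close>)
    also have "(\<Sum>k = r..<m. ?w $$ (m + k, sw (Suc m) r (m + k))) = (\<Sum>k = r..<m. minv A $$ (k, k))"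
      unfolding w by (intro sum.cong refl) (use Ai in \<open>simp add: sw_values b9_index(5)\<close>)
    finally show ?thesis by simp
  qed
  \<comment> \<open>\<rho> negates the second row of i, and the diagonal entries of i are
    equal.\<close>
  also have "(\<Sum>k<2. ?w $$ (2 * m + k, sw (Suc m) r (2 * m + k))) = 0"
  proof -
    have "(\<Sum>k<2. ?w $$ (2 * m + k, sw (Suc m) r (2 * m + k))) = (\<Sum>k<2. (delta_eps 1 * i) $$ (k, k))"
      unfolding w sw_values(5)[OF r] by (intro sum.cong refl) (simp only: b9_index(9) lessThan_iff)
    also have "\<dots> = (delta_eps 1 * i) $$ (0, 0) + (delta_eps 1 * i) $$ (1, 1)" by (simp add: numeral_2_eq_2)
    also have "\<dots> = i $$ (0, 0) - i $$ (1, 1)"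
      using mult_mat_index[OF delta_eps_carrier ic, of 0 0] mult_mat_index[OF delta_eps_carrier ic, of 1 1]
      by (simp add: delta_eps_def numeral_2_eq_2)
    also have "\<dots> = 0" using i unfolding SOminus2_eq[OF nonsq] by auto
    finally show ?thesis .
  qed
  finally show ?thesis by (simp add: sum.distrib add_ac)
qed

end

section \<open>The character sum over the parabolic subgroup\<close>

context additive_character
begin

context
  fixes \<epsilon> :: 'a
  assumes three: "(3::'a) = 0" and nonsq: "\<forall>b. b * b \<noteq> \<epsilon>"
begin

text \<open>As the upper right block is zero, the first r diagonal entries involve only the first r
  columns of h. The other k columns are free and give q^(2k), and the scalar a is absorbed into the
  symmetric block, which leaves the Gauss sum \<open>tsum\<close>.\<close>

lemma sum_gram_low:
  assumes A: "A \<in> symGL r" and C: "C \<in> carrier_mat k r" and D: "D \<in> carrier_mat k k" and a: "a \<noteq> 0"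
  shows "(\<Sum>h\<in>carrier_mat 2 (r + k). \<psi> (a * (\<Sum>l<r. (four_block_mat A (0\<^sub>m r k) C D * gram \<epsilon> h) $$ (l, l)))) =
    of_nat CARD('a) ^ (2 * k) * (- of_nat CARD('a)) ^ r"
proof -
  have Ac: "A \<in> carrier_mat r r" using A by (simp add: symGL_def GL_def)
  let ?M = "four_block_mat A (0\<^sub>m r k) C D"
  have tr: "a * (\<Sum>l<r. (?M * gram \<epsilon> (hcat g h)) $$ (l, l)) = mat_tr ((a \<cdot>\<^sub>m A) * gram \<epsilon> g)"
    if gh: "g \<in> carrier_mat 2 r" "h \<in> carrier_mat 2 k" for g h
  proof -
    let ?X = "transpose_mat g * delta_eps \<epsilon> * h" and ?Y = "transpose_mat h * delta_eps \<epsilon> * g"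
    have X: "?X \<in> carrier_mat r k" "?Y \<in> carrier_mat k r"
      using gh by (auto intro!: mult_carrier_mat[of _ _ 2])
    note G = gram_carrier[OF gh(1), of \<epsilon>] gram_carrier[OF gh(2), of \<epsilon>]
    have "?M * gram \<epsilon> (hcat g h) = four_block_mat (A * gram \<epsilon> g + 0\<^sub>m r k * ?Y) (A * ?X + 0\<^sub>m r k * gram \<epsilon> h)
       (C * gram \<epsilon> g + D * ?Y) (C * ?X + D * gram \<epsilon> h)"
      unfolding gram_hcat[OF gh] using Ac C D X G by (intro mult_four_block_mat) auto
    also have "A * gram \<epsilon> g + 0\<^sub>m r k * ?Y = A * gram \<epsilon> g"
      using left_mult_zero_mat[OF X(2)] right_add_zero_mat[OF mult_carrier_mat[OF Ac G(1)]] by simp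
    finally have M: "?M * gram \<epsilon> (hcat g h) = four_block_mat (A * gram \<epsilon> g) (A * ?X + 0\<^sub>m r k * gram \<epsilon> h)
       (C * gram \<epsilon> g + D * ?Y) (C * ?X + D * gram \<epsilon> h)" .
    have AG: "A * gram \<epsilon> g \<in> carrier_mat r r" using Ac G by simp
    have "(?M * gram \<epsilon> (hcat g h)) $$ (l, l) = (A * gram \<epsilon> g) $$ (l, l)" if "l < r" for l
      unfolding M using that AG by (subst index_mat_four_block(1)) auto
    then have "(\<Sum>l<r. (?M * gram \<epsilon> (hcat g h)) $$ (l, l)) = (\<Sum>l<r. (A * gram \<epsilon> g) $$ (l, l))"
      by (intro sum.cong refl) auto
    moreover have "mat_tr ((a \<cdot>\<^sub>m A) * gram \<epsilon> g) = a * (\<Sum>l<r. (A * gram \<epsilon> g) $$ (l, l))"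
    proof -
      have "(a \<cdot>\<^sub>m A) * gram \<epsilon> g = a \<cdot>\<^sub>m (A * gram \<epsilon> g)" using Ac G by (intro mult_smult_assoc_mat) auto
      then have "mat_tr ((a \<cdot>\<^sub>m A) * gram \<epsilon> g) = (\<Sum>l<r. (a \<cdot>\<^sub>m (A * gram \<epsilon> g)) $$ (l, l))"
        using Ac by (simp add: mat_tr_def)
      also have "\<dots> = (\<Sum>l<r. a * (A * gram \<epsilon> g) $$ (l, l))"
        using AG by (intro sum.cong refl index_smult_mat(1)) auto
      finally show ?thesis by (simp add: sum_distrib_left)
    qed
    ultimately show ?thesis by simp
  qed
  have aA: "a \<cdot>\<^sub>m A \<in> symGL r"
    using A a by (auto simp: symGL_def GL_def transpose_smult)
  have "(\<Sum>h\<in>carrier_mat 2 (r + k). \<psi> (a * (\<Sum>l<r. (?M * gram \<epsilon> h) $$ (l, l)))) =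
      (\<Sum>(g, h)\<in>carrier_mat 2 r \<times> carrier_mat 2 k. \<psi> (a * (\<Sum>l<r. (?M * gram \<epsilon> (hcat g h)) $$ (l, l))))"
    by (subst sum.reindex_bij_betw[OF bij_betw_hcat, symmetric]) (simp only: case_prod_unfold)
  also have "\<dots> = (\<Sum>(g, h)\<in>carrier_mat 2 r \<times> (carrier_mat 2 k :: 'a mat set). \<psi> (mat_tr ((a \<cdot>\<^sub>m A) * gram \<epsilon> g)))"
    by (intro sum.cong refl) (auto simp: tr)
  also have "\<dots> = of_nat (card (carrier_mat 2 k :: 'a mat set)) * tsum \<epsilon> r (a \<cdot>\<^sub>m A)"
    unfolding tsum_def sum.cartesian_product[symmetric] by (simp add: sum_distrib_left)
  also have "\<dots> = of_nat CARD('a) ^ (2 * k) * (- of_nat CARD('a)) ^ r"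
    by (simp add: tsum_symGL[OF nonsq two_ne_0[OF three] aA] card_carrier_mat)
  finally show ?thesis .
qed

lemma lowGL_symmetric_bij:
  "bij_betw (\<lambda>(A, C, D). four_block_mat A (0\<^sub>m r k) C D) (symGL r \<times> carrier_mat k r \<times> GL k)
    {A \<in> GL (r + k). corner_symmetric r (r + k) (A :: 'a mat)}"
proof -
  let ?f = "\<lambda>(A, C, D). four_block_mat A (0\<^sub>m r k) C D :: 'a mat"
  have bij: "bij_betw ?f (GL r \<times> carrier_mat k r \<times> GL k) (lowGL r (r + k))" by (rule lowGL_bij)
  have iff: "corner_symmetric r (r + k) (?f (A, C, D)) \<longleftrightarrow> A \<in> symGL r"
    if "A \<in> GL r" "C \<in> carrier_mat k r" "D \<in> GL k" for A C D
  proof -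
    have c: "A \<in> carrier_mat r r" "D \<in> carrier_mat k k" using that GL_carrier by auto
    have "corner_symmetric r (r + k) (?f (A, C, D)) \<longleftrightarrow> (\<forall>i<r. \<forall>j<r. A $$ (i, j) = A $$ (j, i))"
      using c that by (auto simp: corner_symmetric_def)
    also have "\<dots> \<longleftrightarrow> transpose_mat A = A"
    proof
      assume "\<forall>i<r. \<forall>j<r. A $$ (i, j) = A $$ (j, i)"
      then show "transpose_mat A = A" using c by (intro eq_matI) auto
    next
      assume t: "transpose_mat A = A"
      show "\<forall>i<r. \<forall>j<r. A $$ (i, j) = A $$ (j, i)"
        using c t by (metis carrier_matD index_transpose_mat(1))
    qed
    finally show ?thesis using that by (simp add: symGL_def)
  qed
  have "{A \<in> GL (r + k). corner_symmetric r (r + k) (A :: 'a mat)} = {A \<in> lowGL r (r + k). corner_symmetric r (r + k) A}"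
    by (auto simp: lowGL_def corner_symmetric_def)
  also have "\<dots> = ?f ` (symGL r \<times> carrier_mat k r \<times> GL k)"
  proof (intro equalityI subsetI)
    fix M :: "'a mat" assume M: "M \<in> {A \<in> lowGL r (r + k). corner_symmetric r (r + k) A}"
    then obtain A C D where *: "A \<in> GL r" "C \<in> carrier_mat k r" "D \<in> GL k" "M = ?f (A, C, D)"
      using bij_betw_imp_surj_on[OF bij] by blast
    then show "M \<in> ?f ` (symGL r \<times> carrier_mat k r \<times> GL k)" using iff[OF *(1-3)] M by blast
  next
    fix M :: "'a mat" assume "M \<in> ?f ` (symGL r \<times> carrier_mat k r \<times> GL k)"
    then obtain A C D where *: "A \<in> symGL r" "C \<in> carrier_mat k r" "D \<in> GL k" "M = ?f (A, C, D)" by blast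
    have A: "A \<in> GL r" using * by (simp add: symGL_def)
    have "M \<in> lowGL r (r + k)" using bij_betw_imp_surj_on[OF bij] A * by blast
    then show "M \<in> {A \<in> lowGL r (r + k). corner_symmetric r (r + k) A}" using iff[OF A *(2,3)] * by simp
  qed
  finally show ?thesis
    using inj_on_subset[OF bij_betw_imp_inj_on[OF bij], of "symGL r \<times> carrier_mat k r \<times> GL k"]
    by (auto simp: bij_betw_def symGL_def)
qed

text \<open>The factors have separate origins: q + 1 from i, the power with the triangular exponent
  from K, the number of symmetric corners from A, q^(k r) from the free lower left block, the Gauss
  sum from h, and the sum over GL(k, q) from the lower right block of the Levi factor.\<close>

lemma sum_Qgrp_rho_sigma:
  assumes a: "a \<noteq> 0"
  shows "(\<Sum>z\<in>Qgrp (Suc (r + k)) \<epsilon>. \<psi> (a * mat_tr (rho_mat (Suc (r + k)) * z * sigma_mat (Suc (r + k)) r))) =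
    of_nat (CARD('a) + 1) * of_nat CARD('a) ^ (\<Sum>i<r + k. i) * (of_nat (card (symGL r :: 'a mat set)) * of_nat CARD('a) ^ (k * r)
      * (of_nat CARD('a) ^ (2 * k) * (- of_nat CARD('a)) ^ r) * (\<Sum>D\<in>GL k. \<psi> (a * (mat_tr D + mat_tr (minv D)))))"
proof -
  define m where "m = r + k"
  have r: "r \<le> m" by (simp add: m_def)
  let ?q = "of_nat CARD('a) :: complex"
  let ?S = "of_nat (card (skew m :: 'a mat set)) :: complex"
  define c where "c A = (\<Sum>l = r..<m. A $$ (l, l) + minv A $$ (l, l))" for A :: "'a mat"
  define H where "H A = (\<Sum>h\<in>carrier_mat 2 m. \<psi> (a * (\<Sum>l<r. (A * gram \<epsilon> h) $$ (l, l))))" for A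
  have two: "(2::'a) \<noteq> 0" by (rule two_ne_0[OF three])
  have "(\<Sum>z\<in>Qgrp (Suc m) \<epsilon>. \<psi> (a * mat_tr (rho_mat (Suc m) * z * sigma_mat (Suc m) r))) =
      (\<Sum>p\<in>GL m \<times> SOminus2 \<epsilon> \<times> carrier_mat 2 m \<times> skew m. \<psi> (a * mat_tr (rho_mat (Suc m) * qpar m \<epsilon> p * sigma_mat (Suc m) r)))"
    by (rule sum.reindex_bij_betw[OF qpar_bij[OF three], symmetric])
  also have "\<dots> = (\<Sum>(A, i, h, K)\<in>GL m \<times> SOminus2 \<epsilon> \<times> carrier_mat 2 m \<times> skew m.
      \<psi> (a * c A) * (\<psi> (a * (\<Sum>l<r. (A * gram \<epsilon> h) $$ (l, l))) * \<psi> (a * (\<Sum>l<r. (A * K) $$ (l, l)))))"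
  proof (rule sum.cong[OF refl], clarify)
    fix A i h K :: "'a mat" assume *: "A \<in> GL m" "i \<in> SOminus2 \<epsilon>" "h \<in> carrier_mat 2 m" "K \<in> skew m"
    note G = gram_carrier[OF *(3), of \<epsilon>]
    have Kc: "K \<in> carrier_mat m m" using * by (simp add: skew_def)
    note Ac = GL_carrier[OF *(1)]
    have E: "A * (gram \<epsilon> h + K) = A * gram \<epsilon> h + A * K" by (rule mult_add_distrib_mat[OF Ac G Kc])
    have "(\<Sum>l<r. (A * (gram \<epsilon> h + K)) $$ (l, l)) = (\<Sum>l<r. (A * gram \<epsilon> h) $$ (l, l)) + (\<Sum>l<r. (A * K) $$ (l, l))"
      unfolding E sum.distrib[symmetric] using r Ac Kc by (intro sum.cong refl, subst index_add_mat(1)) auto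
    moreover have "mat_tr (rho_mat (Suc m) * qpar m \<epsilon> (A, i, h, K) * sigma_mat (Suc m) r) =
        (\<Sum>l<r. (A * (gram \<epsilon> h + K)) $$ (l, l)) + c A"
      unfolding qpar_def prod.case c_def using G Kc by (intro mat_tr_rho_sigma[OF three nonsq *(1-3) _ r]) auto
    ultimately have "a * mat_tr (rho_mat (Suc m) * qpar m \<epsilon> (A, i, h, K) * sigma_mat (Suc m) r) =
        a * c A + (a * (\<Sum>l<r. (A * gram \<epsilon> h) $$ (l, l)) + a * (\<Sum>l<r. (A * K) $$ (l, l)))"
      by (simp only: distrib_left add_ac)
    then show "\<psi> (a * mat_tr (rho_mat (Suc m) * qpar m \<epsilon> (A, i, h, K) * sigma_mat (Suc m) r)) =
      \<psi> (a * c A) * (\<psi> (a * (\<Sum>l<r. (A * gram \<epsilon> h) $$ (l, l))) * \<psi> (a * (\<Sum>l<r. (A * K) $$ (l, l))))"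
      by (simp only: add)
  qed
  also have "\<dots> = (\<Sum>A\<in>GL m. \<Sum>i\<in>SOminus2 \<epsilon>. \<Sum>h\<in>carrier_mat 2 m. \<Sum>K\<in>skew m.
      \<psi> (a * c A) * (\<psi> (a * (\<Sum>l<r. (A * gram \<epsilon> h) $$ (l, l))) * \<psi> (a * (\<Sum>l<r. (A * K) $$ (l, l)))))"
    by (simp only: sum.cartesian_product[symmetric])
  also have "\<dots> = (\<Sum>A\<in>GL m. of_nat (CARD('a) + 1) * (\<psi> (a * c A) * (H A * (\<Sum>K\<in>skew m. \<psi> (a * (\<Sum>l<r. (A * K) $$ (l, l)))))))"
    unfolding H_def sum_product by (simp add: card_SOminus2[OF nonsq] sum_distrib_left)
  also have "\<dots> = (\<Sum>A\<in>GL m. if corner_symmetric r m A then of_nat (CARD('a) + 1) * ?S * (\<psi> (a * c A) * H A) else 0)"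
    by (intro sum.cong refl) (simp add: sum_skew[OF two a r GL_carrier])
  also have "\<dots> = (\<Sum>A\<in>{A \<in> GL m. corner_symmetric r m A}. of_nat (CARD('a) + 1) * ?S * (\<psi> (a * c A) * H A))"
    by (rule sum.inter_filter[symmetric]) simp
  also have "\<dots> = (\<Sum>p\<in>symGL r \<times> carrier_mat k r \<times> GL k. of_nat (CARD('a) + 1) * ?S *
      (\<psi> (a * c ((\<lambda>(A, C, D). four_block_mat A (0\<^sub>m r k) C D) p)) * H ((\<lambda>(A, C, D). four_block_mat A (0\<^sub>m r k) C D) p)))"
    unfolding m_def by (rule sum.reindex_bij_betw[OF lowGL_symmetric_bij, symmetric])
  also have "\<dots> = (\<Sum>(A, C, D)\<in>(symGL r :: 'a mat set) \<times> (carrier_mat k r :: 'a mat set) \<times> GL k. of_nat (CARD('a) + 1) * ?S *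
      (\<psi> (a * (mat_tr D + mat_tr (minv D))) * (?q ^ (2 * k) * (- ?q) ^ r)))"
  proof (rule sum.cong[OF refl], clarify)
    fix A C D :: "'a mat" assume *: "A \<in> symGL r" "C \<in> carrier_mat k r" "D \<in> GL k"
    have A: "A \<in> GL r" using * by (simp add: symGL_def)
    note Ac = GL_carrier[OF A] and Dc = GL_carrier[OF *(3)] and iA = minv(1)[OF A] and iD = minv(1)[OF *(3)]
    have "c (four_block_mat A (0\<^sub>m r k) C D) = (\<Sum>l = 0 + r..<k + r. D $$ (l - r, l - r) + minv D $$ (l - r, l - r))"
      unfolding c_def minv_low_block[OF A *(2,3)] m_def using Ac Dc iA iD
      by (intro sum.cong) auto
    also have "\<dots> = mat_tr D + mat_tr (minv D)"
      unfolding sum.shift_bounds_nat_ivl using Dc iD by (simp add: mat_tr_def sum.distrib lessThan_atLeast0)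
    finally have "c (four_block_mat A (0\<^sub>m r k) C D) = mat_tr D + mat_tr (minv D)" .
    moreover have "H (four_block_mat A (0\<^sub>m r k) C D) = ?q ^ (2 * k) * (- ?q) ^ r"
      unfolding H_def m_def by (rule sum_gram_low[OF *(1,2) Dc a])
    ultimately show "of_nat (CARD('a) + 1) * ?S * (\<psi> (a * c (four_block_mat A (0\<^sub>m r k) C D)) * H (four_block_mat A (0\<^sub>m r k) C D)) =
      of_nat (CARD('a) + 1) * ?S * (\<psi> (a * (mat_tr D + mat_tr (minv D))) * (?q ^ (2 * k) * (- ?q) ^ r))" by simp
  qed
  also have "\<dots> = of_nat (CARD('a) + 1) * ?S * (of_nat (card (symGL r :: 'a mat set)) * ?q ^ (k * r)
      * (?q ^ (2 * k) * (- ?q) ^ r) * (\<Sum>D\<in>GL k. \<psi> (a * (mat_tr D + mat_tr (minv D)))))"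
    unfolding sum.cartesian_product[symmetric]
    by (simp add: sum_distrib_left[symmetric] sum_distrib_right[symmetric] card_carrier_mat mult_ac)
  finally show ?thesis unfolding m_def by (simp add: card_skew[OF two])
qed

end

end

subsection \<open>Sums over the double coset\<close>

lemma Qgrp_GL: "Qgrp (Suc m) \<epsilon> \<subseteq> GL (2 * m + 2)" if "\<epsilon> \<noteq> (0 :: 'a::field)"
proof
  fix w assume w: "w \<in> Qgrp (Suc m) \<epsilon>"
  have "det (Jmat (Suc m) \<epsilon>) \<noteq> 0"
  proof -
    let ?J = "Jmat (Suc m) \<epsilon>" and ?J' = "Jmat (Suc m) (inverse \<epsilon>)"
    \<comment> \<open>The inverse of J has the same shape: the swap is an involution and \<epsilon>
      is replaced by its inverse.\<close>
    have "?J * ?J' = 1\<^sub>m (2 * m + 2)"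
    proof (rule eq_matI)
      fix i j assume "i < dim_row (1\<^sub>m (2 * m + 2) :: 'a mat)" "j < dim_col (1\<^sub>m (2 * m + 2) :: 'a mat)"
      then have ij: "i < 2 * m + 2" "j < 2 * m + 2" by auto
      let ?t = "sw (Suc m) m"
      note t = sw_props[OF order_refl ij(1)]
      have "(?J * ?J') $$ (i, j) = (\<Sum>k = 0..<2 * m + 2. ?J $$ (i, k) * ?J' $$ (k, j))"
        by (rule mult_mat_index[OF Jmat_carrier Jmat_carrier ij])
      also have "\<dots> = (\<Sum>k = 0..<2 * m + 2. if k = ?t i then (if i \<le> 2 * m then 1 else - \<epsilon>) * ?J' $$ (?t i, j) else 0)"
        by (intro sum.cong refl) (use ij in \<open>auto simp: Jmat_index\<close>)
      also have "\<dots> = (if i \<le> 2 * m then 1 else - \<epsilon>) * ?J' $$ (?t i, j)"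
        using t(1) by simp
      also have "\<dots> = 1\<^sub>m (2 * m + 2) $$ (i, j)"
      proof -
        have "?t i \<le> 2 * m \<longleftrightarrow> i \<le> 2 * m" by (auto simp: sw_def)
        then show ?thesis unfolding Jmat_index[OF t(1) ij(2)] t(2) using that ij by auto
      qed
      finally show "(?J * ?J') $$ (i, j) = 1\<^sub>m (2 * m + 2) $$ (i, j)" .
    qed (use Jmat_carrier[of m \<epsilon>] Jmat_carrier[of m "inverse \<epsilon>"] in auto)
    from GL_I(1)[OF Jmat_carrier Jmat_carrier this] show ?thesis by (simp add: GL_def)
  qed
  then show "w \<in> GL (2 * m + 2)" by (rule isom_GL[OF Qgrp_isom[OF w] Jmat_carrier])
qed

text \<open>With n = Suc (r + 2) the truncated differences n - 1 and n - 3 become r + 2 and r. Left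
  multiplication by the involution \<rho> identifies \<open>DC4\<close> with a genuine double
  coset.\<close>

lemma DC4_sum:
  fixes f :: "'a::{finite,field} mat \<Rightarrow> complex"
  assumes e: "\<epsilon> \<noteq> 0"
  shows "of_nat (card {z \<in> Qgrp (Suc (r + 2)) \<epsilon>. sigma_mat (Suc (r + 2)) r * z * sigma_mat (Suc (r + 2)) r \<in> Qgrp (Suc (r + 2)) \<epsilon>}) *
      (\<Sum>w\<in>DC4 (Suc (r + 2)) \<epsilon>. f w) =
    (\<Sum>x\<in>Qgrp (Suc (r + 2)) \<epsilon>. \<Sum>y\<in>Qgrp (Suc (r + 2)) \<epsilon>. f (rho_mat (Suc (r + 2)) * (x * sigma_mat (Suc (r + 2)) r * y)))"
proof -
  define m where "m = r + 2"
  have r: "r \<le> m" by (simp add: m_def)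
  let ?Q = "Qgrp (Suc m) \<epsilon>" and ?s = "sigma_mat (Suc m) r :: 'a mat" and ?r = "rho_mat (Suc m) :: 'a mat"
  let ?N = "2 * m + 2"
  define V where "V = {x * ?s * y | x y. x \<in> ?Q \<and> y \<in> ?Q}"
  have Vc: "v \<in> carrier_mat ?N ?N" if "v \<in> V" for v
  proof -
    from that obtain x y where *: "x \<in> ?Q" "y \<in> ?Q" "v = x * ?s * y" unfolding V_def by blast
    show ?thesis unfolding *(3)
      by (rule mult_carrier_mat[OF mult_carrier_mat[OF Qgrp_carrier[OF *(1)] sigma_carrier] Qgrp_carrier[OF *(2)]])
  qed
  have assoc: "?r * x * ?s * y = ?r * (x * ?s * y)" if "x \<in> ?Q" "y \<in> ?Q" for x y
  proof -
    note c = Qgrp_carrier[OF that(1)] Qgrp_carrier[OF that(2)]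
    have "?r * x * ?s * y = ?r * (x * ?s) * y"
      using assoc_mult_mat[OF rho_carrier c(1) sigma_carrier] by simp
    also have "\<dots> = ?r * (x * ?s * y)"
      by (rule assoc_mult_mat[OF rho_carrier mult_carrier_mat[OF c(1) sigma_carrier] c(2)])
    finally show ?thesis .
  qed
  have DC: "DC4 (Suc m) \<epsilon> = (*) ?r ` V"
  proof -
    have "Suc m - 3 = r" by (simp add: m_def)
    then have "DC4 (Suc m) \<epsilon> = {?r * x * ?s * y | x y. x \<in> ?Q \<and> y \<in> ?Q}" by (simp add: DC4_def)
    then show ?thesis unfolding V_def using assoc by (auto simp: image_iff) metis+
  qed
  have rr: "?r * (?r * v) = v" if "v \<in> V" for v
    using assoc_mult_mat[OF rho_carrier rho_carrier Vc[OF that]] left_mult_one_mat[OF Vc[OF that]] by (simp add: rho_square)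
  have inj: "inj_on ((*) ?r) V" by (rule inj_on_inverseI[of _ "(*) ?r"]) (rule rr)
  have "(\<Sum>w\<in>DC4 (Suc m) \<epsilon>. f w) = (\<Sum>v\<in>V. f (?r * v))"
    unfolding DC by (simp add: sum.reindex[OF inj])
  moreover have "of_nat (card {z \<in> ?Q. ?s * z * ?s \<in> ?Q}) * (\<Sum>v\<in>V. f (?r * v)) = (\<Sum>x\<in>?Q. \<Sum>y\<in>?Q. f (?r * (x * ?s * y)))"
    unfolding V_def
    by (rule double_coset_sum[OF Qgrp_GL[OF e] Qgrp_mult one_Qgrp sigma_carrier sigma_square[OF r]])
  ultimately show ?thesis unfolding m_def by simp
qed

lemma card_DC4:
  assumes e: "\<epsilon> \<noteq> (0::'a::{finite,field})"
  shows "card {z \<in> Qgrp (Suc (r + 2)) \<epsilon>. sigma_mat (Suc (r + 2)) r * z * sigma_mat (Suc (r + 2)) r \<in> Qgrp (Suc (r + 2)) \<epsilon>} *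
      card (DC4 (Suc (r + 2)) \<epsilon>) = card (Qgrp (Suc (r + 2)) \<epsilon>) * card (Qgrp (Suc (r + 2)) \<epsilon>)"
proof -
  have "(of_nat (card {z \<in> Qgrp (Suc (r + 2)) \<epsilon>. sigma_mat (Suc (r + 2)) r * z * sigma_mat (Suc (r + 2)) r \<in> Qgrp (Suc (r + 2)) \<epsilon>} *
      card (DC4 (Suc (r + 2)) \<epsilon>)) :: complex) = of_nat (card (Qgrp (Suc (r + 2)) \<epsilon>) * card (Qgrp (Suc (r + 2)) \<epsilon>))"
    using DC4_sum[OF e, of r "\<lambda>_. 1"] by simp
  then show ?thesis by (simp only: of_nat_eq_iff)
qed

text \<open>By cyclicity of the trace, Tr(\<rho>x\<sigma>y) = Tr(\<rho>(\<rho>y\<rho>x)\<sigma>).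
  For fixed y the factor \<rho>y\<rho> lies in Q, so it only permutes the values of x, and the
  double sum becomes |Q| equal sums.\<close>

lemma (in additive_character) DC4_character_sum:
  assumes e: "\<epsilon> \<noteq> 0"
  shows "of_nat (card {z \<in> Qgrp (Suc (r + 2)) \<epsilon>. sigma_mat (Suc (r + 2)) r * z * sigma_mat (Suc (r + 2)) r \<in> Qgrp (Suc (r + 2)) \<epsilon>}) *
      (\<Sum>w\<in>DC4 (Suc (r + 2)) \<epsilon>. \<psi> (a * mat_tr w)) =
    of_nat (card (Qgrp (Suc (r + 2)) \<epsilon>)) *
      (\<Sum>z\<in>Qgrp (Suc (r + 2)) \<epsilon>. \<psi> (a * mat_tr (rho_mat (Suc (r + 2)) * z * sigma_mat (Suc (r + 2)) r)))"
proof -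
  define m where "m = r + 2"
  have r: "r \<le> m" by (simp add: m_def)
  let ?Q = "Qgrp (Suc m) \<epsilon>" and ?s = "sigma_mat (Suc m) r :: 'a mat" and ?r = "rho_mat (Suc m) :: 'a mat"
  let ?N = "2 * m + 2"
  note as = assoc_mult_mat[of _ ?N ?N _ ?N _ ?N]
  have fin: "finite ?Q" using Qgrp_GL[OF e] finite_subset finite_GL by blast
  have tr: "mat_tr (?r * (x * ?s * y)) = mat_tr (?r * ((?r * y * ?r) * x) * ?s)" if "x \<in> ?Q" "y \<in> ?Q" for x y
  proof -
    note c = Qgrp_carrier[OF that(1)] Qgrp_carrier[OF that(2)] rho_carrier[of m, where 'a='a] sigma_carrier[of m r, where 'a='a]
    note p = mult_carrier_mat[of _ ?N ?N _ ?N]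
    have "?r * (x * ?s * y) = (?r * x * ?s) * y" using c p by (simp add: as del: rho_carrier sigma_carrier)
    then have "mat_tr (?r * (x * ?s * y)) = mat_tr (y * (?r * x * ?s))"
      using mat_tr_mult_commute[OF p[OF p[OF c(3,1)] c(4)] c(2)] by simp
    also have "y * (?r * x * ?s) = (?r * ?r) * (y * (?r * x * ?s))"
      unfolding rho_square by (rule left_mult_one_mat[symmetric, OF p[OF c(2) p[OF p[OF c(3,1)] c(4)]]])
    also have "\<dots> = ?r * ((?r * y * ?r) * x) * ?s" using c p by (simp add: as del: rho_carrier sigma_carrier)
    finally show ?thesis .
  qed
  have bij: "bij_betw ((*) v) ?Q ?Q" if v: "v \<in> ?Q" for v
  proof -
    have "v \<in> GL ?N" using Qgrp_GL[OF e] v by blast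
    then have "inj_on ((*) v) ?Q"
      by (intro inj_on_inverseI[of _ "(*) (minv v)"]) (rule minv_mult_cancel(1)[OF _ Qgrp_carrier])
    moreover have "(*) v ` ?Q \<subseteq> ?Q" using Qgrp_mult v by auto
    ultimately show ?thesis unfolding bij_betw_def using endo_inj_surj[OF fin] by blast
  qed
  let ?F = "\<Sum>z\<in>?Q. \<psi> (a * mat_tr (?r * z * ?s))"
  have "(\<Sum>x\<in>?Q. \<Sum>y\<in>?Q. \<psi> (a * mat_tr (?r * (x * ?s * y)))) = (\<Sum>y\<in>?Q. \<Sum>x\<in>?Q. \<psi> (a * mat_tr (?r * ((?r * y * ?r) * x) * ?s)))"
    by (subst sum.swap, intro sum.cong refl) (simp only: tr)
  also have "\<dots> = (\<Sum>y\<in>?Q. ?F)"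
  proof (rule sum.cong[OF refl])
    fix y assume "y \<in> ?Q"
    then have "?r * y * ?r \<in> ?Q" by (rule rho_conj_Qgrp)
    from sum.reindex_bij_betw[OF bij[OF this], of "\<lambda>z. \<psi> (a * mat_tr (?r * z * ?s))"]
    show "(\<Sum>x\<in>?Q. \<psi> (a * mat_tr (?r * ((?r * y * ?r) * x) * ?s))) = ?F" .
  qed
  finally have "(\<Sum>x\<in>?Q. \<Sum>y\<in>?Q. \<psi> (a * mat_tr (?r * (x * ?s * y)))) = of_nat (card ?Q) * ?F" by simp
  then show ?thesis using DC4_sum[OF e, of r "\<lambda>w. \<psi> (a * mat_tr w)"] unfolding m_def by simp
qed

subsection \<open>Closed forms\<close>

lemma card_GL_0: "card (GL 0 :: 'a::field mat set) = 1"
proof -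
  have "GL 0 = {1\<^sub>m 0 :: 'a mat}" by (auto simp: GL_def intro!: eq_matI)
  then show ?thesis by simp
qed

lemma card_field_ge_2: "2 \<le> CARD('a::{finite,field})"
proof -
  have "card {0::'a, 1} \<le> CARD('a)" by (intro card_mono) auto
  then show ?thesis by simp
qed

lemma of_nat_minus_1_power: "real (CARD('a::{finite,field}) ^ m - 1) = real CARD('a) ^ m - 1"
  by (subst of_nat_diff) auto

text \<open>The closed forms follow from the two recursions alone; \<open>gl\<close> and
  \<open>sy\<close> stand for the numbers of invertible and of invertible symmetric
  matrices.\<close>

context
  fixes q :: real and gl sy :: "nat \<Rightarrow> real"
  assumes q1: "q > 1"
    and gl0: "gl 0 = 1" and glS: "\<And>m. gl (Suc m) = (q ^ Suc m - 1) * q ^ m * gl m"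
    and sy0: "sy 0 = 1" and syS: "\<And>m. sy (Suc m) = (q - 1) * q ^ m * sy m + (q ^ m - 1) * q ^ m * sy (m - 1)"
begin

text \<open>Even and odd sizes are treated together because the recursion reaches back two
  steps.\<close>

lemma sy_closed:
  "sy (2 * l) = q ^ (l * (l + 1)) * (\<Prod>j = 1..l. q ^ (2 * j - 1) - 1) \<and>
   sy (2 * l + 1) = q ^ (l * (l + 1)) * (\<Prod>j = 1..Suc l. q ^ (2 * j - 1) - 1)"
proof (induction l)
  case 0
  show ?case using sy0 syS[of 0] by simp
next
  case (Suc l)
  let ?P = "\<Prod>j = 1..Suc l. q ^ (2 * j - 1) - 1" and ?p = "\<Prod>j = 1..l. q ^ (2 * j - 1) - 1"
  have P: "?P = ?p * (q ^ (2 * l + 1) - 1)" by (simp add: prod.nat_ivl_Suc')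
  have P': "(\<Prod>j = 1..Suc (Suc l). q ^ (2 * j - 1) - 1) = ?P * (q ^ (2 * l + 3) - 1)"
    by (simp add: prod.nat_ivl_Suc' numeral_3_eq_3 mult.commute)
  have e: "sy (2 * Suc l) = q ^ (Suc l * (Suc l + 1)) * ?P"
  proof -
    have "sy (2 * Suc l) = (q - 1) * q ^ (2 * l + 1) * sy (2 * l + 1) + (q ^ (2 * l + 1) - 1) * q ^ (2 * l + 1) * sy (2 * l)"
      using syS[of "2 * l + 1"] by simp
    also have "\<dots> = q ^ (2 * l + 1) * q ^ (l * (l + 1)) * ((q - 1) * ?P + (q ^ (2 * l + 1) - 1) * ?p)"
    proof -
      have "(q - 1) * Y * (X * P) + (Z - 1) * Y * (X * p) = Y * X * ((q - 1) * P + (Z - 1) * p)" for X Y Z P p :: real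
        by (simp add: algebra_simps)
      then show ?thesis unfolding conjunct1[OF Suc] conjunct2[OF Suc] .
    qed
    \<comment> \<open>The second summand is again \<open>?P\<close>, so the bracket collapses to one
      product.\<close>
    also have "(q - 1) * ?P + (q ^ (2 * l + 1) - 1) * ?p = q * ?P" unfolding P by (simp add: algebra_simps)
    also have "q ^ (2 * l + 1) * q ^ (l * (l + 1)) * (q * ?P) = q ^ (2 * l + 1 + l * (l + 1) + 1) * ?P"
      by (simp only: power_add power_one_right mult_ac)
    also have "2 * l + 1 + l * (l + 1) + 1 = Suc l * (Suc l + 1)" by simp
    finally show ?thesis .
  qed
  have "sy (2 * Suc l + 1) = q ^ (Suc l * (Suc l + 1)) * (\<Prod>j = 1..Suc (Suc l). q ^ (2 * j - 1) - 1)"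
  proof -
    have "sy (2 * Suc l + 1) = (q - 1) * q ^ (2 * l + 2) * sy (2 * Suc l) + (q ^ (2 * l + 2) - 1) * q ^ (2 * l + 2) * sy (2 * l + 1)"
      using syS[of "2 * Suc l"] by simp
    also have "\<dots> = (q - 1) * q ^ (2 * l + 2) * (q ^ (2 * l + 2) * q ^ (l * (l + 1)) * ?P) + (q ^ (2 * l + 2) - 1) * q ^ (2 * l + 2) * (q ^ (l * (l + 1)) * ?P)"
    proof -
      have "Suc l * (Suc l + 1) = (2 * l + 2) + l * (l + 1)" by simp
      then show ?thesis unfolding e using Suc by (simp only: power_add)
    qed
    also have "\<dots> = q ^ (2 * l + 2) * q ^ (l * (l + 1)) * ?P * (q * q ^ (2 * l + 2) - 1)"
      by (simp add: algebra_simps)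
    also have "q * q ^ (2 * l + 2) = q ^ (2 * l + 3)" by (simp add: numeral_3_eq_3)
    also have "q ^ (2 * l + 2) * q ^ (l * (l + 1)) = q ^ (Suc l * (Suc l + 1))"
      unfolding power_add[symmetric] by (rule arg_cong[of _ _ "power q"]) simp
    finally show ?thesis unfolding P' by (simp only: mult_ac)
  qed
  then show ?case using e by blast
qed

lemma gl_closed: "gl m = q ^ (\<Sum>i<m. i) * (\<Prod>j = 1..m. q ^ j - 1)"
proof (induction m)
  case (Suc m)
  show ?case unfolding glS Suc by (simp add: power_add prod.nat_ivl_Suc' algebra_simps)
qed (simp add: gl0)

lemma gl_pos: "gl m > 0"
proof (induction m)
  case (Suc m)
  have "1 < q ^ Suc m" using q1 by (rule one_less_power) simp
  then show ?case unfolding glS using q1 Suc by simp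
qed (simp add: gl0)

lemma sum_upto: "(\<Sum>i<2 * l. i) + l = 2 * l * l" for l :: nat
  by (induction l) auto

lemma prod_split: "(\<Prod>j = 1..l. q ^ (2 * j - 1) - 1) * (\<Prod>j = 1..l. q ^ (2 * j) - 1) = (\<Prod>j = 1..2 * l. q ^ j - 1)"
  by (induction l) (auto simp: prod.nat_ivl_Suc' algebra_simps)

text \<open>The constant B in terms of r = n - 3: even r is the minus case and odd r the plus case,
  as \<open>Bconst_B4\<close> confirms.\<close>

definition Bconst :: "nat \<Rightarrow> real" where
  "Bconst r = (if even r then q ^ ((r div 2) ^ 2) * (q ^ (r + 1) - 1) * (q ^ (r + 2) - 1) * (\<Prod>j = 1..r div 2. q ^ (2 * j) - 1)
    else q ^ ((r div 2 + 1) ^ 2) * (q ^ (r + 2) - 1) * (\<Prod>j = 1..r div 2 + 1. q ^ (2 * j) - 1))"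

text \<open>The closed form of \<open>sy r\<close> supplies the factors q^j - 1 of
  \<open>gl (r + 2)\<close> with j odd and j \<le> r. \<open>Bconst\<close> supplies all the others,
  that is the even ones and the odd one beyond r.\<close>

lemma gl_eq_Bconst: "q ^ (r + 1) * sy r * Bconst r = gl (r + 2)"
proof (cases "even r")
  case True
  then obtain l where r: "r = 2 * l" by auto
  let ?o = "\<Prod>j = 1..l. q ^ (2 * j - 1) - 1" and ?e = "\<Prod>j = 1..l. q ^ (2 * j) - 1"
  have "q ^ (r + 1) * sy r * Bconst r = q ^ (2 * l + 1 + l * (l + 1) + l ^ 2) * ((?o * ?e) * (q ^ (2 * l + 1) - 1) * (q ^ (2 * l + 2) - 1))"
    using sy_closed[of l] by (simp only: Bconst_def r power_add mult_ac) simp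
  also have "?o * ?e * (q ^ (2 * l + 1) - 1) * (q ^ (2 * l + 2) - 1) = (\<Prod>j = 1..r + 2. q ^ j - 1)"
    unfolding prod_split r by (simp add: prod.nat_ivl_Suc' mult_ac)
  also have "2 * l + 1 + l * (l + 1) + l ^ 2 = (\<Sum>i<r + 2. i)"
    using sum_upto[of l] by (simp add: r power2_eq_square algebra_simps)
  finally show ?thesis unfolding gl_closed .
next
  case False
  then obtain l where r: "r = 2 * l + 1" by (elim oddE)
  let ?o = "\<Prod>j = 1..Suc l. q ^ (2 * j - 1) - 1" and ?e = "\<Prod>j = 1..Suc l. q ^ (2 * j) - 1"
  have d: "r div 2 = l" by (simp add: r)
  have "q ^ (r + 1) * sy r * Bconst r = q ^ (2 * l + 2 + l * (l + 1) + (l + 1) ^ 2) * ((?o * ?e) * (q ^ (2 * l + 3) - 1))"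
  proof -
    have "Bconst r = q ^ ((l + 1) ^ 2) * (q ^ (2 * l + 3) - 1) * ?e"
      using False unfolding Bconst_def d by (simp add: r numeral_3_eq_3)
    moreover have "sy r = q ^ (l * (l + 1)) * ?o" using sy_closed[of l] r by simp
    moreover have "r + 1 = 2 * l + 2" by (simp add: r)
    ultimately show ?thesis by (simp only: power_add mult_ac)
  qed
  also have "?o * ?e * (q ^ (2 * l + 3) - 1) = (\<Prod>j = 1..r + 2. q ^ j - 1)"
  proof -
    have e: "2 * l + 3 = Suc (2 * Suc l)" "r + 2 = Suc (2 * Suc l)" by (simp_all add: r)
    show ?thesis unfolding prod_split e by (subst prod.nat_ivl_Suc', simp, rule mult.commute)
  qed
  also have "2 * l + 2 + l * (l + 1) + (l + 1) ^ 2 = (\<Sum>i<r + 2. i)"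
    using sum_upto[of l] by (simp add: r power2_eq_square algebra_simps)
  finally show ?thesis unfolding gl_closed .
qed

text \<open>The Gaussian binomial is the index in GL(r + 2, q) of the block lower triangular group,
  whose order is the last factor.\<close>

lemma gl_gauss:
  "gl (r + 2) = ((q ^ (r + 2) - 1) * (q ^ (r + 1) - 1)) / ((q ^ 2 - 1) * (q - 1)) * (gl r * gl 2 * q ^ (2 * r))"
proof -
  have g2: "gl 2 = (q ^ 2 - 1) * q * (q - 1)" using glS[of 1] glS[of 0] gl0 by (simp add: numeral_2_eq_2)
  have "1 < q ^ 2" by (rule one_less_power[OF q1]) simp
  then have ne: "q ^ 2 - 1 \<noteq> 0" "q - 1 \<noteq> 0" using q1 by linarith+
  have canc: "u * v / (d * e) * (g * (d * q * e) * z) = u * v * g * (q * z)"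
    if "d \<noteq> 0" "e \<noteq> 0" for u v d e g z :: real
    using that by simp
  have "gl (r + 2) = (q ^ (r + 2) - 1) * q ^ (r + 1) * ((q ^ (r + 1) - 1) * q ^ r * gl r)"
    using glS[of "Suc r"] glS[of r] by (simp add: numeral_2_eq_2)
  also have "\<dots> = (q ^ (r + 2) - 1) * (q ^ (r + 1) - 1) * gl r * (q ^ (r + 1) * q ^ r)"
    by (simp only: mult_ac)
  also have "q ^ (r + 1) * q ^ r = q * q ^ (2 * r)" by (simp add: mult_2 power_add)
  finally show ?thesis unfolding g2 canc[OF ne] .
qed

end

text \<open>Each nonzero square has exactly two roots c and -c, which are distinct because 2 is
  nonzero.\<close>

lemma sum_squares:
  fixes g :: "'a::{finite,field} \<Rightarrow> complex"
  assumes two: "(2::'a) \<noteq> 0"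
  shows "(\<Sum>a\<in>UNIV - {0}. g (a * a)) = 2 * (\<Sum>b\<in>{b. b \<noteq> 0 \<and> (\<exists>a. b = a * a)}. g b)"
proof -
  let ?S = "{b::'a. b \<noteq> 0 \<and> (\<exists>a. b = a * a)}"
  have "(\<Sum>a\<in>UNIV - {0}. g (a * a)) = (\<Sum>b\<in>?S. \<Sum>a\<in>{a \<in> UNIV - {0}. a * a = b}. g (a * a))"
    by (rule sum.group[symmetric]) auto
  also have "\<dots> = (\<Sum>b\<in>?S. 2 * g b)"
  proof (rule sum.cong[OF refl])
    fix b assume "b \<in> ?S"
    then obtain c where c: "b = c * c" "c \<noteq> 0" by auto
    have "a = c \<or> a = - c" if "a * a = b" for a
    proof -
      have "(a - c) * (a + c) = 0" using c that by (simp add: algebra_simps)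
      then show ?thesis by (auto simp: eq_neg_iff_add_eq_0)
    qed
    then have "{a \<in> UNIV - {0}. a * a = b} = {c, - c}" using c by auto
    moreover have "c \<noteq> - c"
    proof
      assume "c = - c"
      then have "2 * c = 0" by (metis add.right_inverse mult_2)
      then show False using two c by simp
    qed
    ultimately show "(\<Sum>a\<in>{a \<in> UNIV - {0}. a * a = b}. g (a * a)) = 2 * g b"
      using c by simp
  qed
  finally show ?thesis by (simp add: sum_distrib_left)
qed

text \<open>The exponent in A is r^2 + 6r + 6, from the index and the sum over Q, plus l (l + 1)
  from the number of symmetric matrices. Here r = 2l + 1, and in the odd counterpart r = 2l.\<close>

lemma exponent_even: "nat ((5 * int (2 * l + 4) ^ 2 - 6 * int (2 * l + 4) - 4) div 4) = (2 * l + 1) ^ 2 + 6 * (2 * l + 1) + 6 + l * (l + 1)"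
proof -
  have "5 * int (2 * l + 4) ^ 2 - 6 * int (2 * l + 4) - 4 = 4 * int ((2 * l + 1) ^ 2 + 6 * (2 * l + 1) + 6 + l * (l + 1))"
    by (simp add: power2_eq_square algebra_simps)
  moreover have "4 * int k div 4 = int k" for k by simp
  ultimately show ?thesis by (simp only: nat_int)
qed

lemma exponent_odd: "nat ((5 * int (2 * l + 3) ^ 2 - 4 * int (2 * l + 3) - 9) div 4) = (2 * l) ^ 2 + 6 * (2 * l) + 6 + l * (l + 1)"
proof -
  have "5 * int (2 * l + 3) ^ 2 - 4 * int (2 * l + 3) - 9 = 4 * int ((2 * l) ^ 2 + 6 * (2 * l) + 6 + l * (l + 1))"
    by (simp add: power2_eq_square algebra_simps)
  moreover have "4 * int k div 4 = int k" for k by simp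
  ultimately show ?thesis by (simp only: nat_int)
qed

section \<open>Cardinality and constants of the double coset\<close>

context
  fixes \<epsilon> :: "'a::{finite,field}"
  assumes char3: "CHAR('a) = 3" and nonsq: "\<forall>b. b * b \<noteq> \<epsilon>"
begin

definition inter_card :: "nat \<Rightarrow> nat" where
  "inter_card r = card {z \<in> Qgrp (Suc (r + 2)) \<epsilon>. sigma_mat (Suc (r + 2)) r * z * sigma_mat (Suc (r + 2)) r \<in> Qgrp (Suc (r + 2)) \<epsilon>}"

text \<open>The factor common to the size of \<open>DC4\<close> and to its character sums. The
  number of symmetric matrices is left unevaluated here and is expanded only when
  \<open>Aconst\<close> is compared with the constants of the theorem.\<close>

definition Aconst :: "nat \<Rightarrow> real" where
  "Aconst r = (real CARD('a) + 1) * gauss2 CARD('a) (r + 2) * real CARD('a) ^ (r ^ 2 + 6 * r + 6) * real (card (symGL r :: 'a mat set))"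

lemma three: "(3::'a) = 0"
  using three_eq_0[OF char3] .

lemma eps_ne_0: "\<epsilon> \<noteq> 0"
  using nonsq by (metis mult_zero_left)

lemma q_gt_1: "1 < real CARD('a)"
  using card_field_ge_2[where 'a='a] by simp

lemma gl_rec: "real (card (GL (Suc m) :: 'a mat set)) = (real CARD('a) ^ Suc m - 1) * real CARD('a) ^ m * real (card (GL m :: 'a mat set))"
  unfolding card_GL_Suc of_nat_mult of_nat_minus_1_power of_nat_power ..

lemma gl_0: "real (card (GL 0 :: 'a mat set)) = 1"
  by (simp add: card_GL_0)

lemma sy_rec: "real (card (symGL (Suc m) :: 'a mat set)) =
    (real CARD('a) - 1) * real CARD('a) ^ m * real (card (symGL m :: 'a mat set)) +
    (real CARD('a) ^ m - 1) * real CARD('a) ^ m * real (card (symGL (m - 1) :: 'a mat set))"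
  unfolding card_symGL_Suc of_nat_mult of_nat_add of_nat_minus_1_power of_nat_power
  using of_nat_minus_1_power[of 1, where 'a='a] by simp

lemma sy_0: "real (card (symGL 0 :: 'a mat set)) = 1"
  by (simp add: symGL_0)

lemmas gl_facts = q_gt_1 gl_0 gl_rec sy_0 sy_rec

lemma sum_upto_add_2: fixes r :: nat shows "(\<Sum>i<r + 2. i) = (\<Sum>i<r. i) + (2 * r + 1)"
  by simp

lemma sum_lessThan_double: fixes r :: nat shows "2 * (\<Sum>i<r. i) + r = r ^ 2"
  by (induction r) (auto simp: power2_eq_square)

text \<open>The last factor is the index of the intersection of Q with its conjugate in Q. It
  multiplies both |Q| and the sum over Q, and positivity of \<open>inter_card\<close> allows
  cancelling the fibre size.\<close>

lemma card_Qgrp_eq: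
  "real (card (Qgrp (Suc (r + 2)) \<epsilon>)) = real (inter_card r) * (gauss2 CARD('a) (r + 2) * real CARD('a) ^ (2 * r + (\<Sum>i<r. i)))"
  "inter_card r > 0"
proof -
  let ?q = "real CARD('a)" and ?gl = "\<lambda>m. real (card (GL m :: 'a mat set))"
  have s: "(\<Sum>i = r..<r + 2. i) = 2 * r + 1" by simp
  have I: "real (inter_card r) = ?gl r * (?q ^ (2 * r) * ?gl 2) * ((?q + 1) * (?q ^ 4 * ?q ^ (2 * r + 1)))"
    unfolding inter_card_def card_Qgrp_inter[OF three nonsq, of r 2] card_lowGL s
    by (simp only: of_nat_mult of_nat_power of_nat_add of_nat_1, simp)
  have Q: "real (card (Qgrp (Suc (r + 2)) \<epsilon>)) = ?gl (r + 2) * ((?q + 1) * (?q ^ (2 * (r + 2)) * ?q ^ (\<Sum>i<r + 2. i)))"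
    unfolding card_Qgrp[OF three nonsq] by (simp only: of_nat_mult of_nat_power of_nat_add of_nat_1)
  have g: "?gl (r + 2) = gauss2 CARD('a) (r + 2) * (?gl r * ?gl 2 * ?q ^ (2 * r))"
    using gl_gauss[of ?q ?gl "\<lambda>m. real (card (symGL m :: 'a mat set))", OF gl_facts, of r] by (simp add: gauss2_def)
  have e: "2 * (r + 2) + (\<Sum>i<r + 2. i) = 4 + (2 * r + 1) + (2 * r + (\<Sum>i<r. i))"
    unfolding sum_upto_add_2 by simp
  have "?q ^ (2 * (r + 2)) * ?q ^ (\<Sum>i<r + 2. i) = ?q ^ 4 * ?q ^ (2 * r + 1) * ?q ^ (2 * r + (\<Sum>i<r. i))"
    by (simp only: power_add[symmetric] e)
  then show "real (card (Qgrp (Suc (r + 2)) \<epsilon>)) = real (inter_card r) * (gauss2 CARD('a) (r + 2) * ?q ^ (2 * r + (\<Sum>i<r. i)))"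
    unfolding Q I g by (simp only: mult_ac)
  have "?gl m > 0" for m
    by (rule gl_pos[of ?q ?gl "\<lambda>m. real (card (symGL m :: 'a mat set))", OF gl_facts])
  then have "real (inter_card r) > 0" unfolding I using q_gt_1
    by (intro mult_pos_pos zero_less_power) auto
  then show "inter_card r > 0" by simp
qed

text \<open>On the left the factors stay grouped as they arise: the index, then the sum over Q
  stripped of its sign and of the Kloosterman expression.\<close>

lemma Aconst_eq:
  "gauss2 CARD('a) (r + 2) * real CARD('a) ^ (2 * r + (\<Sum>i<r. i)) *
    ((real CARD('a) + 1) * real CARD('a) ^ (\<Sum>i<r + 2. i) * (real (card (symGL r :: 'a mat set)) * real CARD('a) ^ (2 * r) * (real CARD('a) ^ 4 * real CARD('a) ^ r) * real CARD('a))) = Aconst r"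
proof -
  let ?q = "real CARD('a)"
  have "2 * r + (\<Sum>i<r. i) + (\<Sum>i<r + 2. i) + 2 * r + 4 + r + 1 = r ^ 2 + 6 * r + 6"
    unfolding sum_upto_add_2 sum_lessThan_double[of r, symmetric] by simp
  then have "?q ^ (r ^ 2 + 6 * r + 6) = ?q ^ (2 * r + (\<Sum>i<r. i)) * ?q ^ (\<Sum>i<r + 2. i) * ?q ^ (2 * r) * ?q ^ 4 * ?q ^ r * ?q ^ 1"
    by (metis power_add)
  then show ?thesis unfolding Aconst_def by (simp only: power_one_right mult_ac)
qed

text \<open>The division by A^h in the moment identity rests on this.\<close>

lemma Aconst_pos: "Aconst r > 0"
proof -
  let ?q = "real CARD('a)"
  have p: "1 < ?q ^ Suc m" for m using one_less_power[OF q_gt_1, of "Suc m"] by simp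
  have "gauss2 CARD('a) (r + 2) > 0"
    unfolding gauss2_def using p[of 1] p[of "r + 1"] p[of r] q_gt_1
    by (intro divide_pos_pos mult_pos_pos) (simp_all add: numeral_2_eq_2)
  moreover have "real (card (symGL r :: 'a mat set)) > 0"
  proof -
    have "1\<^sub>m r \<in> (symGL r :: 'a mat set)" by (simp add: symGL_def)
    moreover have "finite (symGL r :: 'a mat set)" by (rule finite_subset[OF _ finite_GL]) (auto simp: symGL_def)
    ultimately show ?thesis by (auto simp: card_gt_0_iff)
  qed
  ultimately show ?thesis unfolding Aconst_def using q_gt_1
    by (intro mult_pos_pos zero_less_power) auto
qed

lemma card_DC4_eq: "real (card (DC4 (Suc (r + 2)) \<epsilon>)) = Aconst r * Bconst (real CARD('a)) r"
proof -
  let ?q = "real CARD('a)" and ?gl = "\<lambda>m. real (card (GL m :: 'a mat set))" and ?s = "real (card (symGL r :: 'a mat set))"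
  let ?G = "gauss2 CARD('a) (r + 2) * ?q ^ (2 * r + (\<Sum>i<r. i))"
  note Q = card_Qgrp_eq[of r]
  have "real (inter_card r) * real (card (DC4 (Suc (r + 2)) \<epsilon>)) = real (card (Qgrp (Suc (r + 2)) \<epsilon>)) * real (card (Qgrp (Suc (r + 2)) \<epsilon>))"
    using card_DC4[OF eps_ne_0, of r] unfolding inter_card_def by (simp only: of_nat_mult[symmetric])
  also have "\<dots> = real (inter_card r) * (?G * real (card (Qgrp (Suc (r + 2)) \<epsilon>)))"
    unfolding Q(1) by (simp only: mult_ac)
  finally have "real (card (DC4 (Suc (r + 2)) \<epsilon>)) = ?G * real (card (Qgrp (Suc (r + 2)) \<epsilon>))" using Q(2) by simp
  also have "real (card (Qgrp (Suc (r + 2)) \<epsilon>)) = ?gl (r + 2) * ((?q + 1) * (?q ^ (2 * (r + 2)) * ?q ^ (\<Sum>i<r + 2. i)))"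
    unfolding card_Qgrp[OF three nonsq] by (simp only: of_nat_mult of_nat_power of_nat_add of_nat_1)
  also have "?gl (r + 2) = ?q ^ (r + 1) * ?s * Bconst ?q r"
    using gl_eq_Bconst[of ?q ?gl "\<lambda>m. real (card (symGL m :: 'a mat set))", OF gl_facts, of r] ..
  also have "?G * (?q ^ (r + 1) * ?s * Bconst ?q r * ((?q + 1) * (?q ^ (2 * (r + 2)) * ?q ^ (\<Sum>i<r + 2. i)))) =
    ?G * ((?q + 1) * ?q ^ (\<Sum>i<r + 2. i) * (?s * ?q ^ (2 * r) * (?q ^ 4 * ?q ^ r) * ?q)) * Bconst ?q r"
  proof -
    have "2 * (r + 2) = 2 * r + 4" by simp
    then show ?thesis by (simp only: power_add power_one_right mult_ac)
  qed
  finally show ?thesis unfolding Aconst_eq .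
qed

lemma Aconst_A4:
  assumes "n = Suc (r + 2)"
  shows "Aconst r = (if even n then A4plus n CARD('a) else A4minus n CARD('a))"
proof (cases "even r")
  case True
  then obtain l where r: "r = 2 * l" by auto
  have n: "n = 2 * l + 3" using assms r by simp
  have s: "real (card (symGL r :: 'a mat set)) = real CARD('a) ^ (l * (l + 1)) * (\<Prod>j = 1..l. real CARD('a) ^ (2 * j - 1) - 1)"
    using sy_closed[of "real CARD('a)" "\<lambda>m. real (card (GL m :: 'a mat set))" "\<lambda>m. real (card (symGL m :: 'a mat set))", OF gl_facts, of l] r by simp
  have f: "n - 1 = r + 2" "(n - 3) div 2 = l" "even n = False" using n r by auto
  have e: "nat ((5 * int n ^ 2 - 4 * int n - 9) div 4) = r ^ 2 + 6 * r + 6 + l * (l + 1)"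
    unfolding n r by (rule exponent_odd)
  show ?thesis
    unfolding A4minus_def Aconst_def s f e by (simp only: if_False power_add mult_ac)
next
  case False
  then obtain l where r: "r = 2 * l + 1" by (elim oddE)
  have n: "n = 2 * l + 4" using assms r by simp
  have s: "real (card (symGL r :: 'a mat set)) = real CARD('a) ^ (l * (l + 1)) * (\<Prod>j = 1..Suc l. real CARD('a) ^ (2 * j - 1) - 1)"
    using sy_closed[of "real CARD('a)" "\<lambda>m. real (card (GL m :: 'a mat set))" "\<lambda>m. real (card (symGL m :: 'a mat set))", OF gl_facts, of l] r by simp
  have f: "n - 1 = r + 2" "(n - 2) div 2 = Suc l" "even n = True" using n r by auto
  have e: "nat ((5 * int n ^ 2 - 6 * int n - 4) div 4) = r ^ 2 + 6 * r + 6 + l * (l + 1)"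
    unfolding n r by (rule exponent_even)
  show ?thesis
    unfolding A4plus_def Aconst_def s f e by (simp only: if_True power_add mult_ac)
qed

lemma Bconst_B4:
  assumes "n = Suc (r + 2)"
  shows "Bconst (real CARD('a)) r = (if even n then B4plus n CARD('a) else B4minus n CARD('a))"
proof (cases "even r")
  case True
  then obtain l where r: "r = 2 * l" by auto
  have n: "n = 2 * l + 3" using assms r by simp
  have "(n - 3) ^ 2 div 4 = l ^ 2" using n by (simp add: power2_eq_square)
  moreover have "n - 2 = r + 1" "n - 1 = r + 2" "(n - 3) div 2 = l" "odd n" "r div 2 = l" using n r by auto
  ultimately show ?thesis using True unfolding B4minus_def by (simp only: Bconst_def[OF gl_facts] if_True if_False)
next
  case False
  then obtain l where r: "r = 2 * l + 1" by (elim oddE)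
  have n: "n = 2 * l + 4" using assms r by simp
  have "n - 2 = 2 * (l + 1)" using n by simp
  then have "(n - 2) ^ 2 div 4 = (l + 1) ^ 2" by (simp add: power2_eq_square)
  moreover have "n - 1 = r + 2" "(n - 2) div 2 = l + 1" "even n" "r div 2 = l" using n r by auto
  ultimately show ?thesis using False unfolding B4plus_def by (simp only: Bconst_def[OF gl_facts] if_True if_False)
qed

section \<open>Weights and their power moments\<close>

interpretation lam: additive_character "lam :: 'a \<Rightarrow> complex"
proof
  show "lam (x + y) = lam x * lam (y :: 'a)" for x y by (rule lam_add[OF char3])
  show "lam (0 :: 'a) = 1"
  proof -
    have "lam (0 :: 'a) * lam (0 :: 'a) = lam (0 :: 'a)" using lam_add[OF char3, of 0 0] by simp
    moreover have "lam (0 :: 'a) \<noteq> 0" by (simp add: lam_def)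
    ultimately show ?thesis by simp
  qed
  show "\<exists>x :: 'a. lam x \<noteq> 1" by (rule lam_nontrivial[OF char3])
qed

text \<open>Substituting \<open>a * x\<close> for the summation variable collects the scaling of
  both terms in the second one, as the factor a^2. This is where squares enter the theorem.\<close>

lemma kloosterman_eq_Kl:
  assumes a: "a \<noteq> (0::'a)"
  shows "lam.kloosterman a = Kl (a * a)"
  unfolding lam.kloosterman_def Kl_def
  by (rule sum.reindex_bij_witness[of _ "\<lambda>x. x / a" "\<lambda>x. a * x"]) (use a in \<open>auto simp: field_simps\<close>)

text \<open>The index times the sum over Q; the sign is that of the Gauss sum (-q)^r, and the
  bracket is the sum over GL(2, q) without its factor q.\<close>

lemma DC4_lam_sum:
  assumes a: "a \<noteq> (0::'a)"
  shows "(\<Sum>w\<in>DC4 (Suc (r + 2)) \<epsilon>. lam (a * mat_tr w)) =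
    (-1) ^ r * of_real (Aconst r) * (Kl (a * a) ^ 2 + of_nat CARD('a) ^ 2 - of_nat CARD('a))"
proof -
  let ?q = "of_nat CARD('a) :: complex" and ?E = "\<Sum>w\<in>DC4 (Suc (r + 2)) \<epsilon>. lam (a * mat_tr w)"
  let ?X = "Kl (a * a) ^ 2 + ?q ^ 2 - ?q" and ?s = "of_nat (card (symGL r :: 'a mat set)) :: complex"
  let ?G = "gauss2 CARD('a) (r + 2) * real CARD('a) ^ (2 * r + (\<Sum>i<r. i))"
  have "of_nat (inter_card r) * ?E = of_nat (card (Qgrp (Suc (r + 2)) \<epsilon>)) *
     (of_nat (CARD('a) + 1) * ?q ^ (\<Sum>i<r + 2. i) * (?s * ?q ^ (2 * r) * (?q ^ (2 * 2) * (- ?q) ^ r) * (?q * ?X)))"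
    unfolding inter_card_def lam.DC4_character_sum[OF eps_ne_0] lam.sum_Qgrp_rho_sigma[OF three nonsq a]
      lam.sum_GL2[OF a] kloosterman_eq_Kl[OF a] ..
  also have "(of_nat (card (Qgrp (Suc (r + 2)) \<epsilon>)) :: complex) = of_nat (inter_card r) * of_real ?G"
  proof -
    have "(of_nat (card (Qgrp (Suc (r + 2)) \<epsilon>)) :: complex) = of_real (real (card (Qgrp (Suc (r + 2)) \<epsilon>)))" by simp
    also have "\<dots> = of_real (real (inter_card r) * ?G)" by (simp only: card_Qgrp_eq(1))
    finally show ?thesis by simp
  qed
  also have "of_nat (inter_card r) * of_real ?G * (of_nat (CARD('a) + 1) * ?q ^ (\<Sum>i<r + 2. i) * (?s * ?q ^ (2 * r) * (?q ^ (2 * 2) * (- ?q) ^ r) * (?q * ?X))) =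
     of_nat (inter_card r) * ((-1) ^ r * of_real (?G * ((real CARD('a) + 1) * real CARD('a) ^ (\<Sum>i<r + 2. i) * (real (card (symGL r :: 'a mat set)) * real CARD('a) ^ (2 * r) * (real CARD('a) ^ 4 * real CARD('a) ^ r) * real CARD('a)))) * ?X)"
  proof -
    have "(- ?q) ^ r = (-1) ^ r * ?q ^ r" by (rule power_minus)
    then show ?thesis by (simp del: sum.lessThan_Suc add: mult_ac)
  qed
  finally show ?thesis unfolding Aconst_eq using card_Qgrp_eq(2)[of r] by simp
qed

lemma finite_DC4: "finite (DC4 (Suc (r + 2)) \<epsilon>)"
proof -
  have "finite {x. x \<in> Qgrp (Suc (r + 2)) \<epsilon>}"
    using finite_subset[OF Qgrp_GL[OF eps_ne_0, of "r + 2"] finite_GL] by simp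
  then show ?thesis unfolding DC4_def by (intro finite_image_set2)
qed

text \<open>The weight is 2/3 of the difference between the size of the double coset and its
  character sum. Both contain A, so A can be factored out.\<close>

lemma weight_eq:
  assumes a: "a \<noteq> (0::'a)"
  shows "of_nat (card {w \<in> DC4 (Suc (r + 2)) \<epsilon>. lam (a * mat_tr w) \<noteq> 1}) =
    (2 / 3) * of_real (Aconst r) * (of_real (Bconst (real CARD('a)) r) - (-1) ^ r * (Kl (a * a) ^ 2 + of_nat CARD('a) ^ 2 - of_nat CARD('a)))"
proof -
  let ?D = "DC4 (Suc (r + 2)) \<epsilon>" and ?X = "Kl (a * a) ^ 2 + of_nat CARD('a) ^ 2 - of_nat CARD('a)"
  note fin = finite_DC4[of r]
  have "(of_nat (card {w \<in> ?D. lam (a * mat_tr w) \<noteq> 1}) :: complex) = (\<Sum>w\<in>?D. if lam (a * mat_tr w) \<noteq> 1 then 1 else 0)"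
    using fin by (simp add: sum.If_cases Int_def)
  also have "\<dots> = (\<Sum>w\<in>?D. 2 / 3 - (1 / 3) * (lam (a * mat_tr w) + lam ((- a) * mat_tr w)))"
  proof (rule sum.cong[OF refl])
    fix w
    have e: "{0..<3} = {0, 1, 2::nat}" by auto
    \<comment> \<open>The term k = 2 of the Fourier expansion is the character at -a, because 2 =
      -1.\<close>
    have "a * (mat_tr w * 2) = - (a * mat_tr w)"
    proof -
      have "a * (mat_tr w * 2) = 3 * (a * mat_tr w) - a * mat_tr w" by (simp add: algebra_simps)
      then show ?thesis using three by simp
    qed
    then have "lam (a * (mat_tr w * 2)) = lam (- (a * mat_tr w))" by (rule arg_cong)
    then show "(if lam (a * mat_tr w) \<noteq> 1 then 1 else 0) = 2 / 3 - (1 / 3) * (lam (a * mat_tr w) + lam ((- a) * mat_tr w))"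
      unfolding lam.indicator_ne_1[OF char3] e by (simp add: algebra_simps)
  qed
  also have "\<dots> = (2 / 3) * of_nat (card ?D) - (1 / 3) * ((\<Sum>w\<in>?D. lam (a * mat_tr w)) + (\<Sum>w\<in>?D. lam ((- a) * mat_tr w)))"
    unfolding sum_subtractf sum_distrib_left[symmetric] sum.distrib by simp
  also have "(of_nat (card ?D) :: complex) = of_real (Aconst r * Bconst (real CARD('a)) r)"
    unfolding card_DC4_eq[symmetric] by simp
  \<comment> \<open>The character sum depends on a only through a^2.\<close>
  also have "(\<Sum>w\<in>?D. lam ((- a) * mat_tr w)) = (\<Sum>w\<in>?D. lam (a * mat_tr w))"
    using DC4_lam_sum[of a r] DC4_lam_sum[of "- a" r] a by simp
  finally show ?thesis unfolding DC4_lam_sum[OF a] by (simp add: algebra_simps)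
qed

text \<open>The h-th moment of the weights is evaluated twice, by \<open>sum_power_weight\<close>
  over the code and by the binomial theorem applied to \<open>weight_eq\<close>. The term l = h is
  kept on the left, so the recursion of the theorem is a rearrangement.\<close>

lemma moment_identity:
  fixes r h :: nat
  defines "\<eta> \<equiv> - ((-1) ^ r) :: complex" and "A \<equiv> Aconst r" and "B \<equiv> Bconst (real CARD('a)) r"
    and "N \<equiv> card (DC4 (Suc (r + 2)) \<epsilon>)" and "C \<equiv> weight_dist (DC4 (Suc (r + 2)) \<epsilon>)"
  assumes h: "h \<ge> 1"
  shows "(\<Sum>l\<le>h. \<eta> ^ l * of_nat (h choose l) * (of_real B + \<eta> * (of_nat CARD('a) ^ 2 - of_nat CARD('a))) ^ (h - l) * SK TYPE('a) (2 * l)) =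
    of_nat CARD('a) * of_real A powi (- int h) *
      (\<Sum>j = 0..min N h. (-1) ^ j * of_nat (C j) *
        (\<Sum>t = j..h. of_nat (fact t * Stirling h t) * 3 ^ (h - t) * (2::complex) powi (int t - int h - int j - 1)
           * of_nat (if t \<le> N then (N - j) choose (N - t) else 0)))" (is "?S = _")
proof -
  let ?q = "of_nat CARD('a) :: complex" and ?D = "DC4 (Suc (r + 2)) \<epsilon>"
  let ?Sq = "{b::'a. b \<noteq> 0 \<and> (\<exists>a. b = a * a)}"
  define B' where "B' = of_real B + \<eta> * (?q ^ 2 - ?q)"
  define R where "R = (\<Sum>j = 0..min N h. (-1) ^ j * of_nat (C j) * (\<Sum>t = j..h. of_nat (fact t * Stirling h t) * (1/3) ^ t * 2 ^ (t - j) *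
        of_nat (if t \<le> N then (N - j) choose (N - t) else 0)) :: complex)"
  define P where "P = ((2 / 3) * of_real A :: complex) ^ h"
  have A0: "(of_real A :: complex) \<noteq> 0" using Aconst_pos[of r] by (simp add: A_def)
  define w where "w a = card {g \<in> ?D. lam (a * mat_tr g) \<noteq> 1}" for a :: 'a
  have "?q * R = (\<Sum>a\<in>UNIV. of_nat (w a) ^ h)"
    unfolding w_def lam.sum_power_weight[OF char3 finite_DC4] R_def N_def C_def ..
  \<comment> \<open>The term a = 0 has weight 0 and disappears because h is positive;
    \<open>weight_eq\<close> would not apply to it.\<close>
  also have "\<dots> = (\<Sum>a\<in>UNIV - {0}. of_nat (w a) ^ h)"
  proof -
    have "w 0 = 0" by (simp add: w_def)
    then show ?thesis using h by (intro sum.mono_neutral_right) auto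
  qed
  also have "\<dots> = (\<Sum>a\<in>UNIV - {0 :: 'a}. P * (\<eta> * Kl (a * a) ^ 2 + B') ^ h)"
  proof (rule sum.cong[OF refl])
    fix a :: 'a assume "a \<in> UNIV - {0}"
    then have "of_nat (w a) = (2 / 3) * of_real A * (of_real B - (-1) ^ r * (Kl (a * a) ^ 2 + ?q ^ 2 - ?q))"
      unfolding w_def A_def B_def by (intro weight_eq) simp
    also have "of_real B - (-1) ^ r * (Kl (a * a) ^ 2 + ?q ^ 2 - ?q) = \<eta> * Kl (a * a) ^ 2 + B'"
      by (simp add: \<eta>_def B'_def algebra_simps)
    finally have "(of_nat (w a) :: complex) = (2 / 3) * of_real A * (\<eta> * Kl (a * a) ^ 2 + B')" .
    then show "of_nat (w a) ^ h = P * (\<eta> * Kl (a * a) ^ 2 + B') ^ h" by (simp only: P_def power_mult_distrib)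
  qed
  also have "\<dots> = 2 * (\<Sum>b\<in>?Sq. P * (\<eta> * Kl b ^ 2 + B') ^ h)"
    by (rule sum_squares[OF two_ne_0[OF three]])
  also have "\<dots> = 2 * P * (\<Sum>b\<in>?Sq. \<Sum>l\<le>h. of_nat (h choose l) * (\<eta> * Kl b ^ 2) ^ l * B' ^ (h - l))"
    by (simp only: binomial_ring sum_distrib_left mult.assoc)
  also have "(\<Sum>b\<in>?Sq. \<Sum>l\<le>h. of_nat (h choose l) * (\<eta> * Kl b ^ 2) ^ l * B' ^ (h - l)) = ?S"
  proof (subst sum.swap, rule sum.cong[OF refl])
    fix l
    have "(\<eta> * Kl b ^ 2) ^ l = \<eta> ^ l * Kl b ^ (2 * l)" for b :: 'a
      by (simp only: power_mult_distrib power_mult)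
    then show "(\<Sum>b\<in>?Sq. of_nat (h choose l) * (\<eta> * Kl b ^ 2) ^ l * B' ^ (h - l)) =
      \<eta> ^ l * of_nat (h choose l) * (of_real B + \<eta> * (?q ^ 2 - ?q)) ^ (h - l) * SK TYPE('a) (2 * l)"
      by (simp only: SK_def sum_distrib_left B'_def[symmetric] mult_ac)
  qed
  finally have eq: "?q * R = 2 * P * ?S" .
  have P0: "P \<noteq> 0" using A0 by (simp add: P_def)
  have "?S = ?q * R / (2 * P)" unfolding eq using P0 by simp
  \<comment> \<open>The denominator 2^(h + 1) combines 2^h from the factor (2A/3)^h with the 2 from
    counting square roots. Distributed over the terms with (1/3)^t and 2^(t - j), the quotient 3^h /
    2^(h + 1) gives the stated powers; the exponent of 2 is negative, hence
    \<open>powi\<close>.\<close>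
  also have "\<dots> = ?q * of_real A powi (- int h) * (R * (3 ^ h / 2 ^ (h + 1)))"
    using A0 unfolding P_def by (simp add: power_int_minus power_mult_distrib power_divide field_simps)
  also have "R * (3 ^ h / 2 ^ (h + 1)) = (\<Sum>j = 0..min N h. (-1) ^ j * of_nat (C j) *
        (\<Sum>t = j..h. of_nat (fact t * Stirling h t) * 3 ^ (h - t) * (2::complex) powi (int t - int h - int j - 1)
           * of_nat (if t \<le> N then (N - j) choose (N - t) else 0)))"
    unfolding R_def sum_distrib_right sum_distrib_left
  proof (intro sum.cong refl)
    fix j t assume "t \<in> {j..h}"
    then have jt: "j \<le> t" "t \<le> h" by auto
    have "(3::complex) ^ h = 3 ^ (h - t) * 3 ^ t" using jt by (simp only: power_add[symmetric] le_add_diff_inverse2)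
    then have t3: "(1/3) ^ t * (3::complex) ^ h = 3 ^ (h - t)" by (simp add: power_divide)
    have "int t - int h - int j - 1 = int (t - j) - int (h + 1)" using jt by simp
    moreover have "(2::complex) powi (int (t - j) - int (h + 1)) = 2 powi int (t - j) / 2 powi int (h + 1)"
      by (rule power_int_diff) simp
    ultimately have t2: "(2::complex) powi (int t - int h - int j - 1) = 2 ^ (t - j) / 2 ^ (h + 1)"
      by (simp only: power_int_of_nat)
    show "(-1) ^ j * of_nat (C j) * (of_nat (fact t * Stirling h t) * (1/3) ^ t * 2 ^ (t - j) * of_nat (if t \<le> N then (N - j) choose (N - t) else 0)) * (3 ^ h / 2 ^ (h + 1)) =
      (-1) ^ j * of_nat (C j) * (of_nat (fact t * Stirling h t) * 3 ^ (h - t) * (2::complex) powi (int t - int h - int j - 1)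
           * of_nat (if t \<le> N then (N - j) choose (N - t) else 0))"
      unfolding t2 t3[symmetric] by (simp only: times_divide_eq_right times_divide_eq_left mult_ac)
  qed
  finally show ?thesis .
qed

end

theorem theorem1:
  fixes \<epsilon> :: "'a::{finite,field}" and n :: nat
  assumes char3: "CHAR('a) = 3"
    and nonsq: "\<forall>b::'a. b * b \<noteq> \<epsilon>"
    and hn: "(even n \<and> n \<ge> 4) \<or> (odd n \<and> n \<ge> 3)"
  defines "q \<equiv> CARD('a)"
    and "\<eta> \<equiv> (if even n then 1 else -1 :: complex)"
    and "A \<equiv> (if even n then A4plus n CARD('a) else A4minus n CARD('a))"
    and "B \<equiv> (if even n then B4plus n CARD('a) else B4minus n CARD('a))"
    and "N \<equiv> card (DC4 n \<epsilon>)"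
    and "C \<equiv> weight_dist (DC4 n \<epsilon>)"
  shows "real N = A * B \<and>
    (\<forall>h::nat. h \<ge> 1 \<longrightarrow>
      \<eta> ^ h * SK TYPE('a) (2 * h) =
        - (\<Sum>l = 0..h - 1. \<eta> ^ l * of_nat (h choose l)
              * (of_real B + \<eta> * (of_nat q ^ 2 - of_nat q)) ^ (h - l) * SK TYPE('a) (2 * l))
        + of_nat q * of_real A powi (- int h)
          * (\<Sum>j = 0..min N h. (-1) ^ j * of_nat (C j)
              * (\<Sum>t = j..h. of_nat (fact t * Stirling h t) * 3 ^ (h - t)
                  * (2::complex) powi (int t - int h - int j - 1)
                  * of_nat (if t \<le> N then (N - j) choose (N - t) else 0))))"
proof (intro conjI allI impI)
  define r where "r = n - 3"
  have n: "n = Suc (r + 2)" using hn by (auto simp: r_def)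
  have A: "A = Aconst TYPE('a) r" unfolding A_def by (rule Aconst_A4[OF char3 nonsq n, symmetric])
  have B: "B = Bconst (real CARD('a)) r" unfolding B_def by (rule Bconst_B4[OF char3 nonsq n, symmetric])
  have \<eta>: "\<eta> = - ((-1) ^ r)" unfolding \<eta>_def n by simp
  show "real N = A * B" unfolding N_def A B n by (rule card_DC4_eq[OF char3 nonsq])
  fix h :: nat assume h: "h \<ge> 1"
  let ?f = "\<lambda>l. \<eta> ^ l * of_nat (h choose l) * (of_real B + \<eta> * (of_nat q ^ 2 - of_nat q)) ^ (h - l) * SK TYPE('a) (2 * l)"
  \<comment> \<open>The term l = h, where the power of the bracket is 1, is the left side of the
    recursion; h \<ge> 1 makes h - 1 the true predecessor.\<close>
  have "{..h} = insert h {0..h - 1}" using h by auto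
  then have "(\<Sum>l\<le>h. ?f l) = ?f h + (\<Sum>l = 0..h - 1. ?f l)" using h by simp
  moreover have "?f h = \<eta> ^ h * SK TYPE('a) (2 * h)" by simp
  moreover note moment_identity[OF char3 nonsq h, of r, folded \<eta> A B n N_def C_def q_def]
  ultimately show "\<eta> ^ h * SK TYPE('a) (2 * h) =
        - (\<Sum>l = 0..h - 1. ?f l)
        + of_nat q * of_real A powi (- int h)
          * (\<Sum>j = 0..min N h. (-1) ^ j * of_nat (C j)
              * (\<Sum>t = j..h. of_nat (fact t * Stirling h t) * 3 ^ (h - t)
                  * (2::complex) powi (int t - int h - int j - 1)
                  * of_nat (if t \<le> N then (N - j) choose (N - t) else 0)))"
    by (simp only: eq_neg_iff_add_eq_0) (simp add: algebra_simps)
qed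

end
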